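(* Let $\mathscr{L}\subset\mathbb{R}$ denote the closure (in $\mathbb{R}$) of the set of real numbers of the form $\mathscr{M}(\beta)$ for cyclotomic integers $\beta$. Then $\mathscr{L}$ is a closed subset of $\mathbb{Q}$; that is, $\mathscr{L}$ is a closed subset of $\mathbb{R}$ all of whose elements are rational.
   Context: A cyclotomic integer is an algebraic integer lying in some cyclotomic field $\mathbb{Q}(\zeta_N)$. For an algebraic integer $\beta$, $\mathscr{M}(\beta)$ denotes the average value of the real numbers $|\sigma\beta|^2$, where $\sigma\beta$ runs over all conjugates of $\beta$ over $\mathbb{Q}$. *)

theory Defs
  imports
    "HOL-Analysis.Analysis"
    "HOL-Computational_Algebra.Computational_Algebra"
begin

definition complex_subfield :: "complex set \<Rightarrow> bool" where
  "complex_subfield K \<longleftrightarrow> 1 \<in> K \<and>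
     (\<forall>x\<in>K. \<forall>y\<in>K. x - y \<in> K \<and> x * y \<in> K) \<and> (\<forall>x\<in>K. inverse x \<in> K)"

(* A subfield of the complex numbers contains the rationals, so this is the
   field generated over the rationals by the primitive N-th root of unity exp (2 pi i / N). *)
definition cyclotomic_field :: "nat \<Rightarrow> complex set" where
  "cyclotomic_field N = \<Inter>{K. complex_subfield K \<and> cis (2 * pi / real N) \<in> K}"

definition cyclotomic_integer :: "complex \<Rightarrow> bool" where
  "cyclotomic_integer \<beta> \<longleftrightarrow> algebraic_int \<beta> \<and> (\<exists>N\<ge>1. \<beta> \<in> cyclotomic_field N)"

definition is_minimal_polynomial :: "rat poly \<Rightarrow> complex \<Rightarrow> bool" where
  "is_minimal_polynomial p \<beta> \<longleftrightarrow>
     lead_coeff p = 1 \<and> irreducible p \<and> poly (map_poly of_rat p) \<beta> = 0"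

(* For algebraic \<beta> the polynomial p below is unique; the set is empty if \<beta> is transcendental. *)
definition conjugates :: "complex \<Rightarrow> complex set" where
  "conjugates \<beta> = {\<gamma>. \<exists>p. is_minimal_polynomial p \<beta> \<and> poly (map_poly of_rat p) \<gamma> = 0}"

definition mean_sq_conj :: "complex \<Rightarrow> real" where
  "mean_sq_conj \<beta> = (\<Sum>\<gamma>\<in>conjugates \<beta>. (cmod \<gamma>)\<^sup>2) / real (card (conjugates \<beta>))"

definition mean_sq_closure :: "real set" where
  "mean_sq_closure = closure {mean_sq_conj \<beta> | \<beta>. cyclotomic_integer \<beta>}"

end

theory Submission
  imports Defs "HOL-Number_Theory.Cong"
begin

text \<open>
  Write \<open>M(x)\<close> for the mean of the squared absolute values of the conjugates of \<open>x\<close> and \<open>E(x)\<close> for the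
  mean of the conjugates, so that \<open>M(x) = E(x cnj(x))\<close> and \<open>E\<close> is linear on each cyclotomic field.

  The key point is Loxton's theorem in qualitative form: if \<open>M(x) \<le> B\<close>, then \<open>x\<close> is a sum of at most
  \<open>C(B)\<close> roots of unity. For a prime \<open>p\<close> write \<open>x = \<Sum>i<p. \<omega>^i \<alpha>(i)\<close> with \<open>\<alpha>(i) \<in> \<int>[\<zeta>(n)]\<close>, where
  \<open>x \<in> \<int>[\<zeta>(pn)]\<close>. If \<open>p\<close> divides \<open>n\<close> then \<open>M(x) = \<Sum>i. M(\<alpha>(i))\<close>; otherwise
  \<open>2(p - 1)M(x) = \<Sum>i. \<Sum>j. M(\<alpha>(i) - \<alpha>(j))\<close>. As \<open>M \<ge> 1\<close> on nonzero integers, when \<open>p\<close> divides \<open>n\<close> or \<open>p\<close> is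
  large in terms of \<open>B\<close>, either \<open>x\<close> is a root of unity times an element of \<open>\<int>[\<zeta>(n)]\<close>, or \<open>x\<close> has at most
  \<open>2B\<close> nonzero components (after a shift of the \<open>\<alpha>(i)\<close>), each with \<open>M \<le> B - 1/2\<close>. What remains is the single level
  \<open>P!\<close> with \<open>P\<close> depending on \<open>B\<close>, where only finitely many integers have \<open>M \<le> B\<close>.

  If \<open>x\<close> is a sum of \<open>k\<close> roots of unity, then \<open>M(x)\<close> is a sum of \<open>k^2\<close> values of \<open>E\<close> at roots of unity. These
  values are \<open>0\<close> or products of numbers \<open>-1/(p - 1)\<close> over distinct primes, hence form a compact set of rationals
  with \<open>0\<close> as its only limit point, and \<open>k^2\<close>-fold sums from it again form a compact set of rationals.
\<close>

section \<open>Evaluation of integer polynomials at roots of unity\<close>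

text \<open>At each level only finitely many integers have M \<le> B, but this gives nothing
  uniform, and the closure mixes all levels; so C must depend on B alone. If a single component
  carries x, the level drops while M and the number of roots of unity stay the same, so the same C
  serves however often this happens. If several do, C grows, but B drops by a fixed amount, which
  happens boundedly often. The drop is 1/2 and not 1 because, when p is prime to n and X is the
  number of nonzero shifted components, only (p - X) S \<le> (p - 1) M(x) is available for the sum S
  of their values of M; the factor (p - 1)/(p - X) exceeds 1 for X > 1 and comes close to 1 only for
  large p.

  All this happens in Z[zeta], whereas a cyclotomic integer is just an algebraic integer of the
  field. Hence the ring of integers has to be identified with Z[zeta]. The Galois group itself is
  never formed: an automorphism replaces zeta by a power of zeta in an integer polynomial, and
  irreducibility of the cyclotomic polynomial makes this well defined.\<close>

definition ev :: "int poly \<Rightarrow> complex \<Rightarrow> complex" where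
  "ev f z = poly (map_poly of_int f) z"

lemma ev_0 [simp]: "ev 0 z = 0"
  and ev_1 [simp]: "ev 1 z = 1"
  and ev_pCons [simp]: "ev (pCons a f) z = of_int a + z * ev f z"
  by (simp_all add: ev_def map_poly_pCons)

lemma ev_add [simp]: "ev (f + g) z = ev f z + ev g z"
proof (induction f arbitrary: g)
  case (pCons a f)
  obtain b h where "g = pCons b h" by (cases g)
  then show ?case by (simp add: pCons.IH algebra_simps)
qed simp

lemma ev_smult [simp]: "ev (smult c f) z = of_int c * ev f z"
  by (induction f) (auto simp: algebra_simps)

lemma ev_minus [simp]: "ev (- f) z = - ev f z"
  using ev_smult[of "-1" f z] by simp

lemma ev_diff [simp]: "ev (f - g) z = ev f z - ev g z"
  using ev_add[of f "- g" z] by simp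

lemma ev_mult [simp]: "ev (f * g) z = ev f z * ev g z"
  by (induction f) (auto simp: algebra_simps)

lemma ev_power [simp]: "ev (f ^ n) z = ev f z ^ n"
  by (induction n) auto

lemma ev_monom [simp]: "ev (monom c n) z = of_int c * z ^ n"
  by (simp add: ev_def map_poly_monom poly_monom)

lemma ev_pcompose [simp]: "ev (pcompose f g) z = ev f (ev g z)"
  by (induction f) (auto simp: pcompose_pCons algebra_simps)

lemma cnj_ev: "cnj (ev f z) = ev f (cnj z)"
  by (induction f) auto

section \<open>Frobenius congruences modulo a prime\<close>

lemma freshman_dream:
  fixes u v :: "'a::comm_ring_1"
  assumes p: "prime (p::nat)"
  shows "\<exists>h. (u + v) ^ p = u ^ p + v ^ p + of_nat p * h"
proof -
  have p0: "p > 0" using p prime_gt_0_nat by blast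
  have "(u + v) ^ p = (\<Sum>k\<le>p. of_nat (p choose k) * u ^ k * v ^ (p - k))"
    by (rule binomial_ring)
  also have "{..p} = insert 0 (insert p {0<..<p})" using p0 by auto
  also have "(\<Sum>k\<in>\<dots>. of_nat (p choose k) * u ^ k * v ^ (p - k)) =
      v ^ p + u ^ p + (\<Sum>k\<in>{0<..<p}. of_nat (p choose k) * u ^ k * v ^ (p - k))"
    using p0 by (simp add: add.assoc)
  also have "(\<Sum>k\<in>{0<..<p}. of_nat (p choose k) * u ^ k * v ^ (p - k)) =
     (\<Sum>k\<in>{0<..<p}. of_nat p * (of_nat ((p choose k) div p) * u ^ k * v ^ (p - k)))"
  proof (rule sum.cong[OF refl])
    fix k assume k: "k \<in> {0<..<p}"
    have "p dvd (p choose k)" using k p by (intro dvd_choose_prime) auto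
    then obtain m where m: "p choose k = p * m" by blast
    then have "(p choose k) div p = m" using p0 by simp
    then show "of_nat (p choose k) * u ^ k * v ^ (p - k) = of_nat p * (of_nat ((p choose k) div p) * u ^ k * v ^ (p - k))"
      using m by (simp add: mult.assoc)
  qed
  also have "\<dots> = of_nat p * (\<Sum>k\<in>{0<..<p}. of_nat ((p choose k) div p) * u ^ k * v ^ (p - k))"
    by (simp add: sum_distrib_left)
  finally show ?thesis by (metis add.commute)
qed

lemma int_fermat:
  assumes p: "prime (p::nat)"
  shows "int p dvd a ^ p - a"
proof -
  have nat: "int p dvd int n ^ p - int n" for n
  proof (induction n)
    case 0
    then show ?case using prime_gt_0_nat[OF p] by (simp add: power_0_left)
  next
    case (Suc n)
    obtain h where "(int n + 1) ^ p = int n ^ p + 1 ^ p + int p * h"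
      using freshman_dream[OF p, of "int n" 1] by auto
    then have "int (Suc n) ^ p - int (Suc n) = (int n ^ p - int n) + int p * h"
      by (simp add: add.commute)
    then show ?case using Suc by (metis dvd_add dvd_triv_left)
  qed
  have "[a ^ p = (a mod int p) ^ p] (mod int p)"
    by (simp add: cong_def power_mod)
  also have "[(a mod int p) ^ p = a mod int p] (mod int p)"
    using nat[of "nat (a mod int p)"] prime_gt_0_nat[OF p] by (simp add: cong_iff_dvd_diff)
  also have "[a mod int p = a] (mod int p)" by (simp add: cong_def)
  finally show ?thesis by (simp add: cong_iff_dvd_diff)
qed

lemma poly_frobenius:
  fixes f :: "int poly"
  assumes p: "prime (p::nat)"
  shows "\<exists>h. f ^ p = pcompose f (monom 1 p) + of_nat p * h"
proof (induction f)
  case 0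
  then show ?case using prime_gt_0_nat[OF p] by (intro exI[of _ 0]) (auto simp: power_0_left)
next
  case (pCons a f)
  then obtain h where h: "f ^ p = pcompose f (monom 1 p) + of_nat p * h" by blast
  define x :: "int poly" where "x = [:0, 1:]"
  obtain b where b: "a ^ p - a = int p * b" using int_fermat[OF p] by blast
  obtain h2 where h2: "([:a:] + x * f) ^ p = [:a:] ^ p + (x * f) ^ p + of_nat p * h2"
    using freshman_dream[OF p] by blast
  have e1: "pCons a f = [:a:] + x * f" by (simp add: x_def)
  have "[:a:] ^ p = [:a + int p * b:]"
    using b by (simp add: poly_const_pow algebra_simps)
  also have "\<dots> = [:a:] + of_nat p * [:b:]" by (simp add: of_nat_poly)
  finally have e2: "[:a:] ^ p = [:a:] + of_nat p * [:b:]" .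
  have e3: "pcompose (pCons a f) (monom 1 p) = [:a:] + x ^ p * pcompose f (monom 1 p)"
    by (simp add: pcompose_pCons x_def monom_altdef)
  have "pCons a f ^ p = [:a:] + of_nat p * [:b:] + x ^ p * (pcompose f (monom 1 p) + of_nat p * h) + of_nat p * h2"
    by (simp only: e1 h2 power_mult_distrib h e2)
  also have "\<dots> = pcompose (pCons a f) (monom 1 p) + of_nat p * ([:b:] + x ^ p * h + h2)"
    unfolding e3 by (simp only: distrib_left ac_simps)
  finally show ?case by blast
qed

lemma ev_of_nat [simp]: "ev (of_nat n) z = of_nat n"
  by (simp add: of_nat_poly)

lemma ev_frobenius:
  assumes "prime (p::nat)"
  shows "\<exists>h. ev f z ^ p = ev f (z ^ p) + of_nat p * ev h z"
proof -
  obtain h where "f ^ p = pcompose f (monom 1 p) + of_nat p * h"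
    using poly_frobenius[OF assms] by blast
  then have "ev (f ^ p) z = ev (pcompose f (monom 1 p) + of_nat p * h) z" by simp
  then show ?thesis by auto
qed

text \<open>A form of Gauss's lemma. Division by a vanishing polynomial \<open>r\<close> of least
  degree works in Z[x] only up to a constant factor; a vanishing prime polynomial has positive
  degree and divides no nonzero constant, so these factors can be cancelled. That \<open>f\<close>
  divides \<open>r\<close> follows because otherwise \<open>r\<close> would divide a
  constant.\<close>

lemma ev_prime_dvd:
  assumes f: "prime_elem f" "ev f z = 0" and g: "ev g z = 0"
  shows "f dvd g"
proof -
  define D where "D = {degree r | r. r \<noteq> 0 \<and> ev r z = 0}"
  have "f \<noteq> 0" using f by auto
  then have "degree f \<in> D" using f by (auto simp: D_def)
  then have "D \<noteq> {}" by auto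
  then have "(LEAST d. d \<in> D) \<in> D" by (metis LeastI ex_in_conv)
  then obtain r where r: "r \<noteq> 0" "ev r z = 0" "degree r = (LEAST d. d \<in> D)" 
    by (auto simp: D_def)
  have min: "degree r \<le> degree s" if "s \<noteq> 0" "ev s z = 0" for s
    unfolding r(3) by (rule Least_le) (use that in \<open>auto simp: D_def\<close>)
  have key: "\<exists>c. c \<noteq> 0 \<and> r dvd smult c s" if s: "ev s z = 0" for s
  proof -
    obtain c q where cq: "c \<noteq> 0" "smult c s = r * q + pseudo_mod s r"
      using pseudo_mod(1)[OF r(1)] by blast
    have "ev (smult c s) z = ev (r * q + pseudo_mod s r) z" using cq by simp
    then have "ev (pseudo_mod s r) z = 0" using r s by simp
    then have "pseudo_mod s r = 0" using pseudo_mod(2)[OF r(1), of s] min by fastforce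
    then show ?thesis using cq by auto
  qed
  have no_const: "degree s > 0" if "s \<noteq> 0" "ev s z = 0" for s
  proof (rule ccontr)
    assume "\<not> degree s > 0"
    then obtain a where "s = [:a:]" by (metis degree_eq_zeroE gr0I)
    then show False using that by auto
  qed
  have f_dvd: "f dvd s" if "c \<noteq> 0" "f dvd smult c s" for c s
  proof -
    have "f dvd [:c:] * s" using that by simp
    then consider "f dvd [:c:]" | "f dvd s" using f(1) prime_elem_dvd_multD by blast
    then show ?thesis
    proof cases
      case 1
      have "degree f \<le> degree [:c:]" using 1 that by (intro dvd_imp_degree_le) auto
      then show ?thesis using no_const[OF \<open>f \<noteq> 0\<close> f(2)] by simp
    qed
  qed
  have "f dvd r"
  proof -
    obtain c q where cq: "c \<noteq> 0" "smult c f = r * q" using key[OF f(2)] by blast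
    then have "f dvd r * q" by (metis dvd_smult dvd_refl)
    then consider "f dvd r" | "f dvd q" using f(1) prime_elem_dvd_multD by blast
    then show ?thesis
    proof cases
      case 2
      then obtain k where k: "q = f * k" by blast
      have "f * [:c:] = f * (r * k)" using cq k by (simp add: mult.left_commute)
      then have "[:c:] = r * k" using \<open>f \<noteq> 0\<close> by (metis mult_left_cancel)
      then have "degree r \<le> degree [:c:]" using cq by (intro dvd_imp_degree_le) auto
      then show ?thesis using no_const[OF r(1,2)] by simp
    qed
  qed
  then show ?thesis using key[OF g] f_dvd by (meson dvd_trans)
qed

lemma prime_factor_vanishing:
  fixes h :: "'a::factorial_semiring \<Rightarrow> 'b::semidom"
  assumes mult: "\<And>x y. h (x * y) = h x * h y" and one: "h 1 = 1"
    and x: "x \<noteq> 0" "h x = 0"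
  shows "\<exists>f. prime f \<and> f dvd x \<and> h f = 0"
  using x
proof (induction x rule: prime_divisors_induct)
  case (unit x)
  then obtain y where "1 = x * y" by blast
  then have "h x * h y = 1" using mult one by metis
  then show ?case using unit by simp
next
  case (factor p x)
  then show ?case using mult by (metis dvd_mult dvd_triv_left mult_eq_0_iff)
qed simp

section \<open>Roots of unity and residues prime to the level\<close>

definition zt :: "nat \<Rightarrow> complex" where
  "zt N = cis (2 * pi / real N)"

lemma zt_pow: "zt N ^ k = cis (2 * pi * real k / real N)"
proof -
  have "2 * pi * real k / real N = real k * (2 * pi / real N)" by simp
  then show ?thesis unfolding zt_def by (simp only: Complex.DeMoivre)
qed

lemma zt_pow_N [simp]: "N > 0 \<Longrightarrow> zt N ^ N = 1"
  by (simp add: zt_pow)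

lemma zt_nonzero [simp]: "zt N \<noteq> 0" 
  by (simp add: zt_def)

lemma cmod_zt [simp]: "cmod (zt N) = 1"
  by (simp add: zt_def)

lemma zt_1 [simp]: "zt (Suc 0) = 1"
  by (simp add: zt_def complex_eq_iff)

lemma zt_mult: "n > 0 \<Longrightarrow> d > 0 \<Longrightarrow> zt (d * n) ^ d = zt n"
  unfolding zt_pow by (simp add: zt_def)

lemma zt_pow_mod: "N > 0 \<Longrightarrow> zt N ^ (k mod N) = zt N ^ k"
proof -
  assume "N > 0"
  have "zt N ^ k = zt N ^ (N * (k div N) + k mod N)" by simp
  also have "\<dots> = zt N ^ (k mod N)" using \<open>N > 0\<close> by (simp only: power_add power_mult zt_pow_N power_one mult_1)
  finally show ?thesis by simp
qed

lemma root_unity_eq_zt_pow: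
  assumes "N > 0" "z ^ N = 1"
  shows "\<exists>k<N. z = zt N ^ k"
  using bij_betw_imp_surj_on[OF Complex.bij_betw_roots_unity[OF assms(1)]] assms
  unfolding zt_pow by (auto simp: image_def set_eq_iff)

lemma zt_pow_inj: 
  assumes "N > 0" "i < N" "j < N" "zt N ^ i = zt N ^ j" shows "i = j"
  using bij_betw_imp_inj_on[OF Complex.bij_betw_roots_unity[OF assms(1)]] assms
  unfolding zt_pow by (auto simp: inj_on_def)

lemma zt_pow_cong: "N > 0 \<Longrightarrow> zt N ^ i = zt N ^ j \<longleftrightarrow> [i = j] (mod N)"
  by (metis zt_pow_inj cong_def mod_less_divisor zt_pow_mod)

lemma zt_pow_eq_1: "N > 0 \<Longrightarrow> zt N ^ i = 1 \<longleftrightarrow> N dvd i"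
  using zt_pow_cong[of N i 0] by (simp add: cong_0_iff)

text \<open>Residues below N, so that level 1 has the one element 0; this is why the identity is
  written \<open>1 mod N\<close> later on.\<close>

definition units_mod :: "nat \<Rightarrow> nat set" where
  "units_mod N = {a. a < N \<and> coprime a N}"

lemma finite_units_mod [simp]: "finite (units_mod N)"
  by (simp add: units_mod_def)

lemma one_mod_in_units_mod: "N > 0 \<Longrightarrow> 1 mod N \<in> units_mod N"
  by (auto simp: units_mod_def)

lemma card_units_mod_pos: "N > 0 \<Longrightarrow> card (units_mod N) > 0"
  using one_mod_in_units_mod by (auto simp: card_gt_0_iff)

lemma bij_betw_units_mod_mult:
  assumes "N > 0" "coprime b N"
  shows "bij_betw (\<lambda>a. a * b mod N) (units_mod N) (units_mod N)"
proof -
  have "inj_on (\<lambda>a. a * b mod N) (units_mod N)"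
  proof (rule inj_onI)
    fix x y assume xy: "x \<in> units_mod N" "y \<in> units_mod N" "x * b mod N = y * b mod N"
    then have "[x = y] (mod N)" using assms(2) by (metis cong_def cong_mult_rcancel_nat)
    then show "x = y" using xy by (auto simp: cong_def units_mod_def)
  qed
  moreover have "(\<lambda>a. a * b mod N) ` units_mod N \<subseteq> units_mod N"
    using assms by (auto simp: units_mod_def)
  ultimately show ?thesis by (simp add: bij_betw_def endo_inj_surj)
qed

lemma prod_units_mod_mult:
  assumes "N > 0" "coprime b N"
  shows "(\<Prod>a\<in>units_mod N. G (a * b mod N)) = (\<Prod>a\<in>units_mod N. G a)"
  by (rule prod.reindex_bij_betw[OF bij_betw_units_mod_mult[OF assms]])

lemma sum_units_mod_mult:
  assumes "N > 0" "coprime b N" "\<And>a. F (a mod N) = F a"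
  shows "(\<Sum>a\<in>units_mod N. F (a * b)) = (\<Sum>a\<in>units_mod N. F a)"
proof -
  have "(\<Sum>a\<in>units_mod N. F (a * b mod N)) = (\<Sum>a\<in>units_mod N. F a)"
    by (rule sum.reindex_bij_betw[OF bij_betw_units_mod_mult[OF assms(1,2)]])
  then show ?thesis by (simp add: assms(3))
qed

section \<open>Irreducibility of cyclotomic polynomials\<close>

definition cyc_ring :: "nat \<Rightarrow> complex set" where
  "cyc_ring N = range (\<lambda>f. ev f (zt N))"

text \<open>The N-th cyclotomic polynomial, characterised inside Z[x]. Primality gives divisibility
  through \<open>ev_prime_dvd\<close>, the leading coefficient 1 gives division with
  remainder.\<close>

definition cyc_min_poly :: "nat \<Rightarrow> int poly \<Rightarrow> bool" where
  "cyc_min_poly N f \<longleftrightarrow> lead_coeff f = 1 \<and> prime_elem f \<and> ev f (zt N) = 0 \<and> f dvd monom 1 N - 1"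

lemma ex_cyc_min_poly:
  assumes "N > 0"
  shows "\<exists>f. cyc_min_poly N f"
proof -
  define h :: "int poly" where "h = monom 1 N - 1"
  have deg: "coeff h N = 1" using assms by (simp add: h_def)
  have "h \<noteq> 0" using deg by auto
  moreover have "ev h (zt N) = 0" using assms by (simp add: h_def)
  ultimately obtain f where f: "prime f" "f dvd h" "ev f (zt N) = 0"
    using prime_factor_vanishing[of "\<lambda>f. ev f (zt N)" h] by auto
  have "degree h \<le> N" unfolding h_def
    by (intro degree_diff_le) (auto simp: degree_monom_le)
  with deg have "degree h = N" by (simp add: le_degree order_antisym)
  then have lc: "lead_coeff h = 1" using deg by simp
  obtain g where g: "h = f * g" using f by blast
  have "lead_coeff f * lead_coeff g = 1" using lc g by (simp add: lead_coeff_mult)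
  then consider "lead_coeff f = 1" | "lead_coeff f = -1" by (auto simp: zmult_eq_1_iff)
  then show ?thesis
  proof cases
    case 1
    then show ?thesis using f unfolding cyc_min_poly_def h_def by blast
  next
    case 2
    have "prime_elem f" using f by blast
    then have "prime_elem (- 1 * f)" by (subst prime_elem_mult_unit_left) auto
    then have "cyc_min_poly N (- f)" using f 2 unfolding cyc_min_poly_def h_def by auto
    then show ?thesis by blast
  qed
qed

lemma ev_monic_reduce:
  assumes f: "lead_coeff f = 1" "ev f z = 0"
  shows "\<exists>r. degree r < degree f \<and> ev g z = ev r z"
proof -
  have "f \<noteq> 0" using f by auto
  have deg: "degree f > 0"
  proof (rule ccontr)
    assume "\<not> degree f > 0"
    then obtain a where "f = [:a:]" by (metis degree_eq_zeroE gr0I)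
    then show False using f by auto
  qed
  define r where "r = pseudo_mod g f"
  obtain q where "g = f * q + r"
    using pseudo_divmod[OF \<open>f \<noteq> 0\<close>, of g "fst (pseudo_divmod g f)" r] f
    by (auto simp: r_def pseudo_mod_def)
  then have "ev g z = ev r z" using f by simp
  moreover have "degree r < degree f"
    using pseudo_mod(2)[OF \<open>f \<noteq> 0\<close>, of g] deg by (auto simp: r_def)
  ultimately show ?thesis by blast
qed

lemma cyc_min_poly_reduce:
  assumes "cyc_min_poly N f"
  shows "\<exists>r. degree r < degree f \<and> ev g (zt N) = ev r (zt N)"
  using assms by (intro ev_monic_reduce) (auto simp: cyc_min_poly_def)

text \<open>Remainders of degree below \<open>degree f\<close> represent elements of Z[zeta]
  uniquely, so constant coefficients may be compared: p Z[zeta] meets the integers only in multiples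
  of p.\<close>

lemma cyc_ring_nat_multiple:
  assumes "N > 0" "of_nat M = of_nat p * ev h (zt N)" 
  shows "p dvd M"
proof -
  obtain f where f: "cyc_min_poly N f" using ex_cyc_min_poly assms by blast
  obtain r where r: "degree r < degree f" "ev h (zt N) = ev r (zt N)"
    using cyc_min_poly_reduce[OF f] by blast
  define s where "s = smult (int p) r - [:int M:]"
  have "ev s (zt N) = 0" using assms r by (simp add: s_def)
  then have "f dvd s" using ev_prime_dvd f unfolding cyc_min_poly_def by blast
  moreover have "degree s < degree f"
    unfolding s_def using r(1) le_less_trans[OF degree_smult_le r(1)] by (intro degree_diff_less) auto
  ultimately have "s = 0" by (meson dvd_imp_degree_le not_le)
  then have "coeff s 0 = 0" by simp
  then have "int M = int p * coeff r 0" by (simp add: s_def)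
  then show ?thesis by (metis dvd_triv_left int_dvd_int_iff)
qed

text \<open>
  With \<open>x^N - 1 = f g\<close> and \<open>z = \<zeta>^p\<close>, \<open>f(z) \<noteq> 0\<close> would give \<open>g(z) = 0\<close>, and differentiating,
  \<open>N z^(N-1) = f(z) g'(z)\<close>; but \<open>f(z) \<equiv> f(\<zeta>)^p = 0\<close> modulo \<open>p\<close>, so \<open>p\<close> would divide \<open>N\<close>.
\<close>

lemma ev_zt_prime_power_eq_0:
  assumes N: "N > 0" and p: "prime p" "\<not> p dvd N" and f: "ev f (zt N) = 0"
  shows "ev f (zt N ^ p) = 0"
proof -
  obtain f0 where f0: "cyc_min_poly N f0" using ex_cyc_min_poly assms by blast
  then obtain g where g: "monom 1 N - 1 = f0 * g" unfolding cyc_min_poly_def by blast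
  define z where "z = zt N ^ p"
  have zN: "z ^ N = 1" unfolding z_def using N by (metis mult.commute power_mult power_one zt_pow_N)
  have "ev f0 z = 0"
  proof (rule ccontr)
    assume nz: "ev f0 z \<noteq> 0"
    have "ev (monom 1 N - 1) z = ev (f0 * g) z" using g by simp
    then have "ev g z = 0" using nz zN by simp
    have pd: "pderiv (monom 1 N - 1 :: int poly) = monom (int N) (N - 1)"
      by (simp add: pderiv_diff pderiv_monom)
    have "ev (pderiv (monom 1 N - 1)) z = ev (pderiv (f0 * g)) z" using g by simp
    then have "of_nat N * z ^ (N - 1) = ev f0 z * ev (pderiv g) z"
      using \<open>ev g z = 0\<close> unfolding pd by (simp add: pderiv_mult)
    then have e: "(of_nat N * z ^ (N - 1)) * z = (ev f0 z * ev (pderiv g) z) * z" by (rule arg_cong)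
    have "z ^ (N - 1) * z = 1" using zN N by (simp add: power_eq_if mult.commute)
    then have "of_nat N = of_nat N * (z ^ (N - 1) * z)" by simp
    also have "\<dots> = (of_nat N * z ^ (N - 1)) * z" by (simp only: mult.assoc)
    also have "\<dots> = z * ev f0 z * ev (pderiv g) z" unfolding e by (simp only: ac_simps)
    finally have NN: "of_nat N = z * ev f0 z * ev (pderiv g) z" .
    obtain h where "ev f0 (zt N) ^ p = ev f0 (zt N ^ p) + of_nat p * ev h (zt N)"
      using ev_frobenius[OF p(1)] by blast
    moreover have "ev f0 (zt N) ^ p = 0" 
      using f0 prime_gt_0_nat[OF p(1)] by (simp add: cyc_min_poly_def)
    ultimately have "ev f0 z + of_nat p * ev h (zt N) = 0" unfolding z_def by simp
    then have h: "ev f0 z = - of_nat p * ev h (zt N)" by (simp only: eq_neg_iff_add_eq_0 mult_minus_left)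
    then have "of_nat N = of_nat p * ev (- (monom 1 p * h * pcompose (pderiv g) (monom 1 p))) (zt N)"
      unfolding NN h by (simp add: z_def)
    then have "p dvd N" using cyc_ring_nat_multiple N by blast
    then show False using p by simp
  qed
  moreover have "f0 dvd f" using ev_prime_dvd f f0 unfolding cyc_min_poly_def by blast
  ultimately show ?thesis unfolding z_def by auto
qed

text \<open>The prime case speaks only of \<open>zt N\<close>, not of its powers. It is therefore
  used to see that f(X^p) vanishes at \<open>zt N\<close>, and the induction hypothesis for the
  remaining factor is applied to that polynomial.\<close>

lemma ev_zt_coprime_power_eq_0:
  assumes N: "N > 0" and a: "coprime a N" and f: "ev f (zt N) = 0"
  shows "ev f (zt N ^ a) = 0"
  using a f
proof (induction a arbitrary: f rule: prime_divisors_induct)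
  case zero
  then have "N = 1" by simp
  then show ?case using zero by simp
next
  case (unit x)
  then show ?case by simp
next
  case (factor p x)
  have cop: "coprime p N" "coprime x N" using factor.prems(1) by simp_all
  have p: "prime p" using factor.hyps by simp
  have "\<not> p dvd N" using cop(1) p by (metis coprime_absorb_left not_prime_unit)
  note p = p this cop(2)
  have "ev (pcompose f (monom 1 p)) (zt N) = 0"
    using ev_zt_prime_power_eq_0[OF N p(1,2) factor.prems(2)] by simp
  then have "ev (pcompose f (monom 1 p)) (zt N ^ x) = 0"
    using factor.IH p by blast
  then have "ev f ((zt N ^ x) ^ p) = 0" by simp
  moreover have "(zt N ^ x) ^ p = zt N ^ (p * x)" by (metis mult.commute power_mult)
  ultimately show ?case by simp
qed

text \<open>Of the N distinct roots of f g = X^N - 1 at most \<open>degree g\<close> belong to g, so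
  f has at least \<open>degree f\<close> of them. Each is primitive: a root of order dividing a
  proper divisor m of N would make f divide X^m - 1, and \<open>zt N\<close> would have order at
  most m.\<close>

lemma cyc_min_poly_degree_le:
  assumes N: "N > 0" and f: "cyc_min_poly N f"
  shows "degree f \<le> card (units_mod N)"
proof -
  obtain g where g: "monom 1 N - 1 = f * g" using f unfolding cyc_min_poly_def by blast
  define F where "F = (map_poly of_int f :: complex poly)"
  define G where "G = (map_poly of_int g :: complex poly)"
  have deg: "degree F = degree f" "degree G = degree g"
    by (auto simp: F_def G_def degree_map_poly)
  have nz: "f \<noteq> 0" "g \<noteq> 0"
  proof -
    have "coeff (f * g) N = 1" unfolding g[symmetric] using N by simp
    then show "f \<noteq> 0" "g \<noteq> 0" by auto
  qed
  have nz': "F \<noteq> 0" "G \<noteq> 0" using nz by (auto simp: F_def G_def map_poly_eq_0_iff)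
  have "degree (f * g) \<le> N" unfolding g[symmetric]
    by (intro degree_diff_le) (auto simp: degree_monom_le)
  then have dN: "degree f + degree g \<le> N" using nz by (simp add: degree_mult_eq)
  have roots: "{z. z ^ N = 1} \<subseteq> {z. poly F z = 0} \<union> {z. poly G z = 0}"
  proof
    fix z :: complex assume "z \<in> {z. z ^ N = 1}"
    then have "ev (f * g) z = 0" unfolding g[symmetric] by simp
    then have "ev f z * ev g z = 0" by simp
    then show "z \<in> {z. poly F z = 0} \<union> {z. poly G z = 0}"
      by (simp add: ev_def F_def G_def)
  qed
  have "N = card {z::complex. z ^ N = 1}" using N by (simp add: card_roots_unity_eq)
  also have "\<dots> \<le> card ({z. poly F z = 0} \<union> {z. poly G z = 0})"
    using roots nz' by (intro card_mono) (auto simp: poly_roots_finite)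
  also have "\<dots> \<le> card {z. poly F z = 0} + card {z. poly G z = 0}"
    by (rule card_Un_le)
  also have "card {z. poly G z = 0} \<le> degree g"
    using card_poly_roots_bound[OF nz'(2)] deg by simp
  finally have "degree f \<le> card {z. poly F z = 0}" using dN by simp
  also have "{z. poly F z = 0} \<subseteq> (\<lambda>a. zt N ^ a) ` units_mod N"
  proof
    fix z assume "z \<in> {z. poly F z = 0}"
    then have z: "ev f z = 0" by (simp add: ev_def F_def)
    then have "ev (monom 1 N - 1) z = 0" unfolding g by simp
    then have "z ^ N = 1" by simp
    then obtain k where k: "k < N" "z = zt N ^ k" using root_unity_eq_zt_pow[OF N] by blast
    have "coprime k N"
    proof (rule ccontr)
      assume nc: "\<not> coprime k N"
      define d where "d = gcd k N"
      have "d > 1" using nc N by (simp add: d_def coprime_iff_gcd_eq_1 Suc_lessI)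
      obtain k' m where km: "k = d * k'" "N = d * m" unfolding d_def by (meson dvdE gcd_dvd1 gcd_dvd2)
      have "z ^ m = zt N ^ (N * k')" unfolding k(2) km by (simp add: ac_simps flip: power_mult)
      also have "\<dots> = 1" using N by (simp add: power_mult)
      finally have "ev (monom 1 m - 1) z = 0" by simp
      then have "f dvd monom 1 m - 1" using z f ev_prime_dvd unfolding cyc_min_poly_def by blast
      then have "ev (monom 1 m - 1) (zt N) = 0" using f unfolding cyc_min_poly_def by (auto simp del: ev_diff)
      then have "N dvd m" using N by (simp add: zt_pow_eq_1)
      moreover have "m > 0" using km N by (auto intro: gr0I)
      ultimately have "N \<le> m" by (simp add: dvd_imp_le)
      then show False using km \<open>d > 1\<close> \<open>m > 0\<close> by simp
    qed
    then show "z \<in> (\<lambda>a. zt N ^ a) ` units_mod N" using k by (auto simp: units_mod_def)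
  qed
  then have "card {z. poly F z = 0} \<le> card (units_mod N)"
    by (meson card_image_le card_mono finite_imageI finite_units_mod le_trans)
  finally show ?thesis .
qed

text \<open>Once reduced below \<open>degree f\<close>, the polynomial minus its value at
  \<open>zt N\<close> vanishes at every primitive N-th root of unity. These outnumber its degree, so
  it is zero and the value is the constant coefficient.\<close>

lemma cyc_ring_fixed_int:
  assumes N: "N > 0" and fixed: "\<And>a. coprime a N \<Longrightarrow> ev g (zt N ^ a) = ev g (zt N)"
  shows "ev g (zt N) \<in> \<int>"
proof -
  obtain f where f: "cyc_min_poly N f" using ex_cyc_min_poly N by blast
  obtain r where r: "degree r < degree f" "ev g (zt N) = ev r (zt N)"
    using cyc_min_poly_reduce[OF f] by blast
  have conj: "ev r (zt N ^ a) = ev r (zt N)" if "coprime a N" for a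
  proof -
    have "ev (g - r) (zt N ^ a) = 0" using r that by (intro ev_zt_coprime_power_eq_0[OF N]) auto
    then show ?thesis using fixed that r by simp
  qed
  define H where "H = map_poly of_int r - [:ev r (zt N):]"
  have "H = 0"
  proof (rule ccontr)
    assume "H \<noteq> 0"
    have "card (units_mod N) = card ((\<lambda>a. zt N ^ a) ` units_mod N)"
      by (intro card_image[symmetric] inj_onI zt_pow_inj[OF N]) (auto simp: units_mod_def)
    also have "\<dots> \<le> card {z. poly H z = 0}"
    proof (rule card_mono[OF poly_roots_finite[OF \<open>H \<noteq> 0\<close>]])
      show "(\<lambda>a. zt N ^ a) ` units_mod N \<subseteq> {z. poly H z = 0}"
      proof (rule image_subsetI)
        fix a assume "a \<in> units_mod N"
        then have "ev r (zt N ^ a) = ev r (zt N)" using conj by (auto simp: units_mod_def)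
        then show "zt N ^ a \<in> {z. poly H z = 0}" by (simp add: H_def ev_def)
      qed
    qed
    also have "\<dots> \<le> degree H" by (rule card_poly_roots_bound[OF \<open>H \<noteq> 0\<close>])
    also have "\<dots> < degree f"
      unfolding H_def using r(1) by (intro degree_diff_less) (auto simp: degree_map_poly)
    also have "\<dots> \<le> card (units_mod N)" by (rule cyc_min_poly_degree_le[OF N f])
    finally show False by simp
  qed
  then have "coeff H 0 = 0" by simp
  then have "ev r (zt N) = of_int (coeff r 0)" by (simp add: H_def coeff_map_poly)
  then show ?thesis using r by simp
qed

section \<open>The Galois action on cyclotomic fields\<close>

lemma cyc_ringI: "x = ev f (zt N) \<Longrightarrow> x \<in> cyc_ring N"
  by (auto simp: cyc_ring_def)

lemma cyc_ringE: 
  assumes "x \<in> cyc_ring N" obtains f where "x = ev f (zt N)"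
  using assms by (auto simp: cyc_ring_def)

lemma cyc_ring_of_int [simp]: "of_int a \<in> cyc_ring N"
  by (rule cyc_ringI[of _ "[:a:]"]) simp

lemma cyc_ring_of_nat [simp]: "of_nat a \<in> cyc_ring N"
  using cyc_ring_of_int[of "int a"] by simp

lemma cyc_ring_Ints: "x \<in> \<int> \<Longrightarrow> x \<in> cyc_ring N"
  by (auto elim: Ints_cases)

lemma cyc_ring_0 [simp]: "0 \<in> cyc_ring N" and cyc_ring_1 [simp]: "1 \<in> cyc_ring N"
  using cyc_ring_of_int[of 0] cyc_ring_of_int[of 1] by simp_all

lemma cyc_ring_add: "x \<in> cyc_ring N \<Longrightarrow> y \<in> cyc_ring N \<Longrightarrow> x + y \<in> cyc_ring N"
  by (elim cyc_ringE) (metis ev_add cyc_ringI)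

lemma cyc_ring_mult: "x \<in> cyc_ring N \<Longrightarrow> y \<in> cyc_ring N \<Longrightarrow> x * y \<in> cyc_ring N"
  by (elim cyc_ringE) (metis ev_mult cyc_ringI)

lemma cyc_ring_minus: "x \<in> cyc_ring N \<Longrightarrow> - x \<in> cyc_ring N"
  by (elim cyc_ringE) (metis ev_minus cyc_ringI)

lemma cyc_ring_diff: "x \<in> cyc_ring N \<Longrightarrow> y \<in> cyc_ring N \<Longrightarrow> x - y \<in> cyc_ring N"
  by (elim cyc_ringE) (metis ev_diff cyc_ringI)

lemma cyc_ring_power: "x \<in> cyc_ring N \<Longrightarrow> x ^ n \<in> cyc_ring N"
  by (induction n) (auto intro: cyc_ring_mult)

lemma cyc_ring_sum: "(\<And>i. i \<in> A \<Longrightarrow> g i \<in> cyc_ring N) \<Longrightarrow> sum g A \<in> cyc_ring N"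
  by (induction A rule: infinite_finite_induct) (auto intro: cyc_ring_add)

lemma cyc_ring_prod: "(\<And>i. i \<in> A \<Longrightarrow> g i \<in> cyc_ring N) \<Longrightarrow> prod g A \<in> cyc_ring N"
  by (induction A rule: infinite_finite_induct) (auto intro: cyc_ring_mult)

lemma cyc_ring_zt [simp]: "zt N \<in> cyc_ring N"
  by (rule cyc_ringI[of _ "[:0, 1:]"]) simp

lemma zt_dvd: 
  assumes "N > 0" "m dvd N" shows "zt m = zt N ^ (N div m)"
proof -
  obtain d where d: "N = d * m" using assms by (metis dvdE mult.commute)
  then show ?thesis using assms zt_mult[of m d] by (cases "d = 0"; cases "m = 0") auto
qed

lemma cyc_ring_root_unity:
  assumes "N > 0" "z ^ N = 1" shows "z \<in> cyc_ring N"
  using root_unity_eq_zt_pow[OF assms] by (auto intro: cyc_ring_power)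

lemma cyc_ring_mono:
  assumes "N > 0" "m dvd N" shows "cyc_ring m \<subseteq> cyc_ring N"
proof
  fix x assume "x \<in> cyc_ring m"
  then obtain f where "x = ev f (zt m)" by (rule cyc_ringE)
  then have "x = ev (pcompose f (monom 1 (N div m))) (zt N)" using zt_dvd[OF assms] by simp
  then show "x \<in> cyc_ring N" by (rule cyc_ringI)
qed

lemma cnj_zt: 
  assumes "N > 0" shows "cnj (zt N) = zt N ^ (N - 1)"
proof -
  have "cnj (zt N) = inverse (zt N)" by (simp add: zt_def cis_cnj)
  also have "zt N ^ (N - 1) * zt N = 1" using assms by (simp flip: power_Suc2)
  then have "inverse (zt N) = zt N ^ (N - 1)" by (metis inverse_unique mult.commute)
  finally show ?thesis .
qed

lemma cyc_ring_cnj: 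
  assumes "N > 0" "x \<in> cyc_ring N" shows "cnj x \<in> cyc_ring N"
proof -
  obtain f where "x = ev f (zt N)" using assms(2) by (rule cyc_ringE)
  then have "cnj x = ev (pcompose f (monom 1 (N - 1))) (zt N)"
    using cnj_zt[OF assms(1)] by (simp add: cnj_ev)
  then show ?thesis by (rule cyc_ringI)
qed

section \<open>The cyclotomic field as fractions, and its automorphisms\<close>

definition cyc_frac :: "nat \<Rightarrow> complex set" where
  "cyc_frac N = {x. \<exists>d::int. d \<noteq> 0 \<and> of_int d * x \<in> cyc_ring N}"

text \<open>The automorphism sending zeta to its a-th power, for \<open>a\<close> coprime to N. An
  element has many representations as a polynomial value over an integer; that all give the same
  \<open>y\<close> is the content of \<open>ev_zt_coprime_power_eq_0\<close>.\<close>

definition sig :: "nat \<Rightarrow> nat \<Rightarrow> complex \<Rightarrow> complex" where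
  "sig N a x = (THE y. \<exists>d f. d \<noteq> 0 \<and> of_int d * x = ev f (zt N) \<and> of_int d * y = ev f (zt N ^ a))"

lemma cyc_fracE:
  assumes "x \<in> cyc_frac N"
  obtains d f where "d \<noteq> 0" "of_int d * x = ev f (zt N)"
  using assms by (auto simp: cyc_frac_def elim: cyc_ringE)

lemma cyc_fracI: "d \<noteq> 0 \<Longrightarrow> of_int d * x \<in> cyc_ring N \<Longrightarrow> x \<in> cyc_frac N"
  by (auto simp: cyc_frac_def)

lemma cyc_ring_imp_frac: "x \<in> cyc_ring N \<Longrightarrow> x \<in> cyc_frac N"
  by (rule cyc_fracI[of 1]) auto

lemma sig_eq:
  assumes N: "N > 0" "coprime a N" and d: "d \<noteq> 0" "of_int d * x = ev f (zt N)"
  shows "of_int d * sig N a x = ev f (zt N ^ a)"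
proof -
  have "\<exists>!y. \<exists>d f. d \<noteq> 0 \<and> of_int d * x = ev f (zt N) \<and> of_int d * y = ev f (zt N ^ a)"
  proof (rule ex_ex1I)
    show "\<exists>y d f. d \<noteq> 0 \<and> of_int d * x = ev f (zt N) \<and> of_int d * y = ev f (zt N ^ a)"
      using d by (intro exI[of _ "ev f (zt N ^ a) / of_int d"] exI[of _ d] exI[of _ f]) auto
  next
    fix y y'
    assume "\<exists>d f. d \<noteq> 0 \<and> of_int d * x = ev f (zt N) \<and> of_int d * y = ev f (zt N ^ a)"
      and "\<exists>d f. d \<noteq> 0 \<and> of_int d * x = ev f (zt N) \<and> of_int d * y' = ev f (zt N ^ a)"
    then obtain d f d' f' where *: "d \<noteq> 0" "of_int d * x = ev f (zt N)" "of_int d * y = ev f (zt N ^ a)"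
        "d' \<noteq> 0" "of_int d' * x = ev f' (zt N)" "of_int d' * y' = ev f' (zt N ^ a)" by blast
    have "ev (smult d' f - smult d f') (zt N) = of_int d' * (of_int d * x) - of_int d * (of_int d' * x)"
      using * by simp
    also have "\<dots> = 0" by simp
    finally have "ev (smult d' f - smult d f') (zt N ^ a) = 0"
      by (intro ev_zt_coprime_power_eq_0 N)
    then have "of_int d' * (of_int d * y) - of_int d * (of_int d' * y') = 0" using * by simp
    then have "(of_int (d' * d) :: complex) * (y - y') = 0" by (simp add: algebra_simps)
    then show "y = y'" using * by auto
  qed
  then have "\<exists>d f. d \<noteq> 0 \<and> of_int d * x = ev f (zt N) \<and> of_int d * sig N a x = ev f (zt N ^ a)"
    unfolding sig_def by (rule theI')
  then obtain d' f' where *: "d' \<noteq> 0" "of_int d' * x = ev f' (zt N)" "of_int d' * sig N a x = ev f' (zt N ^ a)"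
    by blast
  have "ev (smult d' f - smult d f') (zt N) = of_int d' * (of_int d * x) - of_int d * (of_int d' * x)"
    using * d by simp
  also have "\<dots> = 0" by simp
  finally have "ev (smult d' f - smult d f') (zt N ^ a) = 0"
    by (intro ev_zt_coprime_power_eq_0 N)
  then have "of_int d' * ev f (zt N ^ a) = of_int d * (of_int d' * sig N a x)" using * by simp
  then have "of_int d' * ev f (zt N ^ a) = of_int d' * (of_int d * sig N a x)" by (simp only: mult.left_commute)
  then show ?thesis using *(1) by simp
qed

lemma sig_ev: "N > 0 \<Longrightarrow> coprime a N \<Longrightarrow> sig N a (ev f (zt N)) = ev f (zt N ^ a)"
  using sig_eq[of N a 1 "ev f (zt N)" f] by simp

lemma sig_of_int: "N > 0 \<Longrightarrow> coprime a N \<Longrightarrow> sig N a (of_int c) = of_int c"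
  using sig_ev[of N a "[:c:]"] by simp

lemma sig_mod: "N > 0 \<Longrightarrow> sig N (a mod N) x = sig N a x"
  unfolding sig_def by (simp add: zt_pow_mod)

lemma sig_cong: "N > 0 \<Longrightarrow> [a = b] (mod N) \<Longrightarrow> sig N a x = sig N b x"
  by (metis sig_mod cong_def)

lemma cyc_frac_add: 
  assumes "x \<in> cyc_frac N" "y \<in> cyc_frac N"
  shows "x + y \<in> cyc_frac N"
    and "N > 0 \<Longrightarrow> coprime a N \<Longrightarrow> sig N a (x + y) = sig N a x + sig N a y"
proof -
  obtain d f where x: "d \<noteq> 0" "of_int d * x = ev f (zt N)" using assms by (elim cyc_fracE)
  obtain e g where y: "e \<noteq> 0" "of_int e * y = ev g (zt N)" using assms by (elim cyc_fracE)
  have eq: "of_int (d * e) * (x + y) = ev (smult e f + smult d g) (zt N)"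
    using x(2)[symmetric] y(2)[symmetric] by (simp add: algebra_simps)
  then show "x + y \<in> cyc_frac N"
    using x y by (intro cyc_fracI[OF _ cyc_ringI[OF eq]]) auto
  assume N: "N > 0" "coprime a N"
  have "of_int (d * e) * sig N a (x + y) = ev (smult e f + smult d g) (zt N ^ a)"
    using x y by (intro sig_eq[OF N _ eq]) auto
  also have "\<dots> = of_int (d * e) * (sig N a x + sig N a y)"
    using sig_eq[OF N x, symmetric] sig_eq[OF N y, symmetric] by (simp add: algebra_simps)
  finally show "sig N a (x + y) = sig N a x + sig N a y" using x y by simp
qed

lemma cyc_frac_mult: 
  assumes "x \<in> cyc_frac N" "y \<in> cyc_frac N"
  shows "x * y \<in> cyc_frac N"
    and "N > 0 \<Longrightarrow> coprime a N \<Longrightarrow> sig N a (x * y) = sig N a x * sig N a y"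
proof -
  obtain d f where x: "d \<noteq> 0" "of_int d * x = ev f (zt N)" using assms by (elim cyc_fracE)
  obtain e g where y: "e \<noteq> 0" "of_int e * y = ev g (zt N)" using assms by (elim cyc_fracE)
  have eq: "of_int (d * e) * (x * y) = ev (f * g) (zt N)"
    using x(2)[symmetric] y(2)[symmetric] by (simp add: algebra_simps)
  then show "x * y \<in> cyc_frac N"
    using x y by (intro cyc_fracI[OF _ cyc_ringI[OF eq]]) auto
  assume N: "N > 0" "coprime a N"
  have "of_int (d * e) * sig N a (x * y) = ev (f * g) (zt N ^ a)"
    using x y by (intro sig_eq[OF N _ eq]) auto
  also have "\<dots> = of_int (d * e) * (sig N a x * sig N a y)"
    using sig_eq[OF N x, symmetric] sig_eq[OF N y, symmetric] by (simp add: algebra_simps)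
  finally show "sig N a (x * y) = sig N a x * sig N a y" using x y by simp
qed

lemmas sig_add = cyc_frac_add(2)[rotated 2] and sig_mult = cyc_frac_mult(2)[rotated 2]

lemma cyc_frac_of_int [simp]: "of_int c \<in> cyc_frac N"
  by (simp add: cyc_ring_imp_frac)

lemma cyc_frac_0 [simp]: "0 \<in> cyc_frac N" and cyc_frac_1 [simp]: "1 \<in> cyc_frac N"
  by (simp_all add: cyc_ring_imp_frac)

lemma sig_0: "N > 0 \<Longrightarrow> coprime a N \<Longrightarrow> sig N a 0 = 0"
  and sig_1: "N > 0 \<Longrightarrow> coprime a N \<Longrightarrow> sig N a 1 = 1"
  using sig_of_int[of N a 0] sig_of_int[of N a 1] by simp_all

lemma cyc_frac_minus: "x \<in> cyc_frac N \<Longrightarrow> - x \<in> cyc_frac N"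
  using cyc_frac_mult(1)[OF cyc_frac_of_int[of "-1"], of x N] by simp

lemma sig_minus: 
  assumes "N > 0" "coprime a N" "x \<in> cyc_frac N" shows "sig N a (- x) = - sig N a x"
  using sig_mult[OF assms(1,2) cyc_frac_of_int[of "-1"] assms(3)] sig_of_int[OF assms(1,2), of "-1"] by simp

lemma cyc_frac_diff: "x \<in> cyc_frac N \<Longrightarrow> y \<in> cyc_frac N \<Longrightarrow> x - y \<in> cyc_frac N"
  using cyc_frac_add(1)[of x N "- y"] cyc_frac_minus by simp

lemma sig_diff: 
  assumes "N > 0" "coprime a N" "x \<in> cyc_frac N" "y \<in> cyc_frac N" shows "sig N a (x - y) = sig N a x - sig N a y"
  using sig_add[OF assms(1,2,3) cyc_frac_minus[OF assms(4)]] sig_minus[OF assms(1,2,4)] by simp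

lemma cyc_frac_power: "x \<in> cyc_frac N \<Longrightarrow> x ^ n \<in> cyc_frac N"
  by (induction n) (auto intro: cyc_frac_mult)

lemma sig_power: 
  assumes "N > 0" "coprime a N" "x \<in> cyc_frac N" shows "sig N a (x ^ n) = sig N a x ^ n"
  by (induction n) (auto simp: sig_1 sig_mult cyc_frac_power assms)

lemma cyc_frac_sum: "(\<And>i. i \<in> A \<Longrightarrow> g i \<in> cyc_frac N) \<Longrightarrow> sum g A \<in> cyc_frac N"
  by (induction A rule: infinite_finite_induct) (auto intro: cyc_frac_add)

lemma sig_sum: 
  assumes "N > 0" "coprime a N"
  shows "(\<And>i. i \<in> A \<Longrightarrow> g i \<in> cyc_frac N) \<Longrightarrow> sig N a (sum g A) = (\<Sum>i\<in>A. sig N a (g i))"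
  by (induction A rule: infinite_finite_induct) (auto simp: sig_0 sig_add cyc_frac_sum assms)

lemma cyc_frac_prod: "(\<And>i. i \<in> A \<Longrightarrow> g i \<in> cyc_frac N) \<Longrightarrow> prod g A \<in> cyc_frac N"
  by (induction A rule: infinite_finite_induct) (auto intro: cyc_frac_mult)

lemma sig_prod: 
  assumes "N > 0" "coprime a N"
  shows "(\<And>i. i \<in> A \<Longrightarrow> g i \<in> cyc_frac N) \<Longrightarrow> sig N a (prod g A) = (\<Prod>i\<in>A. sig N a (g i))"
  by (induction A rule: infinite_finite_induct) (auto simp: sig_1 sig_mult cyc_frac_prod assms)

lemma sig_in_ring:
  assumes "N > 0" "coprime a N" "x \<in> cyc_ring N" shows "sig N a x \<in> cyc_ring N"
proof -
  obtain f where "x = ev f (zt N)" using assms(3) by (rule cyc_ringE)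
  then have "sig N a x = ev (pcompose f (monom 1 a)) (zt N)" using assms by (simp add: sig_ev)
  then show ?thesis by (rule cyc_ringI)
qed

lemma sig_in_frac:
  assumes "N > 0" "coprime a N" "x \<in> cyc_frac N" shows "sig N a x \<in> cyc_frac N"
proof -
  obtain d f where x: "d \<noteq> 0" "of_int d * x = ev f (zt N)" using assms by (elim cyc_fracE)
  have "of_int d * sig N a x = ev (pcompose f (monom 1 a)) (zt N)" using sig_eq[OF assms(1,2) x] by simp
  then show ?thesis by (intro cyc_fracI[OF x(1)] cyc_ringI)
qed

lemma sig_sig:
  assumes "N > 0" "coprime a N" "coprime b N" "x \<in> cyc_frac N"
  shows "sig N b (sig N a x) = sig N (a * b) x"
proof -
  obtain d f where x: "d \<noteq> 0" "of_int d * x = ev f (zt N)" using assms by (elim cyc_fracE)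
  have "of_int d * sig N a x = ev (pcompose f (monom 1 a)) (zt N)" using sig_eq[OF assms(1,2) x] by simp
  from sig_eq[OF assms(1,3) x(1) this] have "of_int d * sig N b (sig N a x) = ev f (zt N ^ (a * b))"
    by (simp add: power_mult) (metis mult.commute power_mult)
  also have "\<dots> = of_int d * sig N (a * b) x"
    by (rule sig_eq[symmetric]) (use assms x in auto)
  finally show ?thesis using x by simp
qed

lemma sig_one:
  assumes "N > 0" "x \<in> cyc_frac N" shows "sig N 1 x = x"
proof -
  obtain d f where x: "d \<noteq> 0" "of_int d * x = ev f (zt N)" using assms by (elim cyc_fracE)
  have "of_int d * sig N 1 x = ev f (zt N ^ 1)" by (rule sig_eq) (use assms x in auto)
  then have "of_int d * sig N 1 x = of_int d * x" unfolding x(2) by simp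
  then show ?thesis using x(1) by simp
qed

lemma sig_cong_one:
  assumes "N > 0" "x \<in> cyc_frac N" "[a = 1] (mod N)" shows "sig N a x = x"
  using sig_cong[OF assms(1,3)] sig_one[OF assms(1,2)] by simp

lemma ex_inverse_mod:
  assumes "N > 0" "coprime a (N::nat)"
  obtains b where "[a * b = 1] (mod N)" "coprime b N"
proof -
  obtain b where b: "[a * b = 1] (mod N)" using cong_solve_coprime_nat[OF assms(2)] by auto
  then have "coprime (a * b) N" using cong_imp_coprime cong_sym coprime_1_left by blast
  then show ?thesis using b that by simp
qed

lemma sig_inj:
  assumes "N > 0" "coprime a N" "x \<in> cyc_frac N" "y \<in> cyc_frac N" "sig N a x = sig N a y"
  shows "x = y"
proof -
  obtain b where b: "[a * b = 1] (mod N)" "coprime b N" using ex_inverse_mod assms by blast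
  have "sig N b (sig N a x) = sig N b (sig N a y)" using assms(5) by (rule arg_cong)
  then have "sig N (a * b) x = sig N (a * b) y" 
    by (simp only: sig_sig[OF assms(1,2) b(2) assms(3)] sig_sig[OF assms(1,2) b(2) assms(4)])
  then show ?thesis using sig_cong_one[OF assms(1) _ b(1)] assms by simp
qed

lemma sig_cnj:
  assumes "N > 0" "coprime a N" "x \<in> cyc_ring N"
  shows "sig N a (cnj x) = cnj (sig N a x)"
proof -
  obtain f where f: "x = ev f (zt N)" using assms(3) by (rule cyc_ringE)
  then have "cnj x = ev (pcompose f (monom 1 (N - 1))) (zt N)"
    using cnj_zt[OF assms(1)] by (simp add: cnj_ev)
  then have "sig N a (cnj x) = ev (pcompose f (monom 1 (N - 1))) (zt N ^ a)"
    using assms by (simp only: sig_ev)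
  also have "\<dots> = ev f (cnj (zt N) ^ a)" using cnj_zt[OF assms(1)]
    by simp (metis mult.commute power_mult)
  also have "\<dots> = cnj (sig N a x)" using f assms by (simp add: sig_ev cnj_ev)
  finally show ?thesis .
qed

lemma sig_zt_pow: 
  assumes "N > 0" "coprime a N"
  shows "sig N a (zt N ^ k) = zt N ^ (k * a)"
  using sig_ev[OF assms, of "monom 1 k"] by (simp, metis mult.commute power_mult)

lemma sig_sub:
  assumes "N > 0" "coprime a N" "n dvd N"
  shows "sig N a (ev f (zt n)) = ev f (zt n ^ a)"
  using sig_ev[OF assms(1,2), of "pcompose f (monom 1 (N div n))"] zt_dvd[OF assms(1,3)]
  by simp (metis mult.commute power_mult)

lemma sig_fixed_imp_Ints:
  assumes "N > 0" "x \<in> cyc_ring N" "\<And>a. coprime a N \<Longrightarrow> sig N a x = x"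
  shows "x \<in> \<int>"
proof -
  obtain f where f: "x = ev f (zt N)" using assms(2) by (rule cyc_ringE)
  then show ?thesis using cyc_ring_fixed_int[OF assms(1), of f] assms by (simp add: sig_ev)
qed

section \<open>Conjugates and their means\<close>

abbreviation evq :: "rat poly \<Rightarrow> complex \<Rightarrow> complex" where
  "evq q z \<equiv> poly (map_poly of_rat q) z"

lemma evq_pCons: "evq (pCons a f) z = of_rat a + z * evq f z"
  by (simp add: map_poly_pCons)

lemma evq_add: "evq (f + g) z = evq f z + evq g z"
proof (induction f arbitrary: g)
  case (pCons a f)
  obtain b h where "g = pCons b h" by (cases g)
  then show ?case by (simp add: pCons.IH evq_pCons of_rat_add algebra_simps)
qed simp

lemma evq_smult: "evq (smult c f) z = of_rat c * evq f z"
  by (induction f) (auto simp: evq_pCons of_rat_mult algebra_simps)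

lemma evq_mult: "evq (f * g) z = evq f z * evq g z"
  by (induction f) (auto simp: evq_pCons evq_add evq_smult algebra_simps)

lemma ex_rat_minimal_polynomial:
  assumes P: "P \<noteq> 0" "evq P z = 0"
  shows "\<exists>r. is_minimal_polynomial r z \<and> (\<forall>s. evq s z = 0 \<longrightarrow> r dvd s)"
proof -
  define D where "D = {degree r | r. r \<noteq> 0 \<and> evq r z = 0}"
  have "degree P \<in> D" using P by (auto simp: D_def)
  then have "(LEAST d. d \<in> D) \<in> D" by (rule LeastI)
  then obtain r0 where r0: "r0 \<noteq> 0" "evq r0 z = 0" "degree r0 = (LEAST d. d \<in> D)" 
    by (auto simp: D_def)
  define r where "r = smult (inverse (lead_coeff r0)) r0"
  have r: "r \<noteq> 0" "evq r z = 0" "degree r = (LEAST d. d \<in> D)" "lead_coeff r = 1"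
  proof -
    have lc: "lead_coeff r0 \<noteq> 0" using r0(1) by simp
    then show "r \<noteq> 0" "evq r z = 0" "lead_coeff r = 1" using r0(1,2) by (simp_all add: r_def evq_smult)
    have "degree r = degree r0" using lc by (simp add: r_def)
    then show "degree r = (LEAST d. d \<in> D)" using r0(3) by simp
  qed
  have min: "degree r \<le> degree s" if "s \<noteq> 0" "evq s z = 0" for s
    unfolding r(3) by (rule Least_le) (use that in \<open>auto simp: D_def\<close>)
  have key: "r dvd s" if s: "evq s z = 0" for s
  proof -
    have "evq (s div r * r + s mod r) z = 0" using s by simp
    then have "evq (s mod r) z = 0" using r by (simp only: evq_add evq_mult) simp
    then have "s mod r = 0" using degree_mod_less[OF r(1), of s] min by (meson not_le)
    then show ?thesis by (simp add: dvd_eq_mod_eq_0)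
  qed
  have "irreducible r"
  proof (rule irreducibleI)
    show "\<not> r dvd 1"
    proof
      assume "r dvd 1"
      then obtain k where "1 = r * k" by blast
      have "evq (r * k) z = 0" unfolding evq_mult using r(2) by simp
      then show False unfolding \<open>1 = r * k\<close>[symmetric] by simp
    qed
  next
    fix a b assume ab: "r = a * b"
    have nz: "a \<noteq> 0" "b \<noteq> 0" using ab r by auto
    have deg: "degree r = degree a + degree b" using ab nz by (simp add: degree_mult_eq)
    have "evq a z * evq b z = 0" using r ab by (simp add: evq_mult)
    then consider "evq a z = 0" | "evq b z = 0" by auto
    then show "a dvd 1 \<or> b dvd 1"
    proof cases
      case 1
      then have "degree b = 0" using min[OF nz(1)] deg by simp
      then show ?thesis using nz by (simp add: is_unit_iff_degree)
    next
      case 2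
      then have "degree a = 0" using min[OF nz(2)] deg by simp
      then show ?thesis using nz by (simp add: is_unit_iff_degree)
    qed
  qed (use r in auto)
  then have "is_minimal_polynomial r z" unfolding is_minimal_polynomial_def using r(2,4) by blast
  with key show ?thesis by blast
qed

text \<open>\<open>conjugates\<close> ranges over every minimal polynomial of z. Each is an
  irreducible multiple of \<open>r\<close>, hence a constant multiple, and has the same
  roots.\<close>

lemma conjugates_eq_roots:
  assumes r: "is_minimal_polynomial r z" and dvd: "\<And>s. evq s z = 0 \<Longrightarrow> r dvd s"
  shows "conjugates z = {y. evq r y = 0}"
proof -
  have "{y. evq p y = 0} = {y. evq r y = 0}" if p: "is_minimal_polynomial p z" for p
  proof -
    have "r dvd p" using dvd p by (auto simp: is_minimal_polynomial_def)
    then obtain c where c: "p = r * c" by blast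
    have "\<not> r dvd 1" using r by (auto simp: is_minimal_polynomial_def irreducible_def)
    then have "c dvd 1" using p c by (auto simp: is_minimal_polynomial_def dest: irreducibleD)
    then obtain k where k: "c = [:k:]" "k dvd 1" by (auto simp: is_unit_poly_iff)
    then have "k \<noteq> 0" by auto
    with k show ?thesis unfolding c by (auto simp: evq_mult evq_pCons evq_smult)
  qed
  then show ?thesis using r unfolding conjugates_def by blast
qed

lemma cyc_frac_of_rat [simp]: "of_rat c \<in> cyc_frac N"
  and sig_of_rat: "N > 0 \<Longrightarrow> coprime a N \<Longrightarrow> sig N a (of_rat c) = of_rat c"
proof -
  obtain m d where "quotient_of c = (m, d)" by fastforce
  then have md: "c = of_int m / of_int d" "d > 0"
    using quotient_of_div quotient_of_denom_pos by auto
  then have c: "of_rat c = (of_int m / of_int d :: complex)" by (simp add: of_rat_divide)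
  then have eq: "of_int d * of_rat c = ev [:m:] (zt N)" using md by simp
  show "of_rat c \<in> cyc_frac N" by (rule cyc_fracI[OF _ cyc_ringI[OF eq]]) (use md in auto)
  assume "N > 0" "coprime a N"
  then have "of_int d * sig N a (of_rat c) = ev [:m:] (zt N ^ a)"
    by (intro sig_eq[OF _ _ _ eq]) (use md in auto)
  then have "of_int d * sig N a (of_rat c) = of_int d * of_rat c" using eq by simp
  then show "sig N a (of_rat c) = of_rat c" using md by simp
qed

lemma cyc_frac_evq: "x \<in> cyc_frac N \<Longrightarrow> evq q x \<in> cyc_frac N"
  by (induction q) (auto simp: evq_pCons intro!: cyc_frac_add cyc_frac_mult)

lemma sig_evq:
  assumes "N > 0" "coprime a N" "x \<in> cyc_frac N"
  shows "sig N a (evq q x) = evq q (sig N a x)"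
  by (induction q) (auto simp: evq_pCons sig_0 sig_add sig_mult sig_of_rat cyc_frac_mult cyc_frac_evq assms)

text \<open>Applying an automorphism to the coefficients moves the roots. Membership is carried
  along in the induction because \<open>sig\<close> is known to be additive and multiplicative only
  on \<open>cyc_frac N\<close>.\<close>

lemma coeff_prod_sig:
  assumes N: "N > 0" "coprime b N" and A: "finite A" and c: "\<And>i. i \<in> A \<Longrightarrow> c i \<in> cyc_ring N"
  shows "coeff (\<Prod>i\<in>A. [:- c i, 1:]) k \<in> cyc_ring N \<and>
    coeff (\<Prod>i\<in>A. [:- sig N b (c i), 1:]) k = sig N b (coeff (\<Prod>i\<in>A. [:- c i, 1:]) k)"
  using A c
proof (induction A arbitrary: k rule: finite_induct)
  case empty
  then show ?case using N by (cases k) (auto simp: sig_1 sig_0)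
next
  case (insert x A)
  have c: "c x \<in> cyc_ring N" using insert by simp
  have IH: "coeff (\<Prod>i\<in>A. [:- c i, 1:]) j \<in> cyc_ring N"
    "coeff (\<Prod>i\<in>A. [:- sig N b (c i), 1:]) j = sig N b (coeff (\<Prod>i\<in>A. [:- c i, 1:]) j)" for j
    using insert.IH[of j] insert.prems by auto
  show ?case
    using insert.hyps c IH N
    by (cases k) (auto simp: coeff_pCons sig_add sig_diff sig_mult sig_minus cyc_ring_imp_frac cyc_frac_mult
         intro!: cyc_ring_minus cyc_ring_add cyc_ring_diff cyc_ring_mult)
qed

lemma conj_poly:
  assumes N: "N > 0" and x: "x \<in> cyc_ring N"
  shows "\<exists>P. map_poly of_rat P = (\<Prod>a\<in>units_mod N. [:- sig N a x, 1:])"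
proof -
  define Q where "Q = (\<Prod>a\<in>units_mod N. [:- sig N a x, 1:])"
  have ring: "sig N a x \<in> cyc_ring N" if "a \<in> units_mod N" for a
    using that N x by (auto simp: units_mod_def intro: sig_in_ring)
  have "coeff Q k \<in> \<int>" for k
  proof (rule sig_fixed_imp_Ints[OF N])
    show "coeff Q k \<in> cyc_ring N" 
      unfolding Q_def using coeff_prod_sig[of N 1 "units_mod N" "\<lambda>a. sig N a x" k] N ring by simp
    fix b assume b: "coprime b N"
    have "sig N b (coeff Q k) = coeff (\<Prod>a\<in>units_mod N. [:- sig N b (sig N a x), 1:]) k"
      unfolding Q_def using coeff_prod_sig[OF N b, of "units_mod N" "\<lambda>a. sig N a x" k] ring by simp
    also have "(\<Prod>a\<in>units_mod N. [:- sig N b (sig N a x), 1:]) = (\<Prod>a\<in>units_mod N. [:- sig N (a * b mod N) x, 1:])"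
      by (rule prod.cong) (use N b x in \<open>auto simp: units_mod_def sig_sig sig_mod cyc_ring_imp_frac\<close>)
    also have "\<dots> = Q" unfolding Q_def
      by (rule prod_units_mod_mult[OF N b, of "\<lambda>a. [:- sig N a x, 1:]"])
    finally show "sig N b (coeff Q k) = coeff Q k" .
  qed
  then have "of_rat (of_int \<lfloor>Re (coeff Q k)\<rfloor>) = coeff Q k" for k
    by (metis Ints_cases floor_of_int of_rat_of_int_eq Re_complex_of_real of_real_of_int_eq)
  then have "map_poly of_rat (map_poly (\<lambda>x. of_int \<lfloor>Re x\<rfloor>) Q) = Q"
    by (intro poly_eqI) (simp add: coeff_map_poly)
  then show ?thesis unfolding Q_def by blast
qed

text \<open>The product over the orbit may be a proper power of the minimal polynomial; it is only
  the sets of roots that are compared. One inclusion is divisibility, the other holds because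
  \<open>sig\<close> commutes with rational polynomials.\<close>

lemma conjugates_eq_orbit:
  assumes N: "N > 0" and x: "x \<in> cyc_ring N"
  shows "conjugates x = (\<lambda>a. sig N a x) ` units_mod N"
proof -
  obtain P where P: "map_poly of_rat P = (\<Prod>a\<in>units_mod N. [:- sig N a x, 1:])"
    using conj_poly[OF assms] by blast
  have rootP: "evq P y = 0 \<longleftrightarrow> y \<in> (\<lambda>a. sig N a x) ` units_mod N" for y
    unfolding P by (auto simp: poly_prod image_iff)
  have "x = sig N (1 mod N) x" using N x by (simp only: sig_mod sig_one cyc_ring_imp_frac)
  then have "evq P x = 0" unfolding rootP using one_mod_in_units_mod[OF N] by blast
  moreover have "P \<noteq> 0" using P by (auto simp: prod_zero_iff dest: arg_cong[of _ _ "\<lambda>p. p = 0"])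
  ultimately obtain r where r: "is_minimal_polynomial r x" "\<And>s. evq s x = 0 \<Longrightarrow> r dvd s"
    using ex_rat_minimal_polynomial by blast
  have "r dvd P" using r \<open>evq P x = 0\<close> by blast
  have "{y. evq r y = 0} = (\<lambda>a. sig N a x) ` units_mod N"
  proof (intro equalityI subsetI)
    fix y assume "y \<in> {y. evq r y = 0}"
    then have "evq P y = 0" using \<open>r dvd P\<close> by (auto simp: evq_mult)
    then show "y \<in> (\<lambda>a. sig N a x) ` units_mod N" using rootP by blast
  next
    fix y assume "y \<in> (\<lambda>a. sig N a x) ` units_mod N"
    then obtain a where a: "coprime a N" "y = sig N a x" by (auto simp: units_mod_def)
    have "evq r y = sig N a (evq r x)" unfolding a using N a x by (simp add: sig_evq cyc_ring_imp_frac)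
    also have "\<dots> = 0" using r N a by (simp add: is_minimal_polynomial_def sig_0)
    finally show "y \<in> {y. evq r y = 0}" by simp
  qed
  then show ?thesis using conjugates_eq_roots[OF r] by simp
qed

text \<open>The residues taking x to a given conjugate form a coset of the stabiliser of x, so every
  conjugate is hit equally often. Means may thus be computed at any level that contains x.\<close>

lemma orbit_mean:
  fixes G :: "complex \<Rightarrow> 'b::field_char_0"
  assumes N: "N > 0" and x: "x \<in> cyc_ring N"
  shows "(\<Sum>\<gamma>\<in>conjugates x. G \<gamma>) / of_nat (card (conjugates x)) =
    (\<Sum>a\<in>units_mod N. G (sig N a x)) / of_nat (card (units_mod N))"
proof -
  let ?U = "units_mod N" and ?S = "conjugates x"
  define n where "n = card {a \<in> ?U. sig N a x = x}"
  have S: "?S = (\<lambda>a. sig N a x) ` ?U" by (rule conjugates_eq_orbit[OF assms])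
  have fib: "card {a \<in> ?U. sig N a x = y} = n" if y: "y \<in> ?S" for y
  proof -
    obtain b where b: "coprime b N" "y = sig N b x" using y unfolding S by (auto simp: units_mod_def)
    have eq: "sig N (a * b) x = sig N b x \<longleftrightarrow> sig N a x = x" if "a \<in> ?U" for a
    proof -
      have a: "coprime a N" using that by (simp add: units_mod_def)
      have "sig N (a * b) x = sig N b (sig N a x)" using N a b x by (simp add: sig_sig cyc_ring_imp_frac)
      then show ?thesis using sig_inj[OF N b(1), of "sig N a x" x] N a x
        by (auto simp: sig_in_frac cyc_ring_imp_frac)
    qed
    have "card {a \<in> ?U. sig N a x = y} = (\<Sum>a\<in>?U. if sig N a x = y then 1 else 0)"
      unfolding card_eq_sum by (rule sum.inter_filter) simp
    also have "\<dots> = (\<Sum>a\<in>?U. if sig N (a * b) x = y then 1 else 0)"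
      by (rule sum_units_mod_mult[OF N b(1), symmetric]) (simp add: sig_mod N)
    also have "\<dots> = (\<Sum>a\<in>?U. if sig N a x = x then 1 else 0)"
      by (rule sum.cong) (auto simp: b(2) eq)
    also have "\<dots> = n" unfolding n_def card_eq_sum by (rule sum.inter_filter[symmetric]) simp
    finally show ?thesis .
  qed
  have sums: "(\<Sum>a\<in>?U. G (sig N a x)) = of_nat n * (\<Sum>\<gamma>\<in>?S. G \<gamma>)" for G :: "complex \<Rightarrow> 'b"
  proof -
    have "(\<Sum>a\<in>?U. G (sig N a x)) = (\<Sum>y\<in>?S. \<Sum>a\<in>{a \<in> ?U. sig N a x = y}. G (sig N a x))"
      unfolding S by (rule sum.image_gen) simp
    also have "\<dots> = (\<Sum>y\<in>?S. of_nat n * G y)"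
      by (rule sum.cong) (auto simp: fib)
    finally show ?thesis by (simp add: sum_distrib_left)
  qed
  \<comment> \<open>The constant function 1 turns \<open>sums\<close> into the orbit-stabiliser
    count.\<close>
  have "of_nat (card ?U) = (of_nat n * of_nat (card ?S) :: 'b)" using sums[of "\<lambda>_. 1"] by simp
  moreover have "n > 0" using calculation card_units_mod_pos[OF N] by (intro gr0I) auto
  ultimately show ?thesis unfolding sums by simp
qed

section \<open>Linearity and invariance of the means, and the lower bound 1\<close>

definition mean_conj :: "complex \<Rightarrow> complex" where
  "mean_conj x = (\<Sum>\<gamma>\<in>conjugates x. \<gamma>) / of_nat (card (conjugates x))"

lemma mean_conj_eq:
  assumes "N > 0" "x \<in> cyc_ring N"
  shows "mean_conj x = (\<Sum>a\<in>units_mod N. sig N a x) / of_nat (card (units_mod N))"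
  unfolding mean_conj_def by (rule orbit_mean[OF assms, of "\<lambda>x. x"])

lemma mean_sq_conj_eq:
  assumes "N > 0" "x \<in> cyc_ring N"
  shows "mean_sq_conj x = (\<Sum>a\<in>units_mod N. (cmod (sig N a x))\<^sup>2) / of_nat (card (units_mod N))"
  unfolding mean_sq_conj_def by (rule orbit_mean[OF assms])

lemma mean_conj_add:
  assumes "N > 0" "x \<in> cyc_ring N" "y \<in> cyc_ring N"
  shows "mean_conj (x + y) = mean_conj x + mean_conj y"
proof -
  have "(\<Sum>a\<in>units_mod N. sig N a (x + y)) = (\<Sum>a\<in>units_mod N. sig N a x) + (\<Sum>a\<in>units_mod N. sig N a y)"
    unfolding sum.distrib[symmetric]
    by (rule sum.cong) (use assms in \<open>auto simp: units_mod_def sig_add cyc_ring_imp_frac\<close>)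
  then show ?thesis using assms by (simp add: mean_conj_eq cyc_ring_add add_divide_distrib)
qed

lemma mean_conj_of_int_mult:
  assumes "N > 0" "x \<in> cyc_ring N"
  shows "mean_conj (of_int c * x) = of_int c * mean_conj x"
proof -
  have "(\<Sum>a\<in>units_mod N. sig N a (of_int c * x)) = of_int c * (\<Sum>a\<in>units_mod N. sig N a x)"
    unfolding sum_distrib_left
    by (rule sum.cong) (use assms in \<open>auto simp: units_mod_def sig_mult sig_of_int cyc_ring_imp_frac\<close>)
  then show ?thesis using assms by (simp add: mean_conj_eq cyc_ring_mult)
qed

lemma mean_conj_0 [simp]: "mean_conj 0 = 0"
  using mean_conj_of_int_mult[of 1 0 0] by simp

lemma mean_conj_1 [simp]: "mean_conj 1 = 1"
proof -
  have "units_mod (Suc 0) = {0}" by (auto simp: units_mod_def)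
  then show ?thesis using mean_conj_eq[of 1 1] by (simp add: sig_1)
qed

lemma mean_conj_sum:
  assumes "N > 0" "\<And>i. i \<in> A \<Longrightarrow> g i \<in> cyc_ring N"
  shows "mean_conj (sum g A) = (\<Sum>i\<in>A. mean_conj (g i))"
  using assms(2)
  by (induction A rule: infinite_finite_induct) (auto simp: mean_conj_add[OF assms(1)] cyc_ring_sum)

lemma mean_conj_sig:
  assumes "N > 0" "coprime b N" "x \<in> cyc_ring N"
  shows "mean_conj (sig N b x) = mean_conj x"
proof -
  have "(\<Sum>a\<in>units_mod N. sig N a (sig N b x)) = (\<Sum>a\<in>units_mod N. sig N (a * b) x)"
    by (rule sum.cong) (use assms in \<open>auto simp: units_mod_def sig_sig cyc_ring_imp_frac mult.commute\<close>)
  also have "\<dots> = (\<Sum>a\<in>units_mod N. sig N a x)"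
    by (rule sum_units_mod_mult[OF assms(1,2)]) (simp add: sig_mod assms)
  finally show ?thesis using assms by (simp add: mean_conj_eq sig_in_ring)
qed

lemma mean_conj_norm_sq:
  assumes "N > 0" "x \<in> cyc_ring N"
  shows "mean_conj (x * cnj x) = of_real (mean_sq_conj x)"
proof -
  have "(\<Sum>a\<in>units_mod N. sig N a (x * cnj x)) = (\<Sum>a\<in>units_mod N. of_real ((cmod (sig N a x))\<^sup>2))"
    by (rule sum.cong)
       (use assms in \<open>auto simp: units_mod_def sig_mult cyc_ring_imp_frac cyc_ring_cnj sig_cnj complex_norm_square simp del: of_real_power\<close>)
  then show ?thesis using assms by (simp add: mean_conj_eq mean_sq_conj_eq cyc_ring_mult cyc_ring_cnj)
qed

lemma mean_sq_conj_nonneg: "mean_sq_conj x \<ge> 0"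
  by (simp add: mean_sq_conj_def sum_nonneg)

text \<open>The product is the norm of x: a rational integer, being fixed by every automorphism, and
  nonzero because automorphisms are injective.\<close>

lemma cmod_prod_conjugates_ge_1:
  assumes N: "N > 0" and x: "x \<in> cyc_ring N" "x \<noteq> 0"
  shows "cmod (\<Prod>a\<in>units_mod N. sig N a x) \<ge> 1"
proof -
  have nz: "sig N a x \<noteq> 0" if "coprime a N" for a
    using sig_inj[OF N that, of x 0] x N that by (auto simp: sig_0 cyc_ring_imp_frac)
  have "(\<Prod>a\<in>units_mod N. sig N a x) \<in> \<int>"
  proof (rule sig_fixed_imp_Ints[OF N])
    show "(\<Prod>a\<in>units_mod N. sig N a x) \<in> cyc_ring N"
      by (rule cyc_ring_prod) (use N x in \<open>auto simp: units_mod_def intro: sig_in_ring\<close>)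
    fix b assume b: "coprime b N"
    have "sig N b (\<Prod>a\<in>units_mod N. sig N a x) = (\<Prod>a\<in>units_mod N. sig N b (sig N a x))"
      by (rule sig_prod[OF N b]) (use N x in \<open>auto simp: units_mod_def intro: sig_in_frac cyc_ring_imp_frac\<close>)
    also have "\<dots> = (\<Prod>a\<in>units_mod N. sig N (a * b mod N) x)"
      by (rule prod.cong) (use N b x in \<open>auto simp: units_mod_def sig_sig sig_mod cyc_ring_imp_frac\<close>)
    also have "\<dots> = (\<Prod>a\<in>units_mod N. sig N a x)"
      by (rule prod_units_mod_mult[OF N b])
    finally show "sig N b (\<Prod>a\<in>units_mod N. sig N a x) = (\<Prod>a\<in>units_mod N. sig N a x)" .
  qed
  then obtain m where m: "(\<Prod>a\<in>units_mod N. sig N a x) = of_int m" by (rule Ints_cases)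
  have "(\<Prod>a\<in>units_mod N. sig N a x) \<noteq> 0" using nz by (auto simp: units_mod_def prod_zero_iff)
  then have "m \<noteq> 0" using m by auto
  then show ?thesis unfolding m by simp
qed

text \<open>The inequality of arithmetic and geometric means applied to the norm, in the form ln t
  \<le> t - 1 summed over the conjugates.\<close>

lemma mean_sq_conj_ge_1:
  assumes N: "N > 0" and x: "x \<in> cyc_ring N" "x \<noteq> 0"
  shows "mean_sq_conj x \<ge> 1"
proof -
  let ?U = "units_mod N"
  have pos: "(cmod (sig N a x))\<^sup>2 > 0" if "a \<in> ?U" for a
  proof -
    have "sig N a x \<noteq> 0"
    proof
      assume "sig N a x = 0"
      then have "(\<Prod>a\<in>?U. sig N a x) = 0" using that by (meson finite_units_mod prod_zero)
      then show False using cmod_prod_conjugates_ge_1[OF assms] by (metis norm_zero not_one_le_zero)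
    qed
    then show ?thesis by simp
  qed
  have "1 \<le> (cmod (\<Prod>a\<in>?U. sig N a x))\<^sup>2" using cmod_prod_conjugates_ge_1[OF assms] by (simp add: one_le_power)
  also have "\<dots> = (\<Prod>a\<in>?U. (cmod (sig N a x))\<^sup>2)" by (simp add: prod_norm[symmetric] prod_power_distrib)
  finally have "0 \<le> ln (\<Prod>a\<in>?U. (cmod (sig N a x))\<^sup>2)" by simp
  also have "\<dots> = (\<Sum>a\<in>?U. ln ((cmod (sig N a x))\<^sup>2))"
    using pos by (intro ln_prod) auto
  also have "\<dots> \<le> (\<Sum>a\<in>?U. (cmod (sig N a x))\<^sup>2 - 1)"
    using pos by (intro sum_mono ln_le_minus_one) auto
  also have "\<dots> = (\<Sum>a\<in>?U. (cmod (sig N a x))\<^sup>2) - real (card ?U)" by (simp add: sum_subtractf)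
  finally show ?thesis using card_units_mod_pos[OF N] by (simp add: mean_sq_conj_eq[OF N x(1)] le_divide_eq)
qed

section \<open>The ring of integers\<close>

lemma cyc_frac_fixed_imp_Rats:
  assumes N: "N > 0" and x: "x \<in> cyc_frac N" "\<And>a. coprime a N \<Longrightarrow> sig N a x = x"
  shows "x \<in> \<rat>"
proof -
  obtain d where d: "d \<noteq> 0" "of_int d * x \<in> cyc_ring N" using x(1) by (auto simp: cyc_frac_def)
  have "of_int d * x \<in> \<int>"
    by (rule sig_fixed_imp_Ints[OF N d(2)]) (use N x in \<open>simp add: sig_mult sig_of_int\<close>)
  then obtain m where "of_int d * x = of_int m" by (rule Ints_cases)
  then have "x = of_int m / of_int d" using d(1) by (simp add: field_simps)
  then show ?thesis by simp
qed

lemma Rats_cyc_ring_imp_Ints: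
  assumes N: "N > 0" and x: "x \<in> cyc_ring N" "x \<in> \<rat>"
  shows "x \<in> \<int>"
  using x(2) by (elim Rats_cases) (use N x in \<open>auto intro!: sig_fixed_imp_Ints simp: sig_of_rat\<close>)

text \<open>
  Complete integral closure of \<open>\<int>[\<zeta>]\<close>: unlike for \<^const>\<open>algebraic_int\<close>, closure under sums and products
  is immediate.
\<close>

definition almost_int :: "nat \<Rightarrow> complex set" where
  "almost_int N = {x. \<exists>D::int. D \<noteq> 0 \<and> (\<forall>n. of_int D * x ^ n \<in> cyc_ring N)}"

lemma cyc_ring_imp_almost_int: "x \<in> cyc_ring N \<Longrightarrow> x \<in> almost_int N"
  unfolding almost_int_def by (auto intro!: exI[of _ 1] cyc_ring_power)

lemma almost_int_imp_frac: 
  assumes "x \<in> almost_int N" shows "x \<in> cyc_frac N"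
proof -
  obtain D :: int where "D \<noteq> 0" "of_int D * x ^ 1 \<in> cyc_ring N"
    using assms unfolding almost_int_def by blast
  then show ?thesis by (intro cyc_fracI[of D]) auto
qed

lemma almost_int_add:
  assumes "x \<in> almost_int N" "y \<in> almost_int N" shows "x + y \<in> almost_int N"
proof -
  obtain D :: int where D: "D \<noteq> 0" "\<And>n. of_int D * x ^ n \<in> cyc_ring N"
    using assms unfolding almost_int_def by blast
  obtain E :: int where E: "E \<noteq> 0" "\<And>n. of_int E * y ^ n \<in> cyc_ring N"
    using assms unfolding almost_int_def by blast
  have "of_int (D * E) * (x + y) ^ n \<in> cyc_ring N" for n
  proof -
    have "of_int (D * E) * (x + y) ^ n = (\<Sum>k\<le>n. of_nat (n choose k) * ((of_int D * x ^ k) * (of_int E * y ^ (n - k))))"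
      unfolding binomial_ring sum_distrib_left by (rule sum.cong) simp_all
    then show ?thesis by (simp only:) (intro cyc_ring_sum cyc_ring_mult D E cyc_ring_of_nat)
  qed
  then show ?thesis using D E unfolding almost_int_def by (intro CollectI exI[of _ "D * E"]) auto
qed

lemma almost_int_mult:
  assumes "x \<in> almost_int N" "y \<in> almost_int N" shows "x * y \<in> almost_int N"
proof -
  obtain D :: int where D: "D \<noteq> 0" "\<And>n. of_int D * x ^ n \<in> cyc_ring N"
    using assms unfolding almost_int_def by blast
  obtain E :: int where E: "E \<noteq> 0" "\<And>n. of_int E * y ^ n \<in> cyc_ring N"
    using assms unfolding almost_int_def by blast
  have "of_int (D * E) * (x * y) ^ n \<in> cyc_ring N" for n
  proof -
    have "of_int (D * E) * (x * y) ^ n = (of_int D * x ^ n) * (of_int E * y ^ n)"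
      by (simp add: power_mult_distrib)
    then show ?thesis by (simp only:) (intro cyc_ring_mult D E)
  qed
  then show ?thesis using D E unfolding almost_int_def by (intro CollectI exI[of _ "D * E"]) auto
qed

lemma almost_int_power: "x \<in> almost_int N \<Longrightarrow> x ^ n \<in> almost_int N"
  by (induction n) (auto intro: almost_int_mult cyc_ring_imp_almost_int)

lemma almost_int_diff: 
  assumes "x \<in> almost_int N" "y \<in> almost_int N" shows "x - y \<in> almost_int N"
  using almost_int_add[OF assms(1) almost_int_mult[OF cyc_ring_imp_almost_int[OF cyc_ring_of_int[of "-1"]] assms(2)]]
  by simp

lemma almost_int_sum: "(\<And>i. i \<in> A \<Longrightarrow> g i \<in> almost_int N) \<Longrightarrow> sum g A \<in> almost_int N"
  by (induction A rule: infinite_finite_induct) (auto intro: almost_int_add cyc_ring_imp_almost_int)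

lemma almost_int_sig:
  assumes "N > 0" "coprime a N" "x \<in> almost_int N" shows "sig N a x \<in> almost_int N"
proof -
  obtain D :: int where D: "D \<noteq> 0" "\<And>n. of_int D * x ^ n \<in> cyc_ring N"
    using assms unfolding almost_int_def by blast
  have x: "x \<in> cyc_frac N" by (rule almost_int_imp_frac[OF assms(3)])
  have "of_int D * sig N a x ^ n \<in> cyc_ring N" for n
  proof -
    have "of_int D * sig N a x ^ n = sig N a (of_int D * x ^ n)"
      using assms x by (simp add: sig_mult sig_power sig_of_int cyc_frac_power)
    then show ?thesis using sig_in_ring[OF assms(1,2) D(2)] by simp
  qed
  then show ?thesis using D unfolding almost_int_def by blast
qed

text \<open>If x = u/v in lowest terms, then D x^n is an integer for all n, so every power of v
  divides D. For v \<ge> 2 the exponent |D| already gives a power exceeding |D|.\<close>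

lemma Rats_almost_int_imp_Ints:
  assumes N: "N > 0" and x: "x \<in> almost_int N" "x \<in> \<rat>"
  shows "x \<in> \<int>"
proof -
  obtain D :: int where D: "D \<noteq> 0" "\<And>n. of_int D * x ^ n \<in> cyc_ring N"
    using x unfolding almost_int_def by blast
  obtain c where c: "x = of_rat c" using x(2) by (rule Rats_cases)
  obtain u v where "quotient_of c = (u, v)" by fastforce
  then have uv: "c = of_int u / of_int v" "v > 0" "coprime u v"
    using quotient_of_div quotient_of_denom_pos quotient_of_coprime by auto
  then have xuv: "x = of_int u / of_int v" using c by (simp add: of_rat_divide)
  have dvd: "v ^ n dvd D" for n
  proof -
    have "of_int D * x ^ n \<in> \<int>"
      by (rule Rats_cyc_ring_imp_Ints[OF N D(2)]) (use x in auto)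
    then obtain m where m: "of_int D * x ^ n = of_int m" by (rule Ints_cases)
    then have "of_int (D * u ^ n) = (of_int (m * v ^ n) :: complex)"
      using uv(2) unfolding xuv by (simp add: power_divide field_simps)
    then have "D * u ^ n = m * v ^ n" by (simp only: of_int_eq_iff)
    then have "v ^ n dvd D * u ^ n" by simp
    moreover have "coprime (v ^ n) (u ^ n)" using uv(3) by (simp add: coprime_commute)
    ultimately show ?thesis by (simp add: coprime_dvd_mult_left_iff)
  qed
  have "v = 1"
  proof (rule ccontr)
    assume "v \<noteq> 1"
    then have "v \<ge> 2" using uv(2) by simp
    then have "2 ^ nat \<bar>D\<bar> \<le> v ^ nat \<bar>D\<bar>" by (intro power_mono) auto
    also have "\<dots> \<le> \<bar>D\<bar>" using dvd_imp_le_int[OF D(1) dvd[of "nat \<bar>D\<bar>"]] uv(2) by simp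
    finally have "2 ^ nat \<bar>D\<bar> \<le> \<bar>D\<bar>" .
    moreover have "int (nat \<bar>D\<bar>) < 2 ^ nat \<bar>D\<bar>" by (rule of_nat_less_two_power)
    ultimately show False by simp
  qed
  then show ?thesis using xuv by simp
qed

section \<open>Traces as a bound on denominators\<close>

lemma sum_root_unity_powers:
  fixes w :: complex
  assumes "w ^ N = 1" shows "(\<Sum>j<N. w ^ j) = (if w = 1 then of_nat N else 0)"
  using assms geometric_sum[of w N] by auto

text \<open>Fourier inversion: the exponent (N - 1) j stands for -j, and after exchanging the sums
  the inner sum runs over the powers of zeta^(1 - a), which cancel unless a is 1 modulo N. It
  recovers x from rational traces, for bounding denominators here and for finiteness at a fixed
  level later.\<close>

lemma trace_expansion:
  assumes N: "N > 0" and x: "x \<in> cyc_frac N"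
  shows "of_nat N * x = (\<Sum>j<N. (\<Sum>a\<in>units_mod N. sig N a (x * zt N ^ ((N - 1) * j))) * zt N ^ j)"
proof -
  have "(\<Sum>j<N. (\<Sum>a\<in>units_mod N. sig N a (x * zt N ^ ((N - 1) * j))) * zt N ^ j) =
     (\<Sum>j<N. \<Sum>a\<in>units_mod N. sig N a x * (zt N ^ ((N - 1) * a + 1)) ^ j)"
    unfolding sum_distrib_right
  proof (intro sum.cong refl)
    fix j a assume "a \<in> units_mod N"
    then have a: "coprime a N" by (simp add: units_mod_def)
    have "sig N a (x * zt N ^ ((N - 1) * j)) = sig N a x * zt N ^ ((N - 1) * j * a)"
      by (simp only: sig_mult[OF N a x cyc_ring_imp_frac[OF cyc_ring_power[OF cyc_ring_zt]]] sig_zt_pow[OF N a])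
    moreover have "(zt N ^ ((N - 1) * a + 1)) ^ j = zt N ^ ((N - 1) * j * a) * zt N ^ j"
      by (simp add: algebra_simps flip: power_mult power_add)
    ultimately show "sig N a (x * zt N ^ ((N - 1) * j)) * zt N ^ j = sig N a x * (zt N ^ ((N - 1) * a + 1)) ^ j"
      by (simp only: mult.assoc)
  qed
  also have "\<dots> = (\<Sum>a\<in>units_mod N. sig N a x * (\<Sum>j<N. (zt N ^ ((N - 1) * a + 1)) ^ j))"
    unfolding sum_distrib_left by (rule sum.swap)
  also have "\<dots> = (\<Sum>a\<in>units_mod N. if a = 1 mod N then sig N a x * of_nat N else 0)"
  proof (intro sum.cong refl)
    fix a assume a: "a \<in> units_mod N"
    have "zt N ^ ((N - 1) * a + 1) = 1 \<longleftrightarrow> zt N ^ ((N - 1) * a + 1) * zt N ^ a = zt N ^ a" by simp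
    also have "zt N ^ ((N - 1) * a + 1) * zt N ^ a = zt N ^ (N * a) * zt N"
      using N by (cases N) (auto simp: algebra_simps power_add)
    also have "zt N ^ (N * a) = 1" using N by (simp add: power_mult)
    also have "1 * zt N = zt N ^ a \<longleftrightarrow> [1 = a] (mod N)" using zt_pow_cong[OF N, of 1 a] by simp
    also have "\<dots> \<longleftrightarrow> a = 1 mod N" using a by (auto simp: cong_def units_mod_def)
    finally have iff: "zt N ^ ((N - 1) * a + 1) = 1 \<longleftrightarrow> a = 1 mod N" .
    have "(zt N ^ ((N - 1) * a + 1)) ^ N = 1"
      using N by (metis mult.commute power_mult power_one zt_pow_N)
    from sum_root_unity_powers[OF this]
    show "sig N a x * (\<Sum>j<N. (zt N ^ ((N - 1) * a + 1)) ^ j) = (if a = 1 mod N then sig N a x * of_nat N else 0)"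
      unfolding iff by simp
  qed
  also have "\<dots> = sig N (1 mod N) x * of_nat N"
    using one_mod_in_units_mod[OF N] by simp
  also have "sig N (1 mod N) x = x" by (simp only: sig_mod[OF N] sig_one[OF N x])
  finally show ?thesis by (simp add: mult.commute)
qed

text \<open>The traces in the expansion of m x are rational and almost integral, hence integers. Two
  levels occur because x may lie in the field of level m while integrality of its conjugates is only
  known inside the larger level N.\<close>

lemma trace_denominator:
  assumes m: "m > 0" and N: "N > 0" "m dvd N" and x: "x \<in> cyc_frac m"
    and conj: "\<And>b. coprime b m \<Longrightarrow> sig m b x \<in> almost_int N"
  shows "of_nat m * x \<in> cyc_ring m"
proof -
  have "(\<Sum>a\<in>units_mod m. sig m a (x * zt m ^ ((m - 1) * j))) \<in> \<int>" (is "?t j \<in> _") for j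
  proof (rule Rats_almost_int_imp_Ints[OF N(1)])
    let ?y = "x * zt m ^ ((m - 1) * j)"
    have z: "zt m ^ ((m - 1) * j) \<in> cyc_ring m" by (simp add: cyc_ring_power)
    have y: "?y \<in> cyc_frac m" using x cyc_ring_imp_frac[OF z] by (rule cyc_frac_mult(1))
    show "?t j \<in> almost_int N"
    proof (rule almost_int_sum)
      fix a assume "a \<in> units_mod m"
      then have a: "coprime a m" by (simp add: units_mod_def)
      have "sig m a ?y = sig m a x * sig m a (zt m ^ ((m - 1) * j))"
        by (rule sig_mult[OF m a x cyc_ring_imp_frac[OF z]])
      moreover have "sig m a (zt m ^ ((m - 1) * j)) \<in> almost_int N"
        using sig_in_ring[OF m a z] cyc_ring_mono[OF N] by (blast intro: cyc_ring_imp_almost_int)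
      ultimately show "sig m a ?y \<in> almost_int N" using conj[OF a] almost_int_mult by simp
    qed
    show "?t j \<in> \<rat>"
    proof (rule cyc_frac_fixed_imp_Rats[OF m])
      show "?t j \<in> cyc_frac m"
        by (rule cyc_frac_sum) (use m y in \<open>auto simp: units_mod_def intro: sig_in_frac\<close>)
      fix b assume b: "coprime b m"
      have "sig m b (?t j) = (\<Sum>a\<in>units_mod m. sig m b (sig m a ?y))"
        by (rule sig_sum[OF m b]) (use m y in \<open>auto simp: units_mod_def intro: sig_in_frac\<close>)
      also have "\<dots> = (\<Sum>a\<in>units_mod m. sig m (a * b) ?y)"
        by (rule sum.cong) (use m b y in \<open>auto simp: units_mod_def sig_sig\<close>)
      also have "\<dots> = ?t j" by (rule sum_units_mod_mult[OF m b]) (simp add: sig_mod m)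
      finally show "sig m b (?t j) = ?t j" .
    qed
  qed
  then have "(\<Sum>j<m. ?t j * zt m ^ j) \<in> cyc_ring m"
    by (intro cyc_ring_sum cyc_ring_mult cyc_ring_Ints cyc_ring_power cyc_ring_zt)
  then show ?thesis using trace_expansion[OF m x] by simp
qed

section \<open>Passing between a level and its coprime factors\<close>

lemma sig_lift:
  assumes m: "m > 0" "coprime b m" and N: "N > 0" "m dvd N" "coprime a N" "[a = b] (mod m)" 
    and x: "x \<in> cyc_frac m"
  shows "sig N a x = sig m b x"
proof -
  obtain d f where d: "d \<noteq> 0" "of_int d * x = ev f (zt m)" using x by (elim cyc_fracE)
  have e: "of_int d * x = ev (pcompose f (monom 1 (N div m))) (zt N)"
    using d zt_dvd[OF N(1,2)] by simp
  have "of_int d * sig N a x = ev f ((zt N ^ a) ^ (N div m))"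
    using sig_eq[OF N(1,3) d(1) e] by simp
  also have "(zt N ^ a) ^ (N div m) = zt m ^ a" unfolding zt_dvd[OF N(1,2)]
    by (metis mult.commute power_mult)
  also have "\<dots> = zt m ^ b" using zt_pow_cong[OF m(1)] N(4) by simp
  also have "ev f (zt m ^ b) = of_int d * sig m b x" using sig_eq[OF m d] by simp
  finally show ?thesis using d(1) by simp
qed

lemma ex_coprime_lift:
  assumes "coprime q m" "q > 0" "coprime b (m::nat)" "coprime c q"
  shows "\<exists>a. coprime a (q * m) \<and> [a = b] (mod m) \<and> [a = c] (mod q)"
proof -
  obtain a where a: "[a = b] (mod m)" "[a = c] (mod q)"
    using binary_chinese_remainder_nat[of m q b c] assms(1) by (auto simp: coprime_commute)
  have "coprime a m" "coprime a q" using a assms by (metis cong_imp_coprime cong_sym)+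
  then show ?thesis using a by auto
qed

text \<open>Here u m + v q is 1 modulo q m. The congruence for \<open>u\<close> is exported because
  it makes \<open>zt q ^ u\<close> a primitive q-th root of unity.\<close>

lemma zt_coprime_decompose:
  assumes "coprime q m" "q > 0" "m > 0"
  shows "\<exists>u v. zt (q * m) = zt q ^ u * zt m ^ v \<and> [u * m = 1] (mod q)"
proof -
  obtain u where u: "[m * u = 1] (mod q)" using cong_solve_coprime_nat[of m q] assms by (auto simp: coprime_commute)
  obtain v where v: "[q * v = 1] (mod m)" using cong_solve_coprime_nat[of q m] assms by auto
  have "[u * m + v * q = 1] (mod q)" using u by (simp add: cong_def mult.commute)
  moreover have "[u * m + v * q = 1] (mod m)" using v by (simp add: cong_def mult.commute)
  ultimately have "[u * m + v * q = 1] (mod (q * m))" using assms(1) by (intro coprime_cong_mult_nat)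
  then have "zt (q * m) ^ (u * m + v * q) = zt (q * m) ^ 1" using assms by (subst zt_pow_cong) auto
  moreover have "zt (q * m) ^ (v * q) = zt m ^ v"
    using zt_mult[of m q] assms by (metis mult.commute power_mult)
  moreover have "zt (q * m) ^ (u * m) = zt q ^ u"
    using zt_mult[of q m] assms by (metis mult.commute power_mult)
  ultimately show ?thesis using u by (intro exI[of _ u] exI[of _ v]) (simp add: power_add mult.commute)
qed

lemma ev_frobenius_power:
  assumes p: "prime (p::nat)"
  shows "\<exists>h. ev f z ^ (p ^ k) = ev f (z ^ (p ^ k)) + of_nat p * ev h z"
proof (induction k arbitrary: f)
  case 0
  show ?case by (rule exI[of _ 0]) simp
next
  case (Suc k)
  obtain h where h: "f ^ p = pcompose f (monom 1 p) + of_nat p * h" using poly_frobenius[OF p] by blast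
  obtain h' where h': "ev (f ^ p) z ^ (p ^ k) = ev (f ^ p) (z ^ (p ^ k)) + of_nat p * ev h' z" using Suc.IH by blast
  have "ev f z ^ (p ^ Suc k) = ev (f ^ p) z ^ (p ^ k)" by (simp add: power_mult)
  also have "\<dots> = ev (pcompose f (monom 1 p) + of_nat p * h) (z ^ (p ^ k)) + of_nat p * ev h' z"
    unfolding h' unfolding h ..
  also have "\<dots> = ev f ((z ^ (p ^ k)) ^ p) + of_nat p * ev (pcompose h (monom 1 (p ^ k)) + h') z"
    by (simp add: algebra_simps)
  also have "(z ^ (p ^ k)) ^ p = z ^ (p ^ Suc k)" by (simp add: mult.commute flip: power_mult)
  finally show ?case by blast
qed

lemma ex_power_cong_1:
  assumes "coprime p (m::nat)" "m > 0"
  shows "\<exists>t>0. [p ^ t = 1] (mod m)"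
proof -
  have "\<not> inj (\<lambda>n. p ^ n mod m)"
  proof
    assume "inj (\<lambda>n. p ^ n mod m)"
    then have "infinite (range (\<lambda>n. p ^ n mod m))" by (simp add: range_inj_infinite)
    moreover have "range (\<lambda>n. p ^ n mod m) \<subseteq> {..<m}" using assms by auto
    ultimately show False using finite_subset by blast
  qed
  then obtain i j where ij: "i < j" "[p ^ i = p ^ j] (mod m)"
    unfolding inj_def cong_def by (metis linorder_neqE_nat)
  then have "[p ^ i * 1 = p ^ i * p ^ (j - i)] (mod m)" by (simp flip: power_add)
  then have "[1 = p ^ (j - i)] (mod m)"
    using assms cong_mult_lcancel_nat[of "p ^ i" m] by (meson coprime_power_left_iff)
  then show ?thesis using ij by (intro exI[of _ "j - i"]) (auto simp: cong_sym)
qed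

lemma one_minus_zt_power_dvd:
  assumes "q > 0"
  shows "\<exists>w\<in>cyc_ring q. 1 - zt q ^ u = (1 - zt q) * w"
  by (rule bexI[of _ "\<Sum>i<u. zt q ^ i"]) (auto simp: one_diff_power_eq intro!: cyc_ring_sum cyc_ring_power)

text \<open>Modulo 1 - \<open>zt q\<close> the factor \<open>zt q ^ u\<close> of \<open>zt N\<close>
  becomes 1, so \<open>zt N\<close> is congruent to a power of \<open>zt m\<close>; this passes
  through Horner's scheme.\<close>

lemma cyc_ring_mod_one_minus_zt:
  assumes co: "coprime q m" "q > 0" "m > 0" and x: "x \<in> cyc_ring (q * m)"
  shows "\<exists>c\<in>cyc_ring m. \<exists>w\<in>cyc_ring (q * m). x = c + (1 - zt q) * w"
proof -
  define N where "N = q * m"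
  have N: "N > 0" "q dvd N" "m dvd N" using co by (auto simp: N_def)
  note sub = cyc_ring_mono[OF N(1,2), THEN subsetD] cyc_ring_mono[OF N(1,3), THEN subsetD]
  obtain u v where uv: "zt N = zt q ^ u * zt m ^ v" using zt_coprime_decompose[OF co] unfolding N_def by blast
  obtain w0 where w0: "w0 \<in> cyc_ring q" "1 - zt q ^ u = (1 - zt q) * w0"
    using one_minus_zt_power_dvd[OF co(2)] by blast
  have step: "\<exists>c\<in>cyc_ring m. \<exists>w\<in>cyc_ring N. ev f (zt N) = c + (1 - zt q) * w" for f
  proof (induction f)
    case 0
    show ?case by (intro bexI[of _ 0]) auto
  next
    case (pCons a f)
    then obtain c w where cw: "c \<in> cyc_ring m" "w \<in> cyc_ring N" "ev f (zt N) = c + (1 - zt q) * w" by blast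
    have "zt N = zt m ^ v - zt m ^ v * (1 - zt q ^ u)" by (simp add: uv algebra_simps)
    then have zN: "zt N = zt m ^ v - zt m ^ v * ((1 - zt q) * w0)" unfolding w0(2) .
    have "ev (pCons a f) (zt N) = of_int a + zt N * c + (1 - zt q) * (zt N * w)"
      by (simp add: cw(3) algebra_simps)
    also have "zt N * c = zt m ^ v * c - (1 - zt q) * (zt m ^ v * w0 * c)"
      unfolding zN by (simp add: algebra_simps)
    finally have "ev (pCons a f) (zt N) = (of_int a + zt m ^ v * c) + (1 - zt q) * (zt N * w - zt m ^ v * w0 * c)"
      by (simp add: algebra_simps)
    moreover have "of_int a + zt m ^ v * c \<in> cyc_ring m"
      using cw by (intro cyc_ring_add cyc_ring_mult cyc_ring_power) auto
    moreover have "zt N * w - zt m ^ v * w0 * c \<in> cyc_ring N"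
      using cw w0 by (intro cyc_ring_diff cyc_ring_mult cyc_ring_power) (auto intro: sub cyc_ring_power)
    ultimately show ?case by blast
  qed
  obtain f where "x = ev f (zt N)" using x unfolding N_def by (rule cyc_ringE)
  then show ?thesis using step[of f] unfolding N_def by simp
qed

section \<open>Saturation of Z[zeta] at a prime dividing the level\<close>

context
  fixes p k m :: nat
  assumes p: "prime p" and k: "k > 0" and m: "m > 0" "\<not> p dvd m"
begin

lemma prime_power_facts: "p > 0" "p ^ k > 0" "p ^ k > 1" "p ^ k * m > 0" "p ^ k dvd p ^ k * m" "m dvd p ^ k * m" "coprime (p ^ k) m" "coprime p m"
proof -
  show "p > 0" using p prime_gt_0_nat by blast
  then show "p ^ k > 0" "p ^ k * m > 0" using m by auto
  show "p ^ k > 1" using prime_gt_1_nat[OF p] k by (rule one_less_power)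
  show "coprime p m" using p m prime_imp_coprime by blast
  then show "coprime (p ^ k) m" by simp
qed auto

lemma one_minus_zt_nonzero: "1 - zt (p ^ k) \<noteq> 0"
  using zt_pow_eq_1[OF prime_power_facts(2), of 1] prime_power_facts(3) by auto

lemma one_minus_zt_in_ring: "(1 - zt (p ^ k)) \<in> cyc_ring (p ^ k * m)"
  using cyc_ring_mono[OF prime_power_facts(4,5)] by (intro cyc_ring_diff) auto

text \<open>The p-th roots of unity add up to 0, so p is the sum of the differences 1 -
  \<open>zt p ^ i\<close>, each a multiple of 1 - \<open>zt (p ^ k)\<close> by the geometric
  sum.\<close>

lemma prime_multiple_of_one_minus_zt: "\<exists>w\<in>cyc_ring (p ^ k * m). of_nat p = (1 - zt (p ^ k)) * w"
proof -
  have p0: "p > 0" using prime_power_facts by simp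
  have ztp: "zt p = zt (p ^ k) ^ (p ^ (k - 1))"
    using zt_dvd[of "p ^ k" p] prime_power_facts k p0 by (simp add: power_diff)
  have "zt p \<noteq> 1" using zt_pow_eq_1[OF p0, of 1] prime_gt_1_nat[OF p] by auto
  then have "(\<Sum>i<p. zt p ^ i) = 0" using sum_root_unity_powers[of "zt p" p] p0 by simp
  then have "of_nat p = (\<Sum>i<p. 1 - zt p ^ i)" by (simp add: sum_subtractf)
  also have "\<dots> = (\<Sum>i<p. 1 - zt (p ^ k) ^ (p ^ (k - 1) * i))" unfolding ztp by (simp add: power_mult)
  also have "\<dots> = (\<Sum>i<p. (1 - zt (p ^ k)) * (\<Sum>l<p ^ (k - 1) * i. zt (p ^ k) ^ l))"
    by (simp only: one_diff_power_eq)
  also have "\<dots> = (1 - zt (p ^ k)) * (\<Sum>i<p. \<Sum>l<p ^ (k - 1) * i. zt (p ^ k) ^ l)" by (simp add: sum_distrib_left)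
  finally show ?thesis
    using cyc_ring_mono[OF prime_power_facts(4,5)]
    by (intro bexI[of _ "\<Sum>i<p. \<Sum>l<p ^ (k - 1) * i. zt (p ^ k) ^ l"]) (auto intro!: cyc_ring_sum cyc_ring_power)
qed

text \<open>Frobenius: modulo p the left side is 1 - \<open>zt (p ^ k) ^ (p ^ k)\<close>, which is
  0.\<close>

lemma one_minus_zt_power_multiple_of_prime: "\<exists>w\<in>cyc_ring (p ^ k * m). (1 - zt (p ^ k)) ^ (p ^ k) = of_nat p * w"
proof -
  obtain h where h: "ev [:1, -1:] (zt (p ^ k)) ^ (p ^ k) = ev [:1, -1:] (zt (p ^ k) ^ (p ^ k)) + of_nat p * ev h (zt (p ^ k))"
    using ev_frobenius_power[OF p] by blast
  have "(1 - zt (p ^ k)) ^ (p ^ k) = of_nat p * ev h (zt (p ^ k))" using h prime_power_facts by simp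
  moreover have "ev h (zt (p ^ k)) \<in> cyc_ring (p ^ k * m)" 
    using cyc_ring_mono[OF prime_power_facts(4,5)] cyc_ringI[OF refl] by blast
  ultimately show ?thesis by blast
qed

text \<open>If p^t is 1 modulo m, raising to the power p^(k t) fixes \<open>zt m\<close>, hence
  fixes c modulo p. The exponent is displayed as a multiple of p^k so that c^(p^k), which will be
  divisible by p, splits off.\<close>

lemma frobenius_power_fixes:
  assumes "c \<in> cyc_ring m"
  shows "\<exists>s>0. \<exists>w\<in>cyc_ring m. c ^ ((p ^ k) * s) = c + of_nat p * w"
proof -
  obtain f where f: "c = ev f (zt m)" using assms by (rule cyc_ringE)
  obtain t where t: "t > 0" "[p ^ t = 1] (mod m)" using ex_power_cong_1[OF prime_power_facts(8) m(1)] by blast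
  obtain h where h: "ev f (zt m) ^ (p ^ (k * t)) = ev f (zt m ^ (p ^ (k * t))) + of_nat p * ev h (zt m)"
    using ev_frobenius_power[OF p] by blast
  have "[(p ^ t) ^ k = 1 ^ k] (mod m)" using t(2) by (rule cong_pow)
  moreover have "(p ^ t) ^ k = p ^ (k * t)" by (metis mult.commute power_mult)
  ultimately have "[p ^ (k * t) = 1] (mod m)" by simp
  then have "zt m ^ (p ^ (k * t)) = zt m ^ 1" using zt_pow_cong[OF m(1)] by blast
  then have "c ^ (p ^ (k * t)) = c + of_nat p * ev h (zt m)" using h f by simp
  moreover have "p ^ (k * t) = p ^ k * p ^ (k * t - k)" using t(1) by (simp flip: power_add)
  ultimately show ?thesis using prime_power_facts
    by (intro exI[of _ "p ^ (k * t - k)"] conjI bexI[of _ "ev h (zt m)"]) (auto intro: cyc_ringI)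
qed

text \<open>
  Modulo \<open>\<pi> = 1 - \<zeta>(p^k)\<close> the element \<open>\<pi>\<beta>\<close> is congruent to some \<open>c \<in> \<int>[\<zeta>(m)]\<close>. Then \<open>\<pi>\<close> divides \<open>c\<close>, so
  \<open>p\<close> divides a power of \<open>c\<close>, hence \<open>c\<close> itself since Frobenius has finite order on \<open>\<int>[\<zeta>(m)]/p\<close>. As \<open>c/p\<close> lies at
  level \<open>m\<close>, its denominator divides \<open>m\<close>, so it is integral and \<open>\<pi>\<close> divides \<open>c\<close> in \<open>\<int>[\<zeta>]\<close>.
\<close>

lemma one_minus_zt_saturated:
  assumes \<beta>: "\<beta> \<in> almost_int (p ^ k * m)" "(1 - zt (p ^ k)) * \<beta> \<in> cyc_ring (p ^ k * m)"
  shows "\<beta> \<in> cyc_ring (p ^ k * m)"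
proof -
  let ?N = "p ^ k * m"
  note sub = cyc_ring_mono[OF prime_power_facts(4,6), THEN subsetD]
  obtain c w where c: "c \<in> cyc_ring m" "w \<in> cyc_ring ?N" "(1 - zt (p ^ k)) * \<beta> = c + (1 - zt (p ^ k)) * w"
    using cyc_ring_mod_one_minus_zt[OF prime_power_facts(7,2) m(1) \<beta>(2)] by blast
  obtain s w2 where s: "s > 0" "w2 \<in> cyc_ring m" "c ^ ((p ^ k) * s) = c + of_nat p * w2"
    using frobenius_power_fixes[OF c(1)] by blast
  obtain w1 where w1: "w1 \<in> cyc_ring ?N" "(1 - zt (p ^ k)) ^ (p ^ k) = of_nat p * w1" using one_minus_zt_power_multiple_of_prime by blast
  \<comment> \<open>This is c / p, obtained by dividing c^(p^k s) - p w2 = c by p; in this shape it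
    is visibly almost integral.\<close>
  define x where "x = w1 * (\<beta> - w) ^ (p ^ k) * c ^ ((p ^ k) * (s - 1)) - w2"
  have cx: "c = of_nat p * x"
  proof -
    have "c = (1 - zt (p ^ k)) * (\<beta> - w)" using c(3) by (simp add: right_diff_distrib)
    then have cq: "c ^ (p ^ k) = of_nat p * w1 * (\<beta> - w) ^ (p ^ k)" by (simp only: power_mult_distrib w1(2))
    have "p ^ k * s = (p ^ k) + (p ^ k) * (s - 1)" using s(1) by (cases s) auto
    then have "c ^ ((p ^ k) * s) = c ^ (p ^ k) * c ^ ((p ^ k) * (s - 1))" by (simp only: power_add)
    then have "c + of_nat p * w2 = of_nat p * w1 * (\<beta> - w) ^ (p ^ k) * c ^ ((p ^ k) * (s - 1))" using s(3) cq by (simp only:)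
    then show ?thesis by (simp add: x_def algebra_simps)
  qed
  have xai: "x \<in> almost_int ?N"
    unfolding x_def using w1 \<beta>(1) c(1,2) s(2)
    by (intro almost_int_diff almost_int_mult almost_int_power) (auto intro: cyc_ring_imp_almost_int sub)
  have "of_int (int p) * x \<in> cyc_ring m" using c(1) cx by simp
  then have xf: "x \<in> cyc_frac m" by (rule cyc_fracI[rotated]) (use prime_power_facts in auto)
  have "of_nat m * x \<in> cyc_ring m"
  proof (rule trace_denominator[OF m(1) prime_power_facts(4,6) xf])
    fix b assume b: "coprime b m"
    obtain a where a: "coprime a ?N" "[a = b] (mod m)"
      using ex_coprime_lift[OF prime_power_facts(7,2) b, of 1] by auto
    have "sig ?N a x \<in> almost_int ?N" by (rule almost_int_sig[OF prime_power_facts(4) a(1) xai])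
    then show "sig m b x \<in> almost_int ?N"
      using sig_lift[OF m(1) b prime_power_facts(4,6) a xf] by simp
  qed
  moreover obtain r t where rt: "r * int p + t * int m = 1"
    using bezout_int[of "int p" "int m"] prime_power_facts(8) by (metis coprime_imp_gcd_eq_1 coprime_int_iff)
  \<comment> \<open>Both p x = c and m x lie in Z[zeta(m)], and p and m are coprime.\<close>
  have "x = of_int (r * int p + t * int m) * x" using rt by simp
  then have "x = of_int r * c + of_int t * (of_nat m * x)" unfolding cx by (simp add: algebra_simps)
  ultimately have xr: "x \<in> cyc_ring m" using c(1) by (metis cyc_ring_add cyc_ring_mult cyc_ring_of_int)
  obtain w3 where w3: "w3 \<in> cyc_ring ?N" "of_nat p = (1 - zt (p ^ k)) * w3" using prime_multiple_of_one_minus_zt by blast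
  have "(1 - zt (p ^ k)) * \<beta> = (1 - zt (p ^ k)) * (w3 * x + w)" using c(3) cx w3(2) by (simp add: algebra_simps)
  then have "\<beta> = w3 * x + w" using one_minus_zt_nonzero by simp
  then show ?thesis using w3(1) c(2) sub[OF xr] by (auto intro!: cyc_ring_add cyc_ring_mult)
qed

text \<open>A power of 1 - \<open>zt (p ^ k)\<close> is a multiple of p, so it carries \<beta> into
  the ring as well; its factors are then removed one at a time.\<close>

lemma prime_saturated:
  assumes \<beta>: "\<beta> \<in> almost_int (p ^ k * m)" "of_nat p * \<beta> \<in> cyc_ring (p ^ k * m)"
  shows "\<beta> \<in> cyc_ring (p ^ k * m)"
proof -
  have desc: "(1 - zt (p ^ k)) ^ n * \<beta> \<in> cyc_ring (p ^ k * m) \<Longrightarrow> \<beta> \<in> cyc_ring (p ^ k * m)" for n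
  proof (induction n)
    case (Suc n)
    have "(1 - zt (p ^ k)) * ((1 - zt (p ^ k)) ^ n * \<beta>) \<in> cyc_ring (p ^ k * m)" using Suc.prems by (simp add: mult.assoc)
    moreover have "(1 - zt (p ^ k)) ^ n * \<beta> \<in> almost_int (p ^ k * m)"
      using \<beta> one_minus_zt_in_ring by (intro almost_int_mult almost_int_power) (auto intro: cyc_ring_imp_almost_int)
    ultimately show ?case using one_minus_zt_saturated Suc.IH by blast
  qed simp
  obtain w1 where w1: "w1 \<in> cyc_ring (p ^ k * m)" "(1 - zt (p ^ k)) ^ (p ^ k) = of_nat p * w1" using one_minus_zt_power_multiple_of_prime by blast
  have "(1 - zt (p ^ k)) ^ (p ^ k) * \<beta> = w1 * (of_nat p * \<beta>)" by (simp add: w1(2))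
  then have "(1 - zt (p ^ k)) ^ (p ^ k) * \<beta> \<in> cyc_ring (p ^ k * m)" using \<beta> w1 by (simp only: cyc_ring_mult)
  then show ?thesis by (rule desc)
qed

end

lemma prime_power_decompose:
  assumes "prime (p::nat)" "p dvd N" "N > 0"
  shows "\<exists>k m. N = p ^ k * m \<and> k > 0 \<and> m > 0 \<and> \<not> p dvd m"
proof -
  have "\<not> is_unit p" using assms(1) not_prime_unit by blast
  then obtain m where m: "N = p ^ multiplicity p N * m" "\<not> p dvd m"
    using multiplicity_decompose'[of N p] assms(3) by auto
  moreover have "multiplicity p N > 0"
    using assms m by (metis gr0I mult_1 power_0)
  ultimately show ?thesis using assms(3) by (metis gr0I mult_0_right)
qed

text \<open>The trace expansion puts N x into Z[zeta]. The prime factors of the multiplier N are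
  then removed one by one; \<open>red\<close> remembers that each of them divides the level, as
  saturation is available at exactly those primes.\<close>

theorem almost_int_eq_cyc_ring:
  assumes N: "N > 0"
  shows "almost_int N = cyc_ring N"
proof (intro equalityI subsetI)
  fix x assume x: "x \<in> almost_int N"
  have red: "y \<in> cyc_ring N" if "\<And>p. prime p \<Longrightarrow> p dvd M \<Longrightarrow> p dvd N" "y \<in> almost_int N" "of_nat M * y \<in> cyc_ring N" "M > 0"
    for M :: nat and y
    using that
  proof (induction M arbitrary: y rule: prime_divisors_induct)
    case (factor p M)
    have p: "prime p" "p dvd N" using factor by auto
    obtain k m where km: "N = p ^ k * m" "k > 0" "m > 0" "\<not> p dvd m"
      using prime_power_decompose[OF p N] by blast
    have "of_nat p * (of_nat M * y) \<in> cyc_ring N" using factor.prems by (simp add: mult.assoc)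
    moreover have "of_nat M * y \<in> almost_int N"
      using factor.prems by (intro almost_int_mult) (auto intro: cyc_ring_imp_almost_int)
    ultimately have "of_nat M * y \<in> cyc_ring N"
      using prime_saturated[OF p(1) km(2-4), of "of_nat M * y"] unfolding km(1) by blast
    then show ?case using factor.IH[of y] factor.prems by auto
  qed auto
  have "of_nat N * x \<in> cyc_ring N"
    by (rule trace_denominator[OF N N dvd_refl almost_int_imp_frac[OF x]]) (use almost_int_sig N x in blast)
  then show "x \<in> cyc_ring N" using red[of N x] x N by auto
qed (rule cyc_ring_imp_almost_int)

section \<open>From algebraic integers in the cyclotomic field to Z[zeta]\<close>

lemma cyc_frac_inverse:
  assumes N: "N > 0" and x: "x \<in> cyc_frac N"
  shows "inverse x \<in> cyc_frac N"
proof (cases "x = 0")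
  case False
  have nz: "sig N a x \<noteq> 0" if "coprime a N" for a
    using sig_inj[OF N that, of x 0] x N that False by (auto simp: sig_0)
  define P where "P = (\<Prod>a\<in>units_mod N. sig N a x)"
  have sf: "\<And>a. a \<in> units_mod N \<Longrightarrow> sig N a x \<in> cyc_frac N"
    using N x by (auto simp: units_mod_def intro: sig_in_frac)
  have "P \<in> \<rat>"
  proof (rule cyc_frac_fixed_imp_Rats[OF N])
    show "P \<in> cyc_frac N" unfolding P_def by (rule cyc_frac_prod) (rule sf)
    fix b assume b: "coprime b N"
    have "sig N b P = (\<Prod>a\<in>units_mod N. sig N b (sig N a x))"
      unfolding P_def by (rule sig_prod[OF N b]) (rule sf)
    also have "\<dots> = (\<Prod>a\<in>units_mod N. sig N (a * b mod N) x)"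
      by (rule prod.cong) (use N b x in \<open>auto simp: units_mod_def sig_sig sig_mod\<close>)
    also have "\<dots> = P" unfolding P_def
      by (rule prod_units_mod_mult[OF N b])
    finally show "sig N b P = P" .
  qed
  then have "inverse P \<in> \<rat>" by simp
  then obtain c where c: "inverse P = of_rat c" by (rule Rats_cases)
  \<comment> \<open>The inverse is the product of the other conjugates divided by the rational norm
    P.\<close>
  have "P = sig N (1 mod N) x * (\<Prod>a\<in>units_mod N - {1 mod N}. sig N a x)"
    unfolding P_def by (rule prod.remove) (use one_mod_in_units_mod[OF N] in auto)
  also have "sig N (1 mod N) x = x" by (simp only: sig_mod[OF N] sig_one[OF N x])
  finally have P: "P = x * (\<Prod>a\<in>units_mod N - {1 mod N}. sig N a x)" .
  have "P \<noteq> 0" unfolding P_def using nz by (auto simp: units_mod_def prod_zero_iff)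
  then have "inverse x = of_rat c * (\<Prod>a\<in>units_mod N - {1 mod N}. sig N a x)"
    using P False unfolding c[symmetric] by (simp add: field_simps)
  then show ?thesis using sf by (auto intro!: cyc_frac_mult(1) cyc_frac_prod)
qed simp

lemma cyclotomic_field_subset: 
  assumes "N > 0" shows "cyclotomic_field N \<subseteq> cyc_frac N"
proof -
  have "complex_subfield (cyc_frac N)"
    unfolding complex_subfield_def using cyc_frac_inverse[OF assms] cyc_frac_diff cyc_frac_mult(1) by auto
  moreover have "cis (2 * pi / real N) \<in> cyc_frac N"
    using cyc_ring_imp_frac[OF cyc_ring_zt[of N]] by (simp add: zt_def)
  ultimately show ?thesis unfolding cyclotomic_field_def by blast
qed

text \<open>A monic equation of degree n reduces every power of x to an integer combination of
  powers below n, so one denominator \<open>e ^ n\<close> serves for all of them.\<close>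

lemma algebraic_int_imp_almost_int:
  assumes x: "x \<in> cyc_frac N" "algebraic_int x"
  shows "x \<in> almost_int N"
proof -
  obtain f where f: "ev f x = 0" "lead_coeff f = 1"
    using x(2) by (auto simp: algebraic_int_altdef_ipoly ev_def)
  obtain e where e: "e \<noteq> 0" "of_int e * x \<in> cyc_ring N" using x(1) by (auto simp: cyc_frac_def)
  define n where "n = degree f"
  have small: "of_int (e ^ n) * x ^ i \<in> cyc_ring N" if "i \<le> n" for i
  proof -
    have "of_int (e ^ n) * x ^ i = of_int (e ^ (n - i)) * (of_int e * x) ^ i"
      using that by (simp add: power_mult_distrib flip: power_add mult.assoc)
    then show ?thesis by (simp only:) (intro cyc_ring_mult cyc_ring_power e cyc_ring_of_int)
  qed
  have "of_int (e ^ n) * x ^ i \<in> cyc_ring N" for i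
  proof -
    obtain r where r: "degree r < n" "ev (monom 1 i) x = ev r x"
      using ev_monic_reduce[OF f(2,1)] unfolding n_def by blast
    have "of_int (e ^ n) * x ^ i = of_int (e ^ n) * ev r x" using r by simp
    also have "\<dots> = (\<Sum>j\<le>degree r. of_int (coeff r j) * (of_int (e ^ n) * x ^ j))"
      unfolding ev_def poly_altdef sum_distrib_left by (rule sum.cong) (auto simp: coeff_map_poly degree_map_poly)
    also have "\<dots> \<in> cyc_ring N"
      by (intro cyc_ring_sum cyc_ring_mult[OF cyc_ring_of_int] small) (use r in auto)
    finally show ?thesis .
  qed
  then show ?thesis using e(1) unfolding almost_int_def by (intro CollectI exI[of _ "e ^ n"]) auto
qed

theorem cyclotomic_integer_imp_cyc_ring:
  assumes "cyclotomic_integer \<beta>"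
  shows "\<exists>N>0. \<beta> \<in> cyc_ring N"
proof -
  obtain N where N: "N \<ge> 1" "\<beta> \<in> cyclotomic_field N" "algebraic_int \<beta>"
    using assms unfolding cyclotomic_integer_def by blast
  then have "\<beta> \<in> cyc_frac N" using cyclotomic_field_subset[of N] by auto
  then have "\<beta> \<in> cyc_ring N"
    using algebraic_int_imp_almost_int N almost_int_eq_cyc_ring[of N] by auto
  then show ?thesis using N by (intro exI[of _ N]) auto
qed

section \<open>Orthogonal decompositions\<close>

lemma zt_neq_1: "p > 1 \<Longrightarrow> \<not> p dvd k \<Longrightarrow> zt p ^ k \<noteq> 1"
  by (subst zt_pow_eq_1) auto

text \<open>The residues 1 + n t fix level n and, since p divides n, are prime to p n. They multiply
  the element by the powers of the nontrivial p-th root \<open>zt p ^ k\<close> without changing its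
  mean, and these powers add up to 0.\<close>

lemma mean_conj_ramified:
  assumes p: "prime (p::nat)" "p dvd n" "n > 0" and k: "\<not> p dvd k" and y: "y \<in> cyc_ring n"
  shows "mean_conj (zt (p * n) ^ k * y) = 0"
proof -
  define N where "N = p * n"
  have p1: "p > 1" by (rule prime_gt_1_nat[OF p(1)])
  have N: "N > 0" "n dvd N" using p p1 by (auto simp: N_def)
  obtain f where f: "y = ev f (zt n)" using y by (rule cyc_ringE)
  have yN: "y \<in> cyc_ring N" using cyc_ring_mono[OF N] y by blast
  let ?w = "zt p ^ k"
  have wN: "?w \<in> cyc_ring N" using cyc_ring_mono[of N p] N by (intro cyc_ring_power) (auto simp: N_def)
  have eq: "mean_conj (?w ^ t * (zt N ^ k * y)) = mean_conj (zt N ^ k * y)" for t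
  proof -
    define a where "a = 1 + n * t"
    have "[1 = a] (mod n)" unfolding a_def cong_def by (simp only: mod_mult_self2)
    then have "coprime a n" by (rule cong_imp_coprime) simp
    moreover from this have "coprime a p" using p(2) coprime_divisors[of a a p n] by simp
    ultimately have a: "coprime a N" by (simp add: N_def)
    have "sig N a (zt N ^ k * y) = sig N a (zt N ^ k) * sig N a y"
      using yN by (intro sig_mult[OF N(1) a] cyc_ring_imp_frac cyc_ring_power) auto
    also have "sig N a y = ev f (zt n ^ a)" unfolding f by (rule sig_sub[OF N(1) a N(2)])
    also have "zt n ^ a = zt n" using p(3) by (simp add: a_def power_mult)
    also have "ev f (zt n) = y" by (simp add: f)
    also have "sig N a (zt N ^ k) = zt N ^ (k * a)" by (rule sig_zt_pow[OF N(1) a])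
    also have "\<dots> = zt N ^ k * (zt N ^ n) ^ (k * t)"
      by (simp add: a_def algebra_simps power_add flip: power_mult)
    also have "zt N ^ n = zt p" unfolding N_def using zt_mult[of p n] p p1 by (simp add: mult.commute)
    finally have s: "sig N a (zt N ^ k * y) = ?w ^ t * (zt N ^ k * y)" by (simp add: power_mult)
    show ?thesis unfolding s[symmetric]
      using yN by (intro mean_conj_sig[OF N(1) a] cyc_ring_mult cyc_ring_power) auto
  qed
  have "?w ^ p = 1" using p1 by (metis mult.commute power_mult power_one zt_pow_N gr_implies_not0 gr0I)
  then have "(\<Sum>t<p. ?w ^ t) = 0" using sum_root_unity_powers[of ?w p] zt_neq_1[OF p1 k] by simp
  then have "0 = mean_conj ((\<Sum>t<p. ?w ^ t) * (zt N ^ k * y))" by simp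
  also have "\<dots> = (\<Sum>t<p. mean_conj (?w ^ t * (zt N ^ k * y)))"
    unfolding sum_distrib_right
    by (intro mean_conj_sum[OF N(1)] cyc_ring_mult cyc_ring_power[OF wN] cyc_ring_power[OF cyc_ring_zt] yN)
  also have "\<dots> = of_nat p * mean_conj (zt N ^ k * y)" unfolding eq by simp
  finally show ?thesis using p1 unfolding N_def by simp
qed

text \<open>The automorphisms fixing level n permute the p - 1 nontrivial p-th roots of unity
  transitively, so the means of their products with y agree; together with the mean of y they add up
  to 0.\<close>

lemma mean_conj_unramified:
  assumes p: "prime (p::nat)" "\<not> p dvd n" "n > 0" and z: "z ^ p = 1" "z \<noteq> 1" and y: "y \<in> cyc_ring n"
  shows "mean_conj (z * y) = - mean_conj y / (of_nat p - 1)"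
proof -
  define N where "N = p * n"
  have p1: "p > 1" by (rule prime_gt_1_nat[OF p(1)])
  have co: "coprime p n" using p prime_imp_coprime by blast
  have N: "N > 0" "n dvd N" "p dvd N" using p p1 by (auto simp: N_def)
  obtain f where f: "y = ev f (zt n)" using y by (rule cyc_ringE)
  have yN: "y \<in> cyc_ring N" using cyc_ring_mono[OF N(1,2)] y by blast
  have zp: "zt p \<in> cyc_ring N" using cyc_ring_mono[OF N(1,3)] by auto
  have eq: "mean_conj (zt p ^ k * y) = mean_conj (zt p * y)" if k: "k \<in> {0<..<p}" for k
  proof -
    have "coprime k p" using k p(1) by (metis coprime_commute greaterThanLessThan_iff nat_dvd_not_less prime_imp_coprime)
    then obtain a where a: "coprime a N" "[a = 1] (mod n)" "[a = k] (mod p)"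
      using ex_coprime_lift[OF co _ coprime_1_left, of k] p1 unfolding N_def by auto
    have "sig N a (zt p * y) = sig N a (zt p) * sig N a y"
      using yN zp by (intro sig_mult[OF N(1) a(1)] cyc_ring_imp_frac)
    also have "sig N a y = ev f (zt n ^ a)" unfolding f by (rule sig_sub[OF N(1) a(1) N(2)])
    also have "zt n ^ a = zt n ^ 1" using zt_pow_cong[OF p(3)] a(2) by blast
    also have "ev f (zt n ^ 1) = y" by (simp add: f)
    also have "sig N a (zt p) = zt p ^ a" using sig_sub[OF N(1) a(1) N(3), of "[:0, 1:]"] by simp
    also have "zt p ^ a = zt p ^ k" using zt_pow_cong[of p a k] p1 a(3) by simp
    finally have s: "sig N a (zt p * y) = zt p ^ k * y" .
    show ?thesis unfolding s[symmetric]
      using yN zp by (intro mean_conj_sig[OF N(1) a(1)] cyc_ring_mult)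
  qed
  have "zt p \<noteq> 1" using zt_neq_1[OF p1, of 1] p1 by simp
  then have "(\<Sum>k<p. zt p ^ k) = 0" using sum_root_unity_powers[of "zt p" p] p1 by simp
  then have "0 = mean_conj ((\<Sum>k<p. zt p ^ k) * y)" by simp
  also have "\<dots> = (\<Sum>k<p. mean_conj (zt p ^ k * y))"
    unfolding sum_distrib_right using zp yN
    by (intro mean_conj_sum[OF N(1)] cyc_ring_mult cyc_ring_power) auto
  also have "{..<p} = insert 0 {0<..<p}" using p1 by auto
  also have "(\<Sum>k\<in>insert 0 {0<..<p}. mean_conj (zt p ^ k * y)) = mean_conj y + (\<Sum>k\<in>{0<..<p}. mean_conj (zt p ^ k * y))"
    by simp
  also have "(\<Sum>k\<in>{0<..<p}. mean_conj (zt p ^ k * y)) = (\<Sum>k\<in>{0<..<p}. mean_conj (zt p * y))"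
    by (rule sum.cong) (auto intro: eq)
  also have "\<dots> = (of_nat p - 1) * mean_conj (zt p * y)" using p1 by (simp add: of_nat_diff)
  finally have sum0: "mean_conj y + (of_nat p - 1) * mean_conj (zt p * y) = 0" by simp
  have "(of_nat p - 1 :: complex) \<noteq> 0" using p1 by simp
  moreover have "mean_conj y = - ((of_nat p - 1) * mean_conj (zt p * y))"
    using sum0 by (simp only: eq_neg_iff_add_eq_0)
  ultimately have e1: "mean_conj (zt p * y) = - mean_conj y / (of_nat p - 1)" by simp
  obtain k where k: "k < p" "z = zt p ^ k" using root_unity_eq_zt_pow[of p z] p1 z by auto
  then have "k \<in> {0<..<p}" using z by (auto intro!: gr0I)
  then show ?thesis using eq[of k] k e1 by simp
qed

lemma cyc_ring_powers_decompose:
  assumes p: "p > 0" and n: "n > 0" and x: "x \<in> cyc_ring (p * n)"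
  shows "\<exists>\<alpha>. (\<forall>i. \<alpha> i \<in> cyc_ring n) \<and> x = (\<Sum>i<p. zt (p * n) ^ i * \<alpha> i)"
proof -
  obtain f where f: "x = ev f (zt (p * n))" using x by (rule cyc_ringE)
  obtain r where r: "p = Suc r" using p by (cases p) auto
  have zn: "zt (p * n) ^ p = zt n" by (rule zt_mult[OF n p])
  have "\<exists>\<alpha>. (\<forall>i. \<alpha> i \<in> cyc_ring n) \<and> ev f (zt (p * n)) = (\<Sum>i<p. zt (p * n) ^ i * \<alpha> i)"
  proof (induction f)
    case 0
    show ?case by (rule exI[of _ "\<lambda>_. 0"]) simp
  next
    case (pCons c f)
    then obtain \<alpha> where \<alpha>: "\<And>i. \<alpha> i \<in> cyc_ring n" "ev f (zt (p * n)) = (\<Sum>i<p. zt (p * n) ^ i * \<alpha> i)" by blast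
    \<comment> \<open>Multiplication by \<open>zt (p * n)\<close> shifts the components by one; the
      last wraps round with the factor \<open>zt (p * n) ^ p\<close>, which is
      \<open>zt n\<close>.\<close>
    define \<gamma> where "\<gamma> i = (case i of 0 \<Rightarrow> of_int c + zt n * \<alpha> r | Suc j \<Rightarrow> \<alpha> j)" for i
    have "zt (p * n) * (\<Sum>i<p. zt (p * n) ^ i * \<alpha> i) = (\<Sum>i<r. zt (p * n) ^ Suc i * \<alpha> i) + zt (p * n) ^ p * \<alpha> r"
      unfolding sum_distrib_left by (simp add: r mult.assoc)
    also have "(\<Sum>i<r. zt (p * n) ^ Suc i * \<alpha> i) = (\<Sum>i<p. zt (p * n) ^ i * \<gamma> i) - \<gamma> 0"
      unfolding r sum.lessThan_Suc_shift by (simp add: \<gamma>_def)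
    finally have "ev (pCons c f) (zt (p * n)) = (\<Sum>i<p. zt (p * n) ^ i * \<gamma> i)"
      unfolding ev_pCons \<alpha>(2) zn by (simp add: \<gamma>_def)
    moreover have "\<gamma> i \<in> cyc_ring n" for i
      using \<alpha>(1) by (auto simp: \<gamma>_def split: nat.split intro!: cyc_ring_add cyc_ring_mult)
    ultimately show ?case by blast
  qed
  then show ?thesis unfolding f .
qed

lemma root_unity_cnj:
  assumes "N > 0" "(w::complex) ^ N = 1" shows "w * cnj w = 1"
proof -
  have "cmod w ^ N = 1" using assms(2) by (metis norm_one norm_power)
  then have "cmod w = 1" using assms(1) power_eq_imp_eq_base[of "cmod w" N 1] by simp
  then show ?thesis by (simp flip: complex_norm_square)
qed

text \<open>The constant \<delta> is the mean of \<omega>^i \<open>cnj\<close> (\<omega>^j) off the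
  diagonal. When p divides n, \<omega> is \<open>zt (p * n)\<close>. Otherwise it must be a p-th
  root of unity, to which the unramified formula applies and whose powers add up to 0; this relation
  will permit shifting all components by a common element.\<close>

lemma cyc_ring_orthogonal_decompose:
  assumes p: "prime (p::nat)" and n: "n > 0" and x: "x \<in> cyc_ring (p * n)"
  defines "\<delta> \<equiv> (if p dvd n then 0 else - 1 / (of_nat p - 1) :: complex)"
  shows "\<exists>\<omega> \<alpha>. \<omega> ^ (p * n) = 1 \<and> (\<forall>i. \<alpha> i \<in> cyc_ring n) \<and> x = (\<Sum>i<p. \<omega> ^ i * \<alpha> i) \<and>
    (\<forall>i<p. \<forall>j<p. \<forall>y\<in>cyc_ring n. i \<noteq> j \<longrightarrow> mean_conj (\<omega> ^ i * cnj (\<omega> ^ j) * y) = \<delta> * mean_conj y) \<and>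
    (\<not> p dvd n \<longrightarrow> (\<Sum>i<p. \<omega> ^ i) = 0)"
proof -
  define N where "N = p * n"
  have p1: "p > 1" by (rule prime_gt_1_nat[OF p])
  have N: "N > 0" using p1 n by (simp add: N_def)
  obtain \<alpha> where \<alpha>: "\<And>i. \<alpha> i \<in> cyc_ring n" "x = (\<Sum>i<p. zt N ^ i * \<alpha> i)"
    using cyc_ring_powers_decompose[OF _ n x] p1 unfolding N_def by auto
  show ?thesis
  proof (cases "p dvd n")
    case True
    have orth: "mean_conj (zt N ^ i * cnj (zt N ^ j) * y) = \<delta> * mean_conj y"
      if "i < p" "j < p" "y \<in> cyc_ring n" "i \<noteq> j" for i j y
    proof -
      have e: "zt N ^ i * cnj (zt N ^ j) = zt N ^ (i + (N - 1) * j)"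
        by (simp add: cnj_zt[OF N] power_add power_mult)
      \<comment> \<open>Since p divides N, this exponent is i - j modulo p.\<close>
      have "\<not> p dvd i + (N - 1) * j"
      proof
        assume "p dvd i + (N - 1) * j"
        then have h1: "[i + (N - 1) * j + j = 0 + j] (mod p)" by (intro cong_add) (auto simp: cong_0_iff)
        have "(N - 1) * j + j = N * j" using N by (cases N) auto
        then have h2: "i + (N - 1) * j + j = i + p * (n * j)" by (simp add: N_def mult.assoc)
        have "[i = j] (mod p)" using h1 unfolding h2 by (simp add: cong_def)
        then show False using that by (simp add: cong_def)
      qed
      then show ?thesis unfolding e unfolding N_def
        using mean_conj_ramified[OF p True n _ that(3)] True by (simp add: \<delta>_def)
    qed
    show ?thesis
      by (rule exI[of _ "zt N"], rule exI[of _ \<alpha>]) (use \<alpha> orth True N in \<open>simp add: N_def[symmetric]\<close>)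
  next
    case False
    then have co: "coprime p n" using p prime_imp_coprime by blast
    obtain u v where uv: "zt N = zt p ^ u * zt n ^ v" "[u * n = 1] (mod p)"
      using zt_coprime_decompose[OF co] p1 n unfolding N_def by auto
    have u: "coprime u p"
      using uv(2) by (metis cong_imp_coprime cong_sym coprime_1_left coprime_mult_left_iff)
    define \<omega> where "\<omega> = zt p ^ u"
    \<comment> \<open>The part of \<open>zt N ^ i\<close> lying at level n is absorbed into the
      component.\<close>
    define \<gamma> where "\<gamma> i = zt n ^ (v * i) * \<alpha> i" for i
    have \<omega>p: "\<omega> ^ p = 1" unfolding \<omega>_def using p1
      by (metis mult.commute power_mult power_one zt_pow_N gr_implies_not0 gr0I)
    have "\<not> p dvd u" using u p1 by (metis coprime_absorb_right nat_dvd_1_iff_1 nat_neq_iff)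
    then have "\<omega> \<noteq> 1" unfolding \<omega>_def by (rule zt_neq_1[OF p1])
    have "(\<Sum>i<p. \<omega> ^ i) = 0" using sum_root_unity_powers[OF \<omega>p] \<open>\<omega> \<noteq> 1\<close> by simp
    moreover have "x = (\<Sum>i<p. \<omega> ^ i * \<gamma> i)"
      unfolding \<alpha>(2) uv(1) \<gamma>_def \<omega>_def by (simp add: power_mult_distrib mult.assoc flip: power_mult)
    moreover have "\<forall>i. \<gamma> i \<in> cyc_ring n"
      unfolding \<gamma>_def using \<alpha>(1) by (auto intro!: cyc_ring_mult cyc_ring_power)
    moreover have "\<omega> ^ (p * n) = 1" by (simp add: power_mult \<omega>p)
    moreover have "mean_conj (\<omega> ^ i * cnj (\<omega> ^ j) * y) = \<delta> * mean_conj y"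
      if "i < p" "j < p" "y \<in> cyc_ring n" "i \<noteq> j" for i j y
    proof -
      let ?z = "\<omega> ^ i * cnj (\<omega> ^ j)"
      have "?z ^ p = (\<omega> ^ p) ^ i * cnj ((\<omega> ^ p) ^ j)"
        by (simp add: power_mult_distrib mult.commute flip: power_mult)
      then have "?z ^ p = 1" unfolding \<omega>p by simp
      moreover have "?z \<noteq> 1"
      proof
        assume "?z = 1"
        have "(\<omega> ^ j) ^ p = 1" by (metis \<omega>p mult.commute power_mult power_one)
        then have "\<omega> ^ j * cnj (\<omega> ^ j) = 1" using p1 by (intro root_unity_cnj[of p]) auto
        then have "\<omega> ^ i * cnj (\<omega> ^ j) = \<omega> ^ j * cnj (\<omega> ^ j)" using \<open>?z = 1\<close> by simp
        moreover have "cnj (\<omega> ^ j) \<noteq> 0" unfolding \<omega>_def by simp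
        ultimately have "zt p ^ (u * i) = zt p ^ (u * j)" unfolding \<omega>_def by (simp add: power_mult)
        then have "[u * i = u * j] (mod p)" using zt_pow_cong[of p] p1 by simp
        then have "[i = j] (mod p)" using u by (simp add: cong_mult_lcancel_nat)
        then show False using that by (simp add: cong_def)
      qed
      ultimately show ?thesis
        using mean_conj_unramified[OF p False n _ _ that(3), of ?z] False by (simp add: \<delta>_def)
    qed
    ultimately show ?thesis by blast
  qed
qed

section \<open>The mean square in terms of the components\<close>

lemma mean_sq_conj_cong:
  assumes "N > 0" "x \<in> cyc_ring N" "y \<in> cyc_ring N" "x * cnj x = y * cnj y"
  shows "mean_sq_conj x = mean_sq_conj y"
  using mean_conj_norm_sq[OF assms(1,2)] mean_conj_norm_sq[OF assms(1,3)] assms(4) by simp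

lemma mean_sq_conj_minus:
  assumes "N > 0" "x \<in> cyc_ring N" shows "mean_sq_conj (- x) = mean_sq_conj x"
  by (rule mean_sq_conj_cong[OF assms(1) _ assms(2)]) (simp_all add: assms cyc_ring_minus)

lemma mean_sq_conj_root_mult:
  assumes "N > 0" "x \<in> cyc_ring N" "w ^ N = 1" shows "mean_sq_conj (w * x) = mean_sq_conj x"
proof (rule mean_sq_conj_cong[OF assms(1) _ assms(2)])
  show "w * x \<in> cyc_ring N" using assms by (blast intro: cyc_ring_mult cyc_ring_root_unity)
  have "w * x * cnj (w * x) = (w * cnj w) * (x * cnj x)" by simp
  then show "w * x * cnj (w * x) = x * cnj x" unfolding root_unity_cnj[OF assms(1,3)] by simp
qed

text \<open>In the double sum for x \<open>cnj\<close> x the off-diagonal terms acquire the factor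
  \<delta> and the diagonal ones the factor 1, which is split as \<delta> + (1 - \<delta>) to
  complete the first sum.\<close>

lemma mean_sq_conj_expand:
  assumes p: "prime (p::nat)" and n: "n > 0" and \<omega>: "\<omega> ^ (p * n) = 1" 
    and \<alpha>: "\<And>i. \<alpha> i \<in> cyc_ring n" and x: "x = (\<Sum>i<p. \<omega> ^ i * \<alpha> i)"
    and orth: "\<And>i j y. i < p \<Longrightarrow> j < p \<Longrightarrow> y \<in> cyc_ring n \<Longrightarrow> i \<noteq> j \<Longrightarrow>
      mean_conj (\<omega> ^ i * cnj (\<omega> ^ j) * y) = \<delta> * mean_conj y"
  shows "of_real (mean_sq_conj x) = \<delta> * (\<Sum>i<p. \<Sum>j<p. mean_conj (\<alpha> i * cnj (\<alpha> j))) +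
    (1 - \<delta>) * (\<Sum>i<p. of_real (mean_sq_conj (\<alpha> i)))"
proof -
  define N where "N = p * n"
  have N: "N > 0" "n dvd N" using n prime_gt_0_nat[OF p] by (auto simp: N_def)
  have \<omega>N: "\<omega> \<in> cyc_ring N" by (rule cyc_ring_root_unity[OF N(1)]) (simp add: N_def \<omega>)
  have \<alpha>N: "\<alpha> i \<in> cyc_ring N" for i using cyc_ring_mono[OF N] \<alpha> by blast
  have xN: "x \<in> cyc_ring N" unfolding x by (intro cyc_ring_sum cyc_ring_mult cyc_ring_power \<omega>N \<alpha>N)
  let ?c = "\<lambda>i j. mean_conj (\<alpha> i * cnj (\<alpha> j))"
  have "x * cnj x = (\<Sum>i<p. \<Sum>j<p. \<omega> ^ i * cnj (\<omega> ^ j) * (\<alpha> i * cnj (\<alpha> j)))"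
    unfolding x cnj_sum sum_product by (intro sum.cong refl) (simp add: mult_ac)
  then have "of_real (mean_sq_conj x) = mean_conj (\<Sum>i<p. \<Sum>j<p. \<omega> ^ i * cnj (\<omega> ^ j) * (\<alpha> i * cnj (\<alpha> j)))"
    using mean_conj_norm_sq[OF N(1) xN] by simp
  also have "\<dots> = (\<Sum>i<p. mean_conj (\<Sum>j<p. \<omega> ^ i * cnj (\<omega> ^ j) * (\<alpha> i * cnj (\<alpha> j))))"
    by (intro mean_conj_sum[OF N(1)] cyc_ring_sum cyc_ring_mult cyc_ring_power cyc_ring_cnj[OF N(1)] \<omega>N \<alpha>N)
  also have "\<dots> = (\<Sum>i<p. \<Sum>j<p. mean_conj (\<omega> ^ i * cnj (\<omega> ^ j) * (\<alpha> i * cnj (\<alpha> j))))"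
    by (intro sum.cong refl mean_conj_sum[OF N(1)] cyc_ring_mult cyc_ring_power cyc_ring_cnj[OF N(1)] \<omega>N \<alpha>N)
  also have "\<dots> = (\<Sum>i<p. \<Sum>j<p. \<delta> * ?c i j + (if i = j then (1 - \<delta>) * ?c i i else 0))"
  proof (intro sum.cong refl)
    fix i j assume ij: "i \<in> {..<p}" "j \<in> {..<p}"
    have y: "\<alpha> i * cnj (\<alpha> j) \<in> cyc_ring n" by (intro cyc_ring_mult cyc_ring_cnj[OF n] \<alpha>)
    show "mean_conj (\<omega> ^ i * cnj (\<omega> ^ j) * (\<alpha> i * cnj (\<alpha> j))) = \<delta> * ?c i j + (if i = j then (1 - \<delta>) * ?c i i else 0)"
    proof (cases "i = j")
      case True
      have "(\<omega> ^ i) ^ N = 1" unfolding N_def by (metis \<omega> mult.commute power_mult power_one)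
      then have "\<omega> ^ i * cnj (\<omega> ^ i) = 1" by (rule root_unity_cnj[OF N(1)])
      then show ?thesis unfolding True[symmetric] by (simp add: algebra_simps)
    next
      case False
      then show ?thesis using orth[of i j, OF _ _ y] ij by simp
    qed
  qed
  also have "\<dots> = \<delta> * (\<Sum>i<p. \<Sum>j<p. ?c i j) + (1 - \<delta>) * (\<Sum>i<p. ?c i i)"
    by (simp add: sum.distrib sum_distrib_left)
  also have "(\<Sum>i<p. ?c i i) = (\<Sum>i<p. of_real (mean_sq_conj (\<alpha> i)))"
    by (intro sum.cong refl mean_conj_norm_sq[OF n] \<alpha>)
  finally show ?thesis .
qed

lemma mean_sq_conj_decompose_ramified:
  assumes "prime (p::nat)" "p dvd n" "n > 0" "x \<in> cyc_ring (p * n)"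
  shows "\<exists>\<omega> \<alpha>. \<omega> ^ (p * n) = 1 \<and> (\<forall>i. \<alpha> i \<in> cyc_ring n) \<and> x = (\<Sum>i<p. \<omega> ^ i * \<alpha> i) \<and>
    mean_sq_conj x = (\<Sum>i<p. mean_sq_conj (\<alpha> i))"
proof -
  obtain \<omega> \<alpha> where *: "\<omega> ^ (p * n) = 1" "\<And>i. \<alpha> i \<in> cyc_ring n" "x = (\<Sum>i<p. \<omega> ^ i * \<alpha> i)"
    "\<And>i j y. i < p \<Longrightarrow> j < p \<Longrightarrow> y \<in> cyc_ring n \<Longrightarrow> i \<noteq> j \<Longrightarrow> mean_conj (\<omega> ^ i * cnj (\<omega> ^ j) * y) = 0 * mean_conj y"
    using cyc_ring_orthogonal_decompose[OF assms(1,3,4)] unfolding if_P[OF assms(2)] by blast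
  have "complex_of_real (mean_sq_conj x) = of_real (\<Sum>i<p. mean_sq_conj (\<alpha> i))"
    using mean_sq_conj_expand[OF assms(1,3) *] by simp
  then have "mean_sq_conj x = (\<Sum>i<p. mean_sq_conj (\<alpha> i))" by (simp only: of_real_eq_iff)
  then show ?thesis using * by blast
qed

text \<open>With D the diagonal sum and S the full double sum, multiplying the expansion by p - 1
  gives p D - S, and expanding the squared differences gives 2 (p D - S). Differences do not change
  under a common shift of the components.\<close>

lemma mean_sq_conj_decompose_unramified:
  assumes "prime (p::nat)" "\<not> p dvd n" "n > 0" "x \<in> cyc_ring (p * n)"
  shows "\<exists>\<omega> \<alpha>. \<omega> ^ (p * n) = 1 \<and> (\<forall>i. \<alpha> i \<in> cyc_ring n) \<and> x = (\<Sum>i<p. \<omega> ^ i * \<alpha> i) \<and>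
    (\<Sum>i<p. \<omega> ^ i) = 0 \<and>
    2 * (real p - 1) * mean_sq_conj x = (\<Sum>i<p. \<Sum>j<p. mean_sq_conj (\<alpha> i - \<alpha> j))"
proof -
  define \<delta> :: complex where "\<delta> = - 1 / (of_nat p - 1)"
  obtain \<omega> \<alpha> where *: "\<omega> ^ (p * n) = 1" "\<And>i. \<alpha> i \<in> cyc_ring n" "x = (\<Sum>i<p. \<omega> ^ i * \<alpha> i)"
    "\<And>i j y. i < p \<Longrightarrow> j < p \<Longrightarrow> y \<in> cyc_ring n \<Longrightarrow> i \<noteq> j \<Longrightarrow> mean_conj (\<omega> ^ i * cnj (\<omega> ^ j) * y) = \<delta> * mean_conj y"
    and 0: "(\<Sum>i<p. \<omega> ^ i) = 0"
    using cyc_ring_orthogonal_decompose[OF assms(1,3,4)] assms(2)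
    unfolding if_not_P[OF assms(2)] \<delta>_def by blast
  have p1: "(of_nat p - 1 :: complex) \<noteq> 0" using prime_gt_1_nat[OF assms(1)] by simp
  let ?c = "\<lambda>i j. mean_conj (\<alpha> i * cnj (\<alpha> j))"
  let ?D = "\<Sum>i<p. ?c i i" and ?S = "\<Sum>i<p. \<Sum>j<p. ?c i j"
  have D: "(\<Sum>i<p. of_real (mean_sq_conj (\<alpha> i))) = ?D"
    by (intro sum.cong refl mean_conj_norm_sq[OF assms(3), symmetric] *)
  have d1: "(of_nat p - 1) * \<delta> = -1" "(of_nat p - 1) * (1 - \<delta>) = of_nat p"
    using p1 by (simp_all add: \<delta>_def field_simps)
  have ex: "complex_of_real (mean_sq_conj x) = \<delta> * ?S + (1 - \<delta>) * ?D"
    unfolding D[symmetric] by (rule mean_sq_conj_expand[OF assms(1,3) *])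
  have "complex_of_real (2 * (real p - 1) * mean_sq_conj x) = 2 * ((of_nat p - 1) * of_real (mean_sq_conj x))"
    by (simp add: algebra_simps)
  also have "(of_nat p - 1) * of_real (mean_sq_conj x) = ((of_nat p - 1) * \<delta>) * ?S + ((of_nat p - 1) * (1 - \<delta>)) * ?D"
    unfolding ex by (simp only: distrib_left mult.assoc)
  also have "\<dots> = of_nat p * ?D - ?S" unfolding d1 by simp
  finally have lhs: "complex_of_real (2 * (real p - 1) * mean_sq_conj x) = 2 * (of_nat p * ?D - ?S)" .
  have "(\<Sum>i<p. \<Sum>j<p. of_real (mean_sq_conj (\<alpha> i - \<alpha> j))) = (\<Sum>i<p. \<Sum>j<p. ?c i i + ?c j j - ?c i j - ?c j i)"
  proof (intro sum.cong refl)
    fix i j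
    have r: "\<alpha> k * cnj (\<alpha> l) \<in> cyc_ring n" for k l by (intro cyc_ring_mult cyc_ring_cnj[OF assms(3)] *)
    have md: "mean_conj (u - v) = mean_conj u - mean_conj v" if "u \<in> cyc_ring n" "v \<in> cyc_ring n" for u v
      using mean_conj_add[OF assms(3), of "u - v" v] that by (simp add: cyc_ring_diff)
    have "of_real (mean_sq_conj (\<alpha> i - \<alpha> j)) = mean_conj ((\<alpha> i - \<alpha> j) * cnj (\<alpha> i - \<alpha> j))"
      by (intro mean_conj_norm_sq[OF assms(3), symmetric] cyc_ring_diff *)
    also have "(\<alpha> i - \<alpha> j) * cnj (\<alpha> i - \<alpha> j) = \<alpha> i * cnj (\<alpha> i) + \<alpha> j * cnj (\<alpha> j) - \<alpha> i * cnj (\<alpha> j) - \<alpha> j * cnj (\<alpha> i)"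
      by (simp add: algebra_simps)
    also have "mean_conj \<dots> = ?c i i + ?c j j - ?c i j - ?c j i"
      using r by (simp add: md mean_conj_add[OF assms(3)] cyc_ring_add cyc_ring_diff)
    finally show "of_real (mean_sq_conj (\<alpha> i - \<alpha> j)) = ?c i i + ?c j j - ?c i j - ?c j i" .
  qed
  also have "\<dots> = of_nat p * ?D + of_nat p * ?D - ?S - (\<Sum>i<p. \<Sum>j<p. ?c j i)"
    by (simp add: sum.distrib sum_subtractf sum_distrib_left)
  also have "(\<Sum>i<p. \<Sum>j<p. ?c j i) = ?S" by (rule sum.swap)
  finally have "complex_of_real (2 * (real p - 1) * mean_sq_conj x) = of_real (\<Sum>i<p. \<Sum>j<p. mean_sq_conj (\<alpha> i - \<alpha> j))"
    unfolding lhs by simp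
  then have "2 * (real p - 1) * mean_sq_conj x = (\<Sum>i<p. \<Sum>j<p. mean_sq_conj (\<alpha> i - \<alpha> j))"
    by (simp only: of_real_eq_iff)
  then show ?thesis using * 0 by blast
qed

section \<open>Sums of roots of unity\<close>

definition sum_roots :: "nat \<Rightarrow> complex \<Rightarrow> bool" where
  "sum_roots k x \<longleftrightarrow> (\<exists>zs. length zs \<le> k \<and> (\<forall>z\<in>set zs. \<exists>n>0. z ^ n = 1) \<and> x = sum_list zs)"

lemma sum_roots_mono: "sum_roots j x \<Longrightarrow> j \<le> k \<Longrightarrow> sum_roots k x"
  unfolding sum_roots_def by (elim exE, rule exI) auto

lemma sum_roots_0 [simp]: "sum_roots k 0"
  unfolding sum_roots_def by (rule exI[of _ "[]"]) simp

lemma sum_roots_add: 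
  assumes "sum_roots j x" "sum_roots k y" shows "sum_roots (j + k) (x + y)"
proof -
  obtain xs ys where "length xs \<le> j" "\<forall>z\<in>set xs. \<exists>n>0. z ^ n = 1" "x = sum_list xs"
    "length ys \<le> k" "\<forall>z\<in>set ys. \<exists>n>0. z ^ n = 1" "y = sum_list ys"
    using assms unfolding sum_roots_def by blast
  then show ?thesis unfolding sum_roots_def by (intro exI[of _ "xs @ ys"]) auto
qed

lemma sum_roots_root: "n > 0 \<Longrightarrow> z ^ n = 1 \<Longrightarrow> sum_roots 1 z"
  unfolding sum_roots_def by (rule exI[of _ "[z]"]) auto

lemma sum_roots_mult_root:
  assumes "n > 0" "w ^ n = 1" "sum_roots k x" shows "sum_roots k (w * x)"
proof -
  obtain xs where xs: "length xs \<le> k" "\<forall>z\<in>set xs. \<exists>n>0. z ^ n = 1" "x = sum_list xs"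
    using assms(3) unfolding sum_roots_def by blast
  have "\<exists>m>0. (w * z) ^ m = 1" if z: "z \<in> set xs" for z
  proof -
    obtain m where m: "m > 0" "z ^ m = 1" using xs(2) z by blast
    have "(w * z) ^ (n * m) = (w ^ n) ^ m * (z ^ m) ^ n"
      unfolding power_mult_distrib by (metis mult.commute power_mult)
    then have "(w * z) ^ (n * m) = 1" using assms(2) m(2) by simp
    then show ?thesis using assms(1) m(1) by (intro exI[of _ "n * m"]) simp
  qed
  then show ?thesis unfolding sum_roots_def using xs
    by (intro exI[of _ "map (\<lambda>z. w * z) xs"]) (auto simp: sum_list_const_mult)
qed

lemma sum_roots_sum:
  assumes "finite A" "\<And>i. i \<in> A \<Longrightarrow> sum_roots k (g i)"
  shows "sum_roots (card A * k) (sum g A)"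
  using assms by (induction A rule: finite_induct) (auto intro: sum_roots_add)

lemma cyc_ring_imp_sum_roots:
  assumes "N > 0" "x \<in> cyc_ring N" shows "\<exists>k. sum_roots k x"
proof -
  have int: "\<exists>k. sum_roots k (of_int a)" for a
  proof (induction a rule: int_induct[where k = 0])
    case base
    show ?case by simp
  next
    case (step1 i)
    then show ?case using sum_roots_add[OF _ sum_roots_root[of 1 1]] by auto
  next
    case (step2 i)
    then obtain k where "sum_roots k (of_int i)" by blast
    then have "sum_roots (k + 1) (of_int i + (- 1))" by (rule sum_roots_add) (rule sum_roots_root[of 2], auto)
    then show ?case by auto
  qed
  have "\<exists>k. sum_roots k (ev f (zt N))" for f
  proof (induction f)
    case (pCons a f)
    obtain k l where "sum_roots k (of_int a)" "sum_roots l (ev f (zt N))" using int pCons by blast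
    then have "sum_roots (k + l) (of_int a + zt N * ev f (zt N))"
      by (intro sum_roots_add sum_roots_mult_root[OF assms(1) zt_pow_N[OF assms(1)]])
    then show ?case by auto
  qed auto
  then show ?thesis using assms(2) by (metis cyc_ringE)
qed

section \<open>Finiteness at a fixed level\<close>

lemma trace_Ints:
  assumes N: "N > 0" and x: "x \<in> cyc_ring N"
  shows "(\<Sum>a\<in>units_mod N. sig N a x) \<in> \<int>"
proof (rule sig_fixed_imp_Ints[OF N])
  show "(\<Sum>a\<in>units_mod N. sig N a x) \<in> cyc_ring N"
    by (rule cyc_ring_sum) (use N x in \<open>auto simp: units_mod_def intro: sig_in_ring\<close>)
  fix b assume b: "coprime b N"
  have "sig N b (\<Sum>a\<in>units_mod N. sig N a x) = (\<Sum>a\<in>units_mod N. sig N b (sig N a x))"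
    by (rule sig_sum[OF N b]) (use N x in \<open>auto simp: units_mod_def intro: sig_in_frac cyc_ring_imp_frac\<close>)
  also have "\<dots> = (\<Sum>a\<in>units_mod N. sig N (a * b) x)"
    by (rule sum.cong) (use N b x in \<open>auto simp: units_mod_def sig_sig cyc_ring_imp_frac\<close>)
  also have "\<dots> = (\<Sum>a\<in>units_mod N. sig N a x)" by (rule sum_units_mod_mult[OF N b]) (simp add: sig_mod N)
  finally show "sig N b (\<Sum>a\<in>units_mod N. sig N a x) = (\<Sum>a\<in>units_mod N. sig N a x)" .
qed

text \<open>By the trace expansion x is determined by N rational integers. Each is at most the sum
  of |\<sigma> x| in absolute value, and t \<le> t^2 + 1 bounds this sum by (M(x) + 1) times the
  number of automorphisms, whence K.\<close>

lemma finite_bounded_mean_sq_conj: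
  assumes N: "N > 0"
  shows "finite {x \<in> cyc_ring N. mean_sq_conj x \<le> B}"
proof -
  define K where "K = \<lceil>(B + 1) * card (units_mod N)\<rceil>"
  define T where "T = PiE {..<N} (\<lambda>_. {-K..K})"
  have "{x \<in> cyc_ring N. mean_sq_conj x \<le> B} \<subseteq> (\<lambda>t. (\<Sum>j<N. of_int (t j) * zt N ^ j) / of_nat N) ` T"
  proof
    fix x assume "x \<in> {x \<in> cyc_ring N. mean_sq_conj x \<le> B}"
    then have x: "x \<in> cyc_ring N" "mean_sq_conj x \<le> B" by auto
    let ?t = "\<lambda>j. \<Sum>a\<in>units_mod N. sig N a (x * zt N ^ ((N - 1) * j))"
    have "\<exists>c. ?t j = of_int c \<and> c \<in> {-K..K}" for j
    proof -
      have z: "zt N ^ ((N - 1) * j) \<in> cyc_ring N" by (simp add: cyc_ring_power)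
      have "?t j \<in> \<int>" by (rule trace_Ints[OF N]) (rule cyc_ring_mult[OF x(1) z])
      then obtain c where c: "?t j = of_int c" by (rule Ints_cases)
      have "norm (?t j) \<le> (\<Sum>a\<in>units_mod N. norm (sig N a (x * zt N ^ ((N - 1) * j))))" by (rule norm_sum)
      also have "\<dots> \<le> (\<Sum>a\<in>units_mod N. (norm (sig N a x))\<^sup>2 + 1)"
      proof (rule sum_mono)
        fix a assume "a \<in> units_mod N"
        then have a: "coprime a N" by (simp add: units_mod_def)
        have "sig N a (x * zt N ^ ((N - 1) * j)) = sig N a x * zt N ^ ((N - 1) * j * a)"
          using sig_mult[OF N a cyc_ring_imp_frac[OF x(1)] cyc_ring_imp_frac[OF z]] sig_zt_pow[OF N a] by simp
        then have "norm (sig N a (x * zt N ^ ((N - 1) * j))) = norm (sig N a x)"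
          by (simp add: norm_mult norm_power)
        also have "\<dots> \<le> (norm (sig N a x))\<^sup>2 + 1"
        proof -
          have "0 \<le> (norm (sig N a x) - 1)\<^sup>2" by simp
          then have "2 * norm (sig N a x) \<le> (norm (sig N a x))\<^sup>2 + 1" by (simp add: power2_diff)
          then show ?thesis using norm_ge_zero[of "sig N a x"] by linarith
        qed
        finally show "norm (sig N a (x * zt N ^ ((N - 1) * j))) \<le> (norm (sig N a x))\<^sup>2 + 1" .
      qed
      also have "\<dots> = (mean_sq_conj x + 1) * card (units_mod N)"
        using card_units_mod_pos[OF N] by (simp add: mean_sq_conj_eq[OF N x(1)] sum.distrib field_simps)
      also have "\<dots> \<le> (B + 1) * card (units_mod N)" using x(2) by (intro mult_right_mono) auto
      finally have "\<bar>real_of_int c\<bar> \<le> (B + 1) * card (units_mod N)" unfolding c by simp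
      then have "\<bar>real_of_int c\<bar> \<le> of_int K" unfolding K_def by linarith
      then have "c \<in> {-K..K}" by auto
      then show ?thesis using c by blast
    qed
    then obtain c where c: "\<And>j. ?t j = of_int (c j)" "\<And>j. c j \<in> {-K..K}" by metis
    have "of_nat N * x = (\<Sum>j<N. of_int (c j) * zt N ^ j)"
      using trace_expansion[OF N cyc_ring_imp_frac[OF x(1)]] unfolding c(1) .
    then have "x = (\<Sum>j<N. of_int (restrict c {..<N} j) * zt N ^ j) / of_nat N" using N by (simp add: field_simps)
    moreover have "restrict c {..<N} \<in> T" unfolding T_def using c(2) by (simp add: PiE_iff)
    ultimately show "x \<in> (\<lambda>t. (\<Sum>j<N. of_int (t j) * zt N ^ j) / of_nat N) ` T" by blast
  qed
  moreover have "finite T" unfolding T_def by (intro finite_PiE) auto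
  ultimately show ?thesis using finite_surj by blast
qed

lemma fixed_level_sum_roots_bound:
  assumes N: "N > 0"
  shows "\<exists>C. \<forall>x\<in>cyc_ring N. mean_sq_conj x \<le> B \<longrightarrow> sum_roots C x"
proof -
  have "\<exists>C. \<forall>x\<in>A. sum_roots C x" if "finite A" "\<And>x. x \<in> A \<Longrightarrow> \<exists>k. sum_roots k x" for A
    using that
  proof (induction A rule: finite_induct)
    case (insert y A)
    obtain C k where "\<forall>x\<in>A. sum_roots C x" "sum_roots k y" using insert by blast
    then have "\<forall>x\<in>insert y A. sum_roots (max C k) x" by (auto intro: sum_roots_mono)
    then show ?case by blast
  qed auto
  from this[OF finite_bounded_mean_sq_conj[OF N, of B]] show ?thesis
    using cyc_ring_imp_sum_roots[OF N] by auto
qed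

section \<open>Lowering the level\<close>

lemma squarefree_dvd_fact:
  assumes N: "N > 0" and p: "\<And>p::nat. prime p \<Longrightarrow> p dvd N \<Longrightarrow> p \<le> P \<and> \<not> p * p dvd N"
  shows "N dvd fact P"
proof (rule multiplicity_le_imp_dvd)
  fix q :: nat assume q: "prime q"
  show "multiplicity q N \<le> multiplicity q (fact P)"
  proof (cases "q dvd N")
    case True
    then have qP: "q \<le> P" "\<not> q ^ 2 dvd N" using p[OF q] by (auto simp: power2_eq_square)
    have "\<not> is_unit q" using q not_prime_unit by blast
    have "multiplicity q N < 2"
      using qP(2) multiplicity_dvd' not_less by metis
    moreover have "q dvd fact P" using qP(1) q by (simp add: prime_dvd_fact_iff)
    then have "multiplicity q (fact P) \<ge> 1" using \<open>\<not> is_unit q\<close>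
      by (intro multiplicity_geI) auto
    ultimately show ?thesis by linarith
  qed (simp add: not_dvd_imp_multiplicity_0)
qed (use N in auto)

text \<open>The common end of both reductions. A lone component is x up to a root of unity, so it
  has the same mean square; C must not grow here, as this case may recur for every prime of the
  level. With two or more components the count C' for smaller mean squares applies to each.\<close>

lemma combine_sum_roots:
  assumes N: "N > 0" "n dvd N" and \<omega>: "\<omega> ^ N = 1" and I: "finite I"
    and \<gamma>: "\<And>i. i \<in> I \<Longrightarrow> \<gamma> i \<in> cyc_ring n" and x: "x = (\<Sum>i\<in>I. \<omega> ^ i * \<gamma> i)"
    and small: "\<And>y. y \<in> cyc_ring n \<Longrightarrow> mean_sq_conj y = mean_sq_conj x \<Longrightarrow> sum_roots C y"
    and big: "\<And>i. i \<in> I \<Longrightarrow> card I \<ge> 2 \<Longrightarrow> sum_roots C' (\<gamma> i)"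
    and C: "card I * C' \<le> C"
  shows "sum_roots C x"
proof -
  have \<omega>i: "(\<omega> ^ i) ^ N = 1" for i by (metis \<omega> mult.commute power_mult power_one)
  consider "card I = 0" | "card I = 1" | "card I \<ge> 2" by linarith
  then show ?thesis
  proof cases
    case 1
    then show ?thesis using I x by simp
  next
    case 2
    then obtain i where i: "I = {i}" by (auto simp: card_1_singleton_iff)
    have x': "x = \<omega> ^ i * \<gamma> i" using x i by simp
    have "\<gamma> i \<in> cyc_ring n" using \<gamma> i by simp
    then have "\<gamma> i \<in> cyc_ring N" using cyc_ring_mono[OF N] by blast
    then have "mean_sq_conj (\<gamma> i) = mean_sq_conj x" 
      unfolding x' by (rule mean_sq_conj_root_mult[OF N(1) _ \<omega>i, symmetric])
    then have "sum_roots C (\<gamma> i)" using small \<open>\<gamma> i \<in> cyc_ring n\<close> by blast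
    then show ?thesis unfolding x' by (rule sum_roots_mult_root[OF N(1) \<omega>i])
  next
    case 3
    have "sum_roots (card I * C') x"
      unfolding x using 3 by (intro sum_roots_sum I sum_roots_mult_root[OF N(1) \<omega>i] big)
    then show ?thesis using C by (rule sum_roots_mono)
  qed
qed

text \<open>The nonzero components share M(x) and each takes at least 1. So there are at most b + 1
  of them, and if there are two, each is left with at most (b + 1)/2 - 1, within the range b/2 of
  C'.\<close>

lemma ramified_step:
  assumes p: "prime (p::nat)" "p dvd n" "n > 0" and x: "x \<in> cyc_ring (p * n)" 
    and B: "mean_sq_conj x \<le> real (Suc b) / 2"
    and small: "\<And>y. y \<in> cyc_ring n \<Longrightarrow> mean_sq_conj y \<le> real (Suc b) / 2 \<Longrightarrow> sum_roots C y"
    and big: "\<And>y. y \<in> cyc_ring n \<Longrightarrow> mean_sq_conj y \<le> real b / 2 \<Longrightarrow> sum_roots C' y"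
    and C: "Suc b * C' \<le> C"
  shows "sum_roots C x"
proof -
  obtain \<omega> \<alpha> where *: "\<omega> ^ (p * n) = 1" "\<And>i. \<alpha> i \<in> cyc_ring n" "x = (\<Sum>i<p. \<omega> ^ i * \<alpha> i)"
    and M: "mean_sq_conj x = (\<Sum>i<p. mean_sq_conj (\<alpha> i))"
    using mean_sq_conj_decompose_ramified[OF p x] by blast
  define I where "I = {i. i < p \<and> \<alpha> i \<noteq> 0}"
  have fin: "finite I" by (simp add: I_def)
  have ge1: "mean_sq_conj (\<alpha> i) \<ge> 1" if "i \<in> I" for i
    using mean_sq_conj_ge_1[OF p(3) *(2)] that by (simp add: I_def)
  have MI: "(\<Sum>i\<in>I. mean_sq_conj (\<alpha> i)) \<le> mean_sq_conj x"
    unfolding M by (rule sum_mono2) (auto simp: I_def mean_sq_conj_nonneg)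
  have "real (card I) = (\<Sum>i\<in>I. 1)" by simp
  also have "\<dots> \<le> (\<Sum>i\<in>I. mean_sq_conj (\<alpha> i))" by (rule sum_mono) (rule ge1)
  finally have "real (card I) \<le> real (Suc b) / 2" using MI B by linarith
  also have "\<dots> \<le> real (Suc b)" by simp
  finally have cardI: "card I \<le> Suc b" by (simp only: of_nat_le_iff)
  show ?thesis
  proof (rule combine_sum_roots[of "p * n" n \<omega> I \<alpha> x C C'])
    show "x = (\<Sum>i\<in>I. \<omega> ^ i * \<alpha> i)"
      unfolding *(3) by (rule sum.mono_neutral_right) (auto simp: I_def)
    show "card I * C' \<le> C" using C cardI mult_le_mono1 le_trans by blast
    fix i assume i: "i \<in> I" "card I \<ge> 2"
    then have "card (I - {i}) \<noteq> 0" using fin by simp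
    then obtain j where j: "j \<in> I" "j \<noteq> i" by (metis DiffE card.empty ex_in_conv singletonI)
    have "mean_sq_conj (\<alpha> i) + mean_sq_conj (\<alpha> j) = (\<Sum>l\<in>{i, j}. mean_sq_conj (\<alpha> l))" using j by simp
    also have "\<dots> \<le> (\<Sum>i\<in>I. mean_sq_conj (\<alpha> i))"
      using i j fin by (intro sum_mono2) (auto simp: mean_sq_conj_nonneg)
    finally have "mean_sq_conj (\<alpha> i) + 1 \<le> real (Suc b) / 2" using MI B ge1[OF j(1)] by linarith
    then show "sum_roots C' (\<alpha> i)" using big[OF *(2)] by simp
  qed (use p * small B fin prime_gt_0_nat[OF p(1)] in auto)
qed

text \<open>
  Shifting all \<open>\<alpha>(i)\<close> by the most frequent value leaves at most \<open>2B\<close> of them nonzero, where \<open>2B = b + 1\<close>.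
\<close>

lemma unramified_step:
  assumes p: "prime (p::nat)" "\<not> p dvd n" "n > 0" and x: "x \<in> cyc_ring (p * n)" 
    and B: "mean_sq_conj x \<le> real (Suc b) / 2"
    and large: "p > Suc b * Suc b + Suc b"
    and small: "\<And>y. y \<in> cyc_ring n \<Longrightarrow> mean_sq_conj y \<le> real (Suc b) / 2 \<Longrightarrow> sum_roots C y"
    and big: "\<And>y. y \<in> cyc_ring n \<Longrightarrow> mean_sq_conj y \<le> real b / 2 \<Longrightarrow> sum_roots C' y"
    and C: "Suc b * C' \<le> C"
  shows "sum_roots C x"
proof -
  obtain \<omega> \<alpha> where *: "\<omega> ^ (p * n) = 1" "\<And>i. \<alpha> i \<in> cyc_ring n" "x = (\<Sum>i<p. \<omega> ^ i * \<alpha> i)"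
    "(\<Sum>i<p. \<omega> ^ i) = 0"
    and M: "2 * (real p - 1) * mean_sq_conj x = (\<Sum>i<p. \<Sum>j<p. mean_sq_conj (\<alpha> i - \<alpha> j))"
    using mean_sq_conj_decompose_unramified[OF p x] by blast
  have p1: "p > 1" by (rule prime_gt_1_nat[OF p(1)])
  define d where "d i = card {j. j < p \<and> \<alpha> j \<noteq> \<alpha> i}" for i
  have d_le: "real (d i) \<le> (\<Sum>j<p. mean_sq_conj (\<alpha> i - \<alpha> j))" for i
  proof -
    have "real (d i) = (\<Sum>j\<in>{j. j < p \<and> \<alpha> j \<noteq> \<alpha> i}. 1)" by (simp add: d_def)
    also have "\<dots> \<le> (\<Sum>j\<in>{j. j < p \<and> \<alpha> j \<noteq> \<alpha> i}. mean_sq_conj (\<alpha> i - \<alpha> j))"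
      by (intro sum_mono mean_sq_conj_ge_1[OF p(3)] cyc_ring_diff *(2)) auto
    also have "\<dots> \<le> (\<Sum>j<p. mean_sq_conj (\<alpha> i - \<alpha> j))"
      by (rule sum_mono2) (auto simp: mean_sq_conj_nonneg)
    finally show ?thesis .
  qed
  have "2 * (real p - 1) * mean_sq_conj x = (real p - 1) * (2 * mean_sq_conj x)" by (simp only: ac_simps)
  also have "\<dots> \<le> (real p - 1) * real (Suc b)" using B p1 by (intro mult_left_mono) auto
  finally have Mb: "2 * (real p - 1) * mean_sq_conj x \<le> (real p - 1) * real (Suc b)" .
  \<comment> \<open>The p row sums add up to at most (p - 1)(b + 1), so not every row can reach b +
    1.\<close>
  have "\<exists>i0<p. d i0 \<le> Suc b"
  proof (rule ccontr)
    assume "\<not> (\<exists>i0<p. d i0 \<le> Suc b)"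
    then have ge: "real (Suc b) \<le> real (d i)" if "i < p" for i using that by (meson le_cases of_nat_le_iff)
    have "real p * real (Suc b) = (\<Sum>i<p. real (Suc b))" by simp
    also have "\<dots> \<le> (\<Sum>i<p. real (d i))" by (rule sum_mono) (use ge in auto)
    also have "\<dots> \<le> (\<Sum>i<p. \<Sum>j<p. mean_sq_conj (\<alpha> i - \<alpha> j))" by (rule sum_mono) (rule d_le)
    also have "\<dots> \<le> (real p - 1) * real (Suc b)" using M Mb by simp
    finally show False by (simp add: left_diff_distrib)
  qed
  then obtain i0 where i0: "i0 < p" "d i0 \<le> Suc b" by blast
  define I where "I = {j. j < p \<and> \<alpha> j \<noteq> \<alpha> i0}"
  define \<gamma> where "\<gamma> i = \<alpha> i - \<alpha> i0" for i
  have fin: "finite I" and Isub: "I \<subseteq> {..<p}" by (auto simp: I_def)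
  have cardI: "card I \<le> Suc b" using i0(2) by (simp add: d_def I_def)
  have \<gamma>: "\<gamma> i \<in> cyc_ring n" for i unfolding \<gamma>_def by (intro cyc_ring_diff *(2))
  have ge1: "mean_sq_conj (\<gamma> i) \<ge> 1" if "i \<in> I" for i
    using mean_sq_conj_ge_1[OF p(3) \<gamma>] that by (simp add: I_def \<gamma>_def)
  have "x = (\<Sum>i<p. \<omega> ^ i * \<gamma> i) + (\<Sum>i<p. \<omega> ^ i) * \<alpha> i0"
    unfolding *(3) \<gamma>_def by (simp add: right_diff_distrib sum_subtractf sum_distrib_right)
  then have x_eq: "x = (\<Sum>i<p. \<omega> ^ i * \<gamma> i)" using *(4) by simp
  define S where "S = (\<Sum>i\<in>I. mean_sq_conj (\<gamma> i))"
  have S_le: "2 * ((real p - real (card I)) * S) \<le> 2 * (real p - 1) * mean_sq_conj x"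
  proof -
    let ?J = "{..<p} - I"
    let ?g = "\<lambda>i j. mean_sq_conj (\<alpha> i - \<alpha> j)"
    have cardJ: "real (card ?J) = real p - real (card I)"
      using Isub fin card_mono[OF _ Isub] by (simp add: card_Diff_subset of_nat_diff)
    have g1: "?g i j = mean_sq_conj (\<gamma> i)" if "j \<in> ?J" for i j
      using that by (auto simp: I_def \<gamma>_def)
    have g2: "?g i j = mean_sq_conj (\<gamma> j)" if "i \<in> ?J" for i j
      using that mean_sq_conj_minus[OF p(3) \<gamma>, of j] by (auto simp: I_def \<gamma>_def)
    have split: "sum h {..<p} = sum h I + sum h ?J" for h :: "nat \<Rightarrow> real"
      using sum.subset_diff[OF Isub, of h] by simp
    have "(\<Sum>j\<in>?J. ?g i j) = (real p - real (card I)) * mean_sq_conj (\<gamma> i)" for i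
      using g1 cardJ by simp
    then have a1: "(\<Sum>i\<in>I. \<Sum>j\<in>?J. ?g i j) = (real p - real (card I)) * S"
      by (simp add: S_def sum_distrib_left)
    have "(\<Sum>j\<in>I. ?g i j) = S" if "i \<in> ?J" for i using g2[OF that] by (simp add: S_def)
    then have a2: "(\<Sum>i\<in>?J. \<Sum>j\<in>I. ?g i j) = (real p - real (card I)) * S" using cardJ by simp
    \<comment> \<open>Only pairs with exactly one index in I are kept. Each contributes the mean
      square of the component with that index, and they are counted in both orders.\<close>
    have "(\<Sum>i\<in>I. \<Sum>j\<in>?J. ?g i j) + (\<Sum>i\<in>?J. \<Sum>j\<in>I. ?g i j) \<le> (\<Sum>i<p. \<Sum>j<p. ?g i j)"
      unfolding split sum.distrib by (simp add: sum_nonneg mean_sq_conj_nonneg)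
    then show ?thesis unfolding M a1 a2 by (simp only: mult_2)
  qed
  show ?thesis
  proof (rule combine_sum_roots[of "p * n" n \<omega> I \<gamma> x C C'])
    show "x = (\<Sum>i\<in>I. \<omega> ^ i * \<gamma> i)"
      unfolding x_eq by (rule sum.mono_neutral_right) (auto simp: I_def \<gamma>_def)
    show "card I * C' \<le> C" using C cardI mult_le_mono1 le_trans by blast
    fix i assume i: "i \<in> I" "card I \<ge> 2"
    then have "card (I - {i}) \<noteq> 0" using fin by simp
    then obtain j where j: "j \<in> I" "j \<noteq> i" by (metis DiffE card.empty ex_in_conv singletonI)
    have "mean_sq_conj (\<gamma> i) + mean_sq_conj (\<gamma> j) = (\<Sum>l\<in>{i, j}. mean_sq_conj (\<gamma> l))" using j by simp
    also have "\<dots> \<le> S" unfolding S_def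
      using i j fin by (intro sum_mono2) (auto simp: mean_sq_conj_nonneg)
    finally have s: "mean_sq_conj (\<gamma> i) + 1 \<le> S" using ge1[OF j(1)] by linarith
    define c where "c = real (Suc b)"
    have pc: "real p > c * c + c" using large unfolding c_def by (metis of_nat_add of_nat_less_iff of_nat_mult)
    have "c \<ge> 1" by (simp add: c_def)
    have "(real p - c) * (mean_sq_conj (\<gamma> i) + 1) \<le> (real p - real (card I)) * S"
    proof (rule mult_mono)
      show "real p - c \<le> real p - real (card I)" using cardI by (simp add: c_def)
      show "0 \<le> real p - real (card I)" using cardI pc \<open>c \<ge> 1\<close> unfolding c_def
        by (smt (verit) mult_nonneg_nonneg of_nat_le_iff)
      show "0 \<le> mean_sq_conj (\<gamma> i) + 1" using mean_sq_conj_nonneg[of "\<gamma> i"] by linarith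
    qed (rule s)
    also have "2 * \<dots> \<le> (real p - 1) * c" using S_le Mb by (simp add: c_def)
    finally have main: "2 * ((real p - c) * (mean_sq_conj (\<gamma> i) + 1)) \<le> (real p - 1) * c" by simp
    \<comment> \<open>Against \<open>main\<close> this amounts to (p - 1) c \<le> (p - c)(c + 1),
      that is c^2 \<le> p, together with p > c for the division. The bound c^2 + c on p covers
      both.\<close>
    have "mean_sq_conj (\<gamma> i) + 1 \<le> (c + 1) / 2"
    proof (rule ccontr)
      assume "\<not> ?thesis"
      then have "(c + 1) / 2 < mean_sq_conj (\<gamma> i) + 1" by simp
      moreover have "real p - c > 0" using pc \<open>c \<ge> 1\<close> by (smt (verit) mult_nonneg_nonneg)
      ultimately have "(real p - c) * ((c + 1) / 2) < (real p - c) * (mean_sq_conj (\<gamma> i) + 1)"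
        by (rule mult_strict_left_mono)
      then have "(real p - c) * (c + 1) < (real p - 1) * c" using main by simp
      then show False using pc \<open>c \<ge> 1\<close> by (simp add: algebra_simps)
    qed
    then have "mean_sq_conj (\<gamma> i) \<le> real b / 2" by (simp add: c_def)
    then show "sum_roots C' (\<gamma> i)" using big[OF \<gamma>] by simp
  qed (use p * small B fin \<gamma> p1 in auto)
qed

text \<open>B runs through half-integers to make the drop by 1/2 an induction on b. Inside it an
  induction on the level keeps C fixed, so that C is uniform in N. At b = 0 the lower bound 1 leaves
  only x = 0.\<close>

theorem mean_sq_conj_bounds_sum_roots:
  "\<exists>C. \<forall>N>0. \<forall>x\<in>cyc_ring N. mean_sq_conj x \<le> real b / 2 \<longrightarrow> sum_roots C x"
proof (induction b)
  case 0
  have "x = 0" if "N > 0" "x \<in> cyc_ring N" "mean_sq_conj x \<le> 0" for N x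
    using mean_sq_conj_ge_1[OF that(1,2)] that(3) by fastforce
  then have "\<forall>N>0. \<forall>x\<in>cyc_ring N. mean_sq_conj x \<le> real 0 / 2 \<longrightarrow> sum_roots 0 x"
    using sum_roots_0 by (metis div_0 of_nat_0)
  then show ?case by blast
next
  case (Suc b)
  then obtain C' where C': "\<And>N x. N > 0 \<Longrightarrow> x \<in> cyc_ring N \<Longrightarrow> mean_sq_conj x \<le> real b / 2 \<Longrightarrow> sum_roots C' x" by blast
  define P where "P = Suc b * Suc b + Suc b"
  obtain C1 where C1: "\<And>x. x \<in> cyc_ring (fact P) \<Longrightarrow> mean_sq_conj x \<le> real (Suc b) / 2 \<Longrightarrow> sum_roots C1 x"
    using fixed_level_sum_roots_bound[of "fact P" "real (Suc b) / 2"] by auto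
  define C where "C = max C1 (Suc b * C')"
  have C: "Suc b * C' \<le> C" "C1 \<le> C" by (auto simp: C_def)
  have "sum_roots C x" if "N > 0" "x \<in> cyc_ring N" "mean_sq_conj x \<le> real (Suc b) / 2" for N x
    using that
  proof (induction N arbitrary: x rule: less_induct)
    case (less N)
    \<comment> \<open>A repeated prime factor can be stripped whatever its size, a simple one only
      above P; a level admitting neither is squarefree with all primes at most P, hence divides
      P!.\<close>
    consider (ram) p where "prime p" "p * p dvd N"
      | (unram) p where "prime p" "p dvd N" "\<not> p * p dvd N" "p > P"
      | (bounded) "\<And>p. prime p \<Longrightarrow> p dvd N \<Longrightarrow> p \<le> P \<and> \<not> p * p dvd N"
      by (meson not_le)
    then show ?case
    proof cases
      case ram
      then obtain m where m: "N = p * (p * m)" by (metis dvdE mult.assoc)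
      then have n: "p * m > 0" "p * m < N" using less.prems(1) prime_gt_1_nat[OF ram(1)] by auto
      show ?thesis
        by (rule ramified_step[OF ram(1) _ n(1) less.prems(2)[unfolded m] less.prems(3) _ _ C(1)])
           (use less.IH[OF n(2,1)] C'[OF n(1)] in auto)
    next
      case unram
      then obtain n where m: "N = p * n" by blast
      then have n: "n > 0" "n < N" using less.prems(1) prime_gt_1_nat[OF unram(1)] by auto
      have "\<not> p dvd n" using unram(3) m by auto
      then show ?thesis
        by (rule unramified_step[OF unram(1) _ n(1) less.prems(2)[unfolded m] less.prems(3) unram(4)[unfolded P_def] _ _ C(1)])
           (use less.IH[OF n(2,1)] C'[OF n(1)] in auto)
    next
      case bounded
      then have "N dvd fact P" using squarefree_dvd_fact less.prems(1) by blast
      then have "x \<in> cyc_ring (fact P)" using cyc_ring_mono[of "fact P" N] less.prems(2) by auto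
      then show ?thesis using C1 less.prems(3) C(2) sum_roots_mono by blast
    qed
  qed
  then show ?case by blast
qed

section \<open>Means of roots of unity\<close>

text \<open>These are the values mu(n)/phi(n), the means of primitive n-th roots of unity: the
  product over the primes of a squarefree n, and 0 for all other n.\<close>

definition root_means :: "real set" where
  "root_means = insert 0 {\<Prod>p\<in>P. - 1 / (real p - 1) | P. finite P \<and> (\<forall>p\<in>P. prime (p::nat))}"

text \<open>One prime p of N is stripped at a time. The clause that the primes in P divide the level
  ensures that p is new when it does not divide N / p, so that inserting it contributes exactly one
  factor.\<close>

lemma mean_conj_root_unity_primes:
  assumes "N > 0" "z ^ N = 1"
  shows "mean_conj z = 0 \<or> (\<exists>P. finite P \<and> (\<forall>p\<in>P. prime p \<and> p dvd N) \<and>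
    mean_conj z = of_real (\<Prod>p\<in>P. - 1 / (real p - 1)))"
  using assms
proof (induction N arbitrary: z rule: less_induct)
  case (less N)
  show ?case
  proof (cases "N = 1")
    case True
    then have "z = 1" using less.prems by simp
    then show ?thesis by (intro disjI2 exI[of _ "{}"]) simp
  next
    case False
    then obtain p where p: "prime p" "p dvd N" using prime_factor_nat by blast
    then obtain n where n: "N = p * n" by blast
    have p1: "p > 1" by (rule prime_gt_1_nat[OF p(1)])
    have n0: "n > 0" "n < N" using less.prems(1) n p1 by auto
    obtain k where k: "z = zt N ^ k" using root_unity_eq_zt_pow[OF less.prems] by blast
    show ?thesis
    proof (cases "p dvd k")
      case True
      then obtain l where l: "k = p * l" by blast
      have "z = zt n ^ l" unfolding k l n using zt_mult[OF n0(1), of p] p1 by (simp add: power_mult)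
      then have "z ^ n = 1" using n0(1) by (metis mult.commute power_mult power_one zt_pow_N)
      then have "mean_conj z = 0 \<or> (\<exists>P. finite P \<and> (\<forall>p\<in>P. prime p \<and> p dvd n) \<and>
         mean_conj z = of_real (\<Prod>p\<in>P. - 1 / (real p - 1)))" using less.IH[OF n0(2,1)] by blast
      then show ?thesis unfolding n by (meson dvd_mult)
    next
      case pk: False
      show ?thesis
      proof (cases "p dvd n")
        case True
        then show ?thesis using mean_conj_ramified[OF p(1) True n0(1) pk cyc_ring_1] k n by simp
      next
        case False
        then have co: "coprime p n" using p prime_imp_coprime by blast
        obtain u v where uv: "zt N = zt p ^ u * zt n ^ v" "[u * n = 1] (mod p)"
          using zt_coprime_decompose[OF co] p1 n0 unfolding n by auto
        have "coprime u p"
          using uv(2) by (metis cong_imp_coprime cong_sym coprime_1_left coprime_mult_left_iff)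
        then have "\<not> p dvd u" using p1 by (metis coprime_absorb_right nat_dvd_1_iff_1 nat_neq_iff)
        then have "\<not> p dvd u * k" using pk p(1) by (simp add: prime_dvd_mult_iff)
        then have w1: "zt p ^ (u * k) \<noteq> 1" by (rule zt_neq_1[OF p1])
        have wp: "(zt p ^ (u * k)) ^ p = 1" using p1
          by (metis mult.commute power_mult power_one zt_pow_N gr_implies_not0 gr0I)
        define y where "y = zt n ^ (v * k)"
        have y: "y \<in> cyc_ring n" by (simp add: y_def cyc_ring_power)
        have "y ^ n = 1" unfolding y_def using n0(1) by (metis mult.commute power_mult power_one zt_pow_N)
        then consider "mean_conj y = 0" | P where "finite P" "\<And>q. q \<in> P \<Longrightarrow> prime q \<and> q dvd n"
            "mean_conj y = of_real (\<Prod>p\<in>P. - 1 / (real p - 1))"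
          using less.IH[OF n0(2,1), of y] by blast
        moreover have "z = zt p ^ (u * k) * y"
          unfolding k uv(1) y_def by (simp add: power_mult_distrib power_mult)
        then have mz: "mean_conj z = - mean_conj y / (of_nat p - 1)"
          using mean_conj_unramified[OF p(1) False n0(1) wp w1 y] by simp
        ultimately show ?thesis
        proof cases
          case 2
          have "p \<notin> P" using 2(2) False by blast
          then have "mean_conj z = of_real (\<Prod>p\<in>insert p P. - 1 / (real p - 1))"
            unfolding mz 2(3) using 2(1) by simp
          moreover have "finite (insert p P)" "\<forall>q\<in>insert p P. prime q \<and> q dvd N"
            using 2 p n by auto
          ultimately show ?thesis by blast
        qed (simp add: mz)
      qed
    qed
  qed
qed

lemma mean_conj_root_unity:
  assumes "N > 0" "z ^ N = 1"
  shows "\<exists>r\<in>root_means. mean_conj z = of_real r"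
  using mean_conj_root_unity_primes[OF assms]
proof
  assume "mean_conj z = 0"
  then show ?thesis by (intro bexI[of _ 0]) (auto simp: root_means_def)
next
  assume "\<exists>P. finite P \<and> (\<forall>p\<in>P. prime p \<and> p dvd N) \<and> mean_conj z = of_real (\<Prod>p\<in>P. - 1 / (real p - 1))"
  then show ?thesis unfolding root_means_def by blast
qed

lemma root_means_Rats: "root_means \<subseteq> \<rat>"
proof -
  have "(\<Prod>p\<in>P. - 1 / (real p - 1)) \<in> \<rat>" for P :: "nat set"
    by (induction P rule: infinite_finite_induct) auto
  then show ?thesis by (auto simp: root_means_def)
qed

text \<open>All factors have absolute value at most 1, so a product of size at least e has each
  single factor at least e, which bounds every prime by 1 + 1/e. The factor for the prime 2 has
  absolute value 1, so only the size of the primes is used.\<close>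

lemma finite_root_means_away_from_0:
  assumes e: "e > 0"
  shows "finite {r \<in> root_means. \<bar>r\<bar> \<ge> e}"
proof -
  define K where "K = nat \<lceil>1 / e\<rceil> + 1"
  let ?h = "\<lambda>P. \<Prod>p\<in>P. - 1 / (real p - 1)"
  have "{r \<in> root_means. \<bar>r\<bar> \<ge> e} \<subseteq> ?h ` Pow {..K}"
  proof
    fix r assume "r \<in> {r \<in> root_means. \<bar>r\<bar> \<ge> e}"
    then have r: "r \<in> root_means" "\<bar>r\<bar> \<ge> e" by auto
    have "r \<noteq> 0" using r(2) e by auto
    with r(1) obtain P where P: "finite P" "\<And>p. p \<in> P \<Longrightarrow> prime p" "r = ?h P"
      unfolding root_means_def by blast
    have "P \<subseteq> {..K}"
    proof
      fix p assume p: "p \<in> P"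
      have ge1: "real q - 1 \<ge> 1" if "q \<in> P" for q using prime_ge_2_nat[OF P(2)[OF that]] by simp
      have "\<bar>r\<bar> = (\<Prod>q\<in>P. 1 / (real q - 1))"
        unfolding P(3) abs_prod by (rule prod.cong) (use ge1 in \<open>auto simp: abs_if dest: ge1\<close>)
      also have "\<dots> = 1 / (real p - 1) * (\<Prod>q\<in>P - {p}. 1 / (real q - 1))"
        by (rule prod.remove[OF P(1) p])
      also have "\<dots> \<le> 1 / (real p - 1) * 1"
      proof (rule mult_left_mono)
        show "(\<Prod>q\<in>P - {p}. 1 / (real q - 1)) \<le> 1"
        proof (rule prod_le_1)
          fix q assume "q \<in> P - {p}"
          then have "real q - 1 \<ge> 1" using ge1 by blast
          then show "0 \<le> 1 / (real q - 1) \<and> 1 / (real q - 1) \<le> 1" by simp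
        qed
        show "0 \<le> 1 / (real p - 1)" using ge1[OF p] by simp
      qed
      finally have "e \<le> 1 / (real p - 1)" using r(2) by simp
      then have "real p - 1 \<le> 1 / e" using e ge1[OF p] by (simp add: field_simps)
      then have "real p \<le> real K" unfolding K_def by linarith
      then show "p \<in> {..K}" by simp
    qed
    then show "r \<in> ?h ` Pow {..K}" using P(3) by blast
  qed
  then show ?thesis by (rule finite_subset) simp
qed

text \<open>An open set around 0 already contains all but finitely many elements.\<close>

lemma compact_root_means: "compact root_means"
proof (rule compactI)
  fix \<C> :: "real set set"
  assume \<C>: "\<forall>U\<in>\<C>. open U" "root_means \<subseteq> \<Union>\<C>"
  have "0 \<in> root_means" by (simp add: root_means_def)
  then obtain U where U: "U \<in> \<C>" "0 \<in> U" using \<C>(2) by blast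
  then obtain e where e: "e > 0" "ball 0 e \<subseteq> U" using \<C>(1) openE by blast
  let ?F = "{r \<in> root_means. \<bar>r\<bar> \<ge> e}"
  have "finite ?F" by (rule finite_root_means_away_from_0[OF e(1)])
  have "\<forall>r\<in>?F. \<exists>V\<in>\<C>. r \<in> V" using \<C>(2) by blast
  then obtain V where V: "\<And>r. r \<in> ?F \<Longrightarrow> V r \<in> \<C> \<and> r \<in> V r" by metis
  have "root_means \<subseteq> \<Union>(insert U (V ` ?F))"
  proof
    fix r assume r: "r \<in> root_means"
    show "r \<in> \<Union>(insert U (V ` ?F))"
    proof (cases "\<bar>r\<bar> \<ge> e")
      case False
      then have "r \<in> ball 0 e" by simp
      then show ?thesis using e(2) by auto
    qed (use V r in blast)
  qed
  moreover have "insert U (V ` ?F) \<subseteq> \<C>" using U V by auto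
  ultimately show "\<exists>\<C>'\<subseteq>\<C>. finite \<C>' \<and> root_means \<subseteq> \<Union>\<C>'"
    using \<open>finite ?F\<close> by (meson finite.insertI finite_imageI)
qed

section \<open>Sumsets, and the conclusion\<close>

fun root_means_sum :: "nat \<Rightarrow> real set" where
  "root_means_sum 0 = {0}"
| "root_means_sum (Suc k) = {x + y | x y. x \<in> root_means_sum k \<and> y \<in> root_means}"

lemma compact_root_means_sum: "compact (root_means_sum k)"
  by (induction k) (auto intro: compact_sums compact_root_means)

lemma root_means_sum_Rats: "root_means_sum k \<subseteq> \<rat>"
  using root_means_Rats by (induction k) (auto intro!: Rats_add)

text \<open>Shorter sums are padded with 0, an element of \<open>root_means\<close>.\<close>

lemma root_means_sum_mono:
  assumes "j \<le> k" shows "root_means_sum j \<subseteq> root_means_sum k"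
  using assms
proof (induction k rule: dec_induct)
  case (step k)
  have "x \<in> root_means_sum (Suc k)" if "x \<in> root_means_sum k" for x
  proof -
    have "0 \<in> root_means" by (simp add: root_means_def)
    then have "x + 0 \<in> root_means_sum (Suc k)" unfolding root_means_sum.simps using that by blast
    then show ?thesis by simp
  qed
  then show ?case using step.IH by blast
qed simp

lemma sum_in_root_means_sum:
  assumes "finite A" "\<And>i. i \<in> A \<Longrightarrow> g i \<in> root_means"
  shows "sum g A \<in> root_means_sum (card A)"
  using assms
proof (induction A rule: finite_induct)
  case (insert x A)
  have "sum g A + g x \<in> root_means_sum (Suc (card A))"
    unfolding root_means_sum.simps using insert.IH insert.prems by blast
  then show ?case using insert.hyps by (simp add: add.commute)
qed simp

lemma mean_sq_conj_sum_roots: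
  assumes "sum_roots C x"
  shows "mean_sq_conj x \<in> root_means_sum (C * C)"
proof -
  obtain zs where zs: "length zs \<le> C" "\<forall>z\<in>set zs. \<exists>n>0. z ^ n = 1" "x = sum_list zs"
    using assms unfolding sum_roots_def by blast
  obtain n where n: "\<And>z. z \<in> set zs \<Longrightarrow> n z > 0 \<and> z ^ n z = 1" using zs(2) by metis
  define N where "N = (\<Prod>z\<in>set zs. n z)"
  have N: "N > 0" unfolding N_def using n by (intro prod_pos) auto
  have zN: "z ^ N = 1" if "z \<in> set zs" for z
  proof -
    have "n z dvd N" unfolding N_def using that by (intro dvd_prodI) auto
    then show ?thesis using n[OF that] by (metis dvdE power_mult power_one)
  qed
  define l where "l = length zs"
  have x: "x = (\<Sum>i<l. zs ! i)" unfolding zs(3) l_def by (simp add: sum_list_sum_nth atLeast0LessThan)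
  have ring: "zs ! i \<in> cyc_ring N" if "i < l" for i
    using cyc_ring_root_unity[OF N zN] that by (simp add: l_def)
  have "\<exists>r\<in>root_means. mean_conj (zs ! i * cnj (zs ! j)) = of_real r" if "i < l" "j < l" for i j
  proof (rule mean_conj_root_unity[OF N])
    have zij: "zs ! i ^ N = 1" "zs ! j ^ N = 1" using zN that by (simp_all add: l_def)
    have "(zs ! i * cnj (zs ! j)) ^ N = zs ! i ^ N * cnj (zs ! j ^ N)" by (simp add: power_mult_distrib)
    then show "(zs ! i * cnj (zs ! j)) ^ N = 1" unfolding zij by simp
  qed
  then obtain r where r: "\<And>i j. i < l \<Longrightarrow> j < l \<Longrightarrow> r i j \<in> root_means \<and> mean_conj (zs ! i * cnj (zs ! j)) = of_real (r i j)"
    by metis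
  have xr: "x \<in> cyc_ring N" unfolding x by (rule cyc_ring_sum) (use ring in auto)
  have "of_real (mean_sq_conj x) = mean_conj (x * cnj x)" by (rule mean_conj_norm_sq[OF N xr, symmetric])
  also have "x * cnj x = (\<Sum>(i, j)\<in>{..<l} \<times> {..<l}. zs ! i * cnj (zs ! j))"
    unfolding x cnj_sum sum_product sum.cartesian_product ..
  also have "mean_conj \<dots> = (\<Sum>(i, j)\<in>{..<l} \<times> {..<l}. mean_conj (zs ! i * cnj (zs ! j)))"
    unfolding case_prod_beta
    by (rule mean_conj_sum[OF N]) (use ring in \<open>auto intro!: cyc_ring_mult cyc_ring_cnj[OF N]\<close>)
  also have "\<dots> = (\<Sum>(i, j)\<in>{..<l} \<times> {..<l}. of_real (r i j))"
    by (rule sum.cong) (use r in auto)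
  also have "\<dots> = of_real (\<Sum>(i, j)\<in>{..<l} \<times> {..<l}. r i j)" by (simp add: case_prod_beta)
  finally have "mean_sq_conj x = (\<Sum>(i, j)\<in>{..<l} \<times> {..<l}. r i j)" by (simp only: of_real_eq_iff)
  moreover have "(\<Sum>(i, j)\<in>{..<l} \<times> {..<l}. r i j) \<in> root_means_sum (card ({..<l} \<times> {..<l}))"
    by (rule sum_in_root_means_sum) (use r in auto)
  moreover have "card ({..<l} \<times> {..<l}) \<le> C * C" using zs(1) by (simp add: l_def mult_le_mono)
  ultimately show ?thesis using root_means_sum_mono by auto
qed

theorem theorem9p1p1:
  shows "closed mean_sq_closure \<and> mean_sq_closure \<subseteq> (\<rat> :: real set)"
proof
  show "closed mean_sq_closure" by (simp add: mean_sq_closure_def)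
  show "mean_sq_closure \<subseteq> \<rat>"
  proof
    fix y assume y: "y \<in> mean_sq_closure"
    define A where "A = {mean_sq_conj \<beta> | \<beta>. cyclotomic_integer \<beta>}"
    define b where "b = nat \<lceil>2 * (y + 1)\<rceil>"
    have b: "y + 1 \<le> real b / 2" using real_nat_ceiling_ge[of "2 * (y + 1)"] unfolding b_def by simp
    obtain C where C: "\<And>N x. N > 0 \<Longrightarrow> x \<in> cyc_ring N \<Longrightarrow> mean_sq_conj x \<le> real b / 2 \<Longrightarrow> sum_roots C x"
      using mean_sq_conj_bounds_sum_roots[of b] by blast
    \<comment> \<open>Values below y + 1 have a common bound for M, hence one C for all of them and
      one compact set of rationals.\<close>
    have sub: "A \<inter> {..<y + 1} \<subseteq> root_means_sum (C * C)"
    proof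
      fix a assume "a \<in> A \<inter> {..<y + 1}"
      then obtain \<beta> where \<beta>: "a = mean_sq_conj \<beta>" "cyclotomic_integer \<beta>" "a < y + 1" by (auto simp: A_def)
      obtain N where "N > 0" "\<beta> \<in> cyc_ring N" using cyclotomic_integer_imp_cyc_ring[OF \<beta>(2)] by blast
      then have "sum_roots C \<beta>" using C \<beta> b by auto
      then show "a \<in> root_means_sum (C * C)" unfolding \<beta>(1) by (rule mean_sq_conj_sum_roots)
    qed
    \<comment> \<open>Approximation within distance less than 1 uses only values below y + 1, so y
      is already a limit of the bounded part.\<close>
    have "y \<in> closure (A \<inter> {..<y + 1})"
    proof (rule closure_approachable[THEN iffD2], intro allI impI)
      fix e :: real assume "e > 0"
      then have "min e 1 > 0" by simp
      then obtain a where "a \<in> A" "dist a y < min e 1"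
        using y closure_approachable[of y A] unfolding mean_sq_closure_def A_def by blast
      then show "\<exists>a\<in>A \<inter> {..<y + 1}. dist a y < e" by (intro bexI[of _ a]) (auto simp: dist_real_def)
    qed
    also have "\<dots> \<subseteq> root_means_sum (C * C)"
      by (rule closure_minimal[OF sub compact_imp_closed[OF compact_root_means_sum]])
    finally show "y \<in> \<rat>" using root_means_sum_Rats by blast
  qed
qed

end
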